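(* For any $K>0$ and $b\in(0,1)$ there are $r,C,c>0$ depending only on $K$ and $b$ with the following property. Let $A$ be an $n\times n$ random matrix whose entries $A_{ij}$ are independent and satisfy $\sum_{i,j=1}^n\mathbb{E}A_{ij}^2\le Kn^2$ and $\max_{i,j}\mathcal{L}(A_{ij},1)\le b$. Denote the columns of $A$ by $A_1,\dots,A_n$ and let $H_j=\operatorname{span}\{A_i:\ i\ne j,\ i=1,\dots,n\}$, $j\le n$. Take any $j\le n$ such that $\mathbb{E}|A_j|^2\le rn^2$, and let $v_j$ be a random unit vector orthogonal to $H_j$ and measurable with respect to the $\sigma$-field generated by $H_j$. Then $$\mathcal{L}\big(\langle v_j,A_j\rangle,\varepsilon\big)\le C\varepsilon+2e^{-cn}\qquad\text{for all }\varepsilon\ge0.$$ In particular, for every such $j$, $$\mathbb{P}\{\operatorname{dist}(A_j,H_j)\le\varepsilon\}\le C\varepsilon+2e^{-cn}\qquad\text{for all }\varepsilon\ge0.$$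
   Context: All random variables are real. For a real random variable $Z$ and $t\ge0$, $\mathcal{L}(Z,t):=\sup_{u\in\mathbb{R}}\mathbb{P}\{|Z-u|<t\}$. $|\cdot|$ is the Euclidean norm, $\langle\cdot,\cdot\rangle$ the standard inner product, and $\operatorname{dist}$ the Euclidean distance in $\mathbb{R}^n$. *)

theory Defs
  imports "HOL-Probability.Probability" "Jordan_Normal_Form.VS_Connect"
begin

no_notation inner (infix "\<bullet>" 70)
no_notation vec_nth (infixl "$" 90)

text \<open>Vectors of \<open>\<real>\<^sup>n\<close> are the elements of \<open>carrier_vec n\<close>, so that the dimension \<open>n\<close> can be
  quantified after the constants. Rows and columns are numbered from \<open>0\<close>.\<close>

definition vec_norm :: "real vec \<Rightarrow> real" where
  "vec_norm x = sqrt (x \<bullet> x)"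

definition vec_setdist :: "real vec \<Rightarrow> real vec set \<Rightarrow> real" where
  "vec_setdist x H = (INF y\<in>H. vec_norm (x - y))"

definition vec_open :: "nat \<Rightarrow> real vec set \<Rightarrow> bool" where
  "vec_open n U \<longleftrightarrow> U \<subseteq> carrier_vec n \<and>
     (\<forall>x\<in>U. \<exists>e>0. \<forall>y\<in>carrier_vec n. vec_norm (y - x) < e \<longrightarrow> y \<in> U)"

definition vec_span :: "nat \<Rightarrow> real vec set \<Rightarrow> real vec set" where
  "vec_span n S = LinearCombinations.module.span class_ring (module_vec TYPE(real) n) S"

definition other_cols_span :: "nat \<Rightarrow> real mat \<Rightarrow> nat \<Rightarrow> real vec set" where
  "other_cols_span n B j = vec_span n {col B i |i. i < n \<and> i \<noteq> j}"

definition concentration :: "'w measure \<Rightarrow> ('w \<Rightarrow> real) \<Rightarrow> real \<Rightarrow> real" where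
  "concentration M Z t = (SUP u. measure M {\<omega> \<in> space M. \<bar>Z \<omega> - u\<bar> < t})"

text \<open>The \<open>\<sigma>\<close>-field generated by a random subspace \<open>H\<close> of \<open>\<real>\<^sup>n\<close>, seen as a random closed set:
  it is generated by the events that \<open>H\<close> hits \<open>U\<close>, for \<open>U\<close> open (the Effros \<open>\<sigma>\<close>-field, which on
  linear subspaces is the Borel \<open>\<sigma>\<close>-field of the Grassmannian).\<close>

definition subspace_sigma :: "'w measure \<Rightarrow> nat \<Rightarrow> ('w \<Rightarrow> real vec set) \<Rightarrow> 'w measure" where
  "subspace_sigma M n H =
     sigma (space M) {{\<omega> \<in> space M. H \<omega> \<inter> U \<noteq> {}} |U. vec_open n U}"

text \<open>The property of the constants \<open>r\<close>, \<open>C\<close>, \<open>c\<close> asserted by the theorem, for all random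
  matrices on sample spaces of type \<open>'w\<close>. HOL cannot quantify over \<open>'w\<close> inside the existential
  quantifier over the constants. The theorem therefore asserts that suitable constants exist for
  sample spaces of type \<open>nat \<Rightarrow> real\<close>, and that any such constants also work for every \<open>'w\<close>;
  together this says that they depend on \<open>K\<close> and \<open>b\<close> only.

  Second moments are taken in \<open>[0, \<infinity>]\<close>: the Bochner integral of a non-integrable
  function is \<open>0\<close>, which would make the moment bounds hold vacuously.\<close>

definition distance_bound ::
  "'w itself \<Rightarrow> real \<Rightarrow> real \<Rightarrow> real \<Rightarrow> real \<Rightarrow> real \<Rightarrow> bool" where
  "distance_bound (_ :: 'w itself) K b r C c \<longleftrightarrow>
    (\<forall>(n::nat) (M :: 'w measure) (A :: 'w \<Rightarrow> real mat).
       prob_space M \<longrightarrow>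
       (\<forall>\<omega>\<in>space M. A \<omega> \<in> carrier_mat n n) \<longrightarrow>
       prob_space.indep_vars M (\<lambda>_. borel) (\<lambda>(i, j) \<omega>. A \<omega> $$ (i, j)) ({..<n} \<times> {..<n}) \<longrightarrow>
       (\<Sum>i<n. \<Sum>j<n. \<integral>\<^sup>+\<omega>. ennreal ((A \<omega> $$ (i, j))\<^sup>2) \<partial>M) \<le> ennreal (K * (real n)\<^sup>2) \<longrightarrow>
       (\<forall>i<n. \<forall>j<n. concentration M (\<lambda>\<omega>. A \<omega> $$ (i, j)) 1 \<le> b) \<longrightarrow>
       (\<forall>j<n.
          (\<integral>\<^sup>+\<omega>. ennreal ((vec_norm (col (A \<omega>) j))\<^sup>2) \<partial>M) \<le> ennreal (r * (real n)\<^sup>2) \<longrightarrow>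
          (\<forall>v :: 'w \<Rightarrow> real vec.
             (\<forall>\<omega>\<in>space M. v \<omega> \<in> carrier_vec n) \<longrightarrow>
             (\<forall>k<n. (\<lambda>\<omega>. v \<omega> $ k) \<in>
                borel_measurable (subspace_sigma M n (\<lambda>\<omega>. other_cols_span n (A \<omega>) j))) \<longrightarrow>
             (AE \<omega> in M. vec_norm (v \<omega>) = 1) \<longrightarrow>
             (AE \<omega> in M. \<forall>h\<in>other_cols_span n (A \<omega>) j. v \<omega> \<bullet> h = 0) \<longrightarrow>
             (\<forall>\<epsilon>\<ge>0. concentration M (\<lambda>\<omega>. v \<omega> \<bullet> col (A \<omega>) j) \<epsilon>
                \<le> C * \<epsilon> + 2 * exp (- c * real n))) \<and>
          (\<forall>\<epsilon>\<ge>0. measure M {\<omega> \<in> space M.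
                vec_setdist (col (A \<omega>) j) (other_cols_span n (A \<omega>) j) \<le> \<epsilon>}
             \<le> C * \<epsilon> + 2 * exp (- c * real n))))"

end

theory Submission imports Defs begin

text \<open>A vector \<open>v\<close> orthogonal to the columns \<open>A\<^sub>i\<close>, \<open>i \<noteq> j\<close>, is shown to be spread out, outside an
  event of probability \<open>e\<^bsup>-cn\<^esup>\<close>, in the sense that the characteristic function of \<open>\<langle>v, A\<^sub>j\<rangle>\<close>
  satisfies \<open>\<bar>\<phi>(s)\<bar> \<le> max (e\<^bsup>-c s\<^sup>2\<^esup>) (e\<^bsup>-cn\<^esup>)\<close> up to an exponentially large frequency; Esseen's
  inequality and the independence of \<open>v\<close> and \<open>A\<^sub>j\<close> then give the bound.

  Let \<open>\<Psi>\<^sub>i(v, s) = \<Sum>\<^sub>k E (1 - cos (s v\<^sub>k \<xi>\<^sub>k\<^sub>i))\<close> for the symmetrised entries \<open>\<xi>\<^sub>k\<^sub>i\<close>, so that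
  \<open>\<langle>v, A\<^sub>i\<rangle>\<close> has a characteristic function of modulus at most \<open>e\<^bsup>-\<Psi>/2\<^esup>\<close>. Compressible \<open>v\<close> (few
  coordinates of size \<open>n\<^bsup>-1/2\<^esup>\<close>) are excluded by a union bound over sparse lattice points. For
  incompressible \<open>v\<close>, let \<open>D\<close> be the first frequency on a grid at which \<open>\<Psi>\<^sub>i\<close> is small for some column
  \<open>i\<close> with \<open>E \<bar>A\<^sub>i\<bar>\<^sup>2 \<le> r n\<^sup>2\<close>. Below \<open>D\<close> all such columns have a bounded density, so a point
  of a lattice of mesh about \<open>1 / (D \<surd>n)\<close> is nearly orthogonal to all of them with probability at most
  \<open>(C/D)\<^bsup>n - O(1)\<^esup>\<close>. On the other hand, smallness of \<open>\<Psi>\<^sub>i\<close> at \<open>D\<close> forces \<open>D v\<^sub>k \<xi>\<^sub>k\<^sub>i\<close> to be close to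
  \<open>2 \<pi> \<int>\<close> for most \<open>k\<close>, which leaves only \<open>(\<rho> D)\<^bsup>n\<^esup>\<close> candidates among the lattice points with \<open>\<rho>\<close> as
  small as needed when \<open>r\<close> is small.

  The total second moment bound does not control single columns. Columns of large norm are handled
  by dividing them by the weights \<open>w2\<close>, whose product is exponential in \<open>n\<close>: rounding is done with
  respect to the rescaled columns, and the inequality \<open>1 / (1 + x\<^sup>2) \<ge> e\<^bsup>-x\<^sup>2/w\<^esup> / w\<close> for \<open>w \<ge> 1\<close> absorbs
  the weights in the probability estimates.\<close>

section \<open>Uniform averages and symmetrised cosine moments\<close>

text \<open>The obstacle is that second moments give no bound on the operator norm of A. Rounding is
  therefore random: its error is then small in square mean after applying A, not in the worst case.
  The small factor \<rho> comes from a dichotomy for the symmetrised entries of one column. If most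
  of them stay below about \<surd>n / D, nothing wraps around modulo 2 \<pi> and \<Psi> is quadratic
  in the frequency. Otherwise a positive fraction has, with positive probability, size between about
  \<surd>n / D and \<surd>(r n). The lower limit makes the multiples by lattice coordinates sweep a
  length of order one, the upper limit makes the steps of this sweep of order \<surd>r; so only a
  small proportion of the values of such a coordinate come near 2 \<pi> \<int>. The same alternative
  excludes frequencies below about 1 / \<surd>r. The frequency grid has spacing 1 / \<surd>n: since
  |v_k| \<le> 1 and a column has second moment at most r n^2, one grid step changes \<Psi> by O(r n)
  beyond a factor 2. At most K / r columns violate this moment bound; they cost boundedly many
  factors D, which is affordable as ln D is a small multiple of n.\<close>

definition unif01 :: "real measure" where
  "unif01 = uniform_measure lborel {0..1}"

lemma prob_space_unif01: "prob_space unif01"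
  unfolding unif01_def by (rule prob_space_uniform_measure) auto

lemma sets_unif01 [measurable_cong, simp]: "sets unif01 = sets borel"
  by (simp add: unif01_def)

lemma space_unif01 [simp]: "space unif01 = UNIV"
  by (simp add: unif01_def)

lemma AE_unif01: "AE t in unif01. t \<in> {0..1}"
  unfolding unif01_def by (rule AE_uniform_measureI) auto

lemma integrable_unif01:
  fixes g :: "real \<Rightarrow> real"
  assumes "g \<in> borel_measurable borel" and "\<And>t. t \<in> {0..1} \<Longrightarrow> \<bar>g t\<bar> \<le> B"
  shows "integrable unif01 g"
proof -
  interpret prob_space unif01 by (rule prob_space_unif01)
  show ?thesis
    using AE_unif01 assms by (intro integrable_const_bound[of _ B]) auto
qed

lemma integral_unif01_FTC:
  fixes g G :: "real \<Rightarrow> real"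
  assumes "\<And>t. (G has_real_derivative g t) (at t)" and "\<And>t. isCont g t"
  shows "(\<integral>t. g t \<partial>unif01) = G 1 - G 0"
proof -
  have m: "g \<in> borel_measurable borel"
    using assms(2) by (intro borel_measurable_continuous_onI) (simp add: continuous_at_imp_continuous_on)
  have "(\<integral>t. g t \<partial>unif01) = (\<integral>t. indicator {0..1} t *\<^sub>R g t \<partial>lborel)"
  proof -
    have "unif01 = density lborel (\<lambda>x. ennreal (indicator {0..1} x))"
      unfolding unif01_def uniform_measure_def
      by (intro density_cong) (auto simp: indicator_def)
    then show ?thesis using m by (subst \<open>unif01 = _\<close>, subst integral_density) auto
  qed
  also have "\<dots> = G 1 - G 0"
    using integral_FTC_atLeastAtMost[of 0 1 G g] assms
    by (simp add: has_real_derivative_iff_has_vector_derivative has_vector_derivative_at_within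
        continuous_at_imp_continuous_on)
  finally show ?thesis .
qed

lemma swap_unif01:
  fixes g :: "real \<times> 'a \<Rightarrow> real"
  assumes "prob_space \<mu>" and [measurable]: "g \<in> borel_measurable (borel \<Otimes>\<^sub>M \<mu>)"
    and "\<And>t x. t \<in> {0..1} \<Longrightarrow> \<bar>g (t, x)\<bar> \<le> B"
  shows "(\<integral>t. (\<integral>x. g (t, x) \<partial>\<mu>) \<partial>unif01) = (\<integral>x. (\<integral>t. g (t, x) \<partial>unif01) \<partial>\<mu>)"
proof -
  interpret U: prob_space unif01 by (rule prob_space_unif01)
  interpret m: prob_space \<mu> by fact
  interpret pair_prob_space unif01 \<mu> ..
  have B: "0 \<le> B" using assms(3)[of 0 undefined] by auto
  \<comment> \<open>The bound on \<open>g\<close> holds only for \<open>t\<close> in [0,1]. Cutting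
    off outside, which \<open>unif01\<close> does not see, makes it global, so that Fubini
    applies.\<close>
  define g' where "g' = (\<lambda>p. indicator {0..1} (fst p) * g p)"
  have [measurable]: "g' \<in> borel_measurable (borel \<Otimes>\<^sub>M \<mu>)"
    unfolding g'_def by measurable
  have s: "sets (unif01 \<Otimes>\<^sub>M \<mu>) = sets (borel \<Otimes>\<^sub>M \<mu>)"
    by (rule sets_pair_measure_cong[OF sets_unif01 refl])
  have meas: "g' \<in> borel_measurable (unif01 \<Otimes>\<^sub>M \<mu>)" "g \<in> borel_measurable (unif01 \<Otimes>\<^sub>M \<mu>)"
    using measurable_cong_sets[OF s refl, of borel] by auto
  have bd: "\<bar>g' p\<bar> \<le> B" for p
    using assms(3)[of "fst p" "snd p"] B by (auto simp: g'_def indicator_def)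
  have int: "integrable (unif01 \<Otimes>\<^sub>M \<mu>) (\<lambda>(t, x). g' (t, x))"
    using bd meas by (intro integrable_const_bound[of _ B]) (auto split: prod.splits)
  have "(\<integral>t. (\<integral>x. g (t, x) \<partial>\<mu>) \<partial>unif01) = (\<integral>t. (\<integral>x. g' (t, x) \<partial>\<mu>) \<partial>unif01)"
  proof (rule integral_cong_AE)
    show "(\<lambda>t. \<integral>x. g (t, x) \<partial>\<mu>) \<in> borel_measurable unif01"
      using meas(2) by (intro m.borel_measurable_lebesgue_integral) auto
    show "(\<lambda>t. \<integral>x. g' (t, x) \<partial>\<mu>) \<in> borel_measurable unif01"
      using meas(1) by (intro m.borel_measurable_lebesgue_integral) auto
    show "AE t in unif01. (\<integral>x. g (t, x) \<partial>\<mu>) = (\<integral>x. g' (t, x) \<partial>\<mu>)"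
      using AE_unif01 by eventually_elim (simp add: g'_def)
  qed
  also have "\<dots> = (\<integral>x. (\<integral>t. g' (t, x) \<partial>unif01) \<partial>\<mu>)"
    using Fubini_integral[OF int] by simp
  also have "\<dots> = (\<integral>x. (\<integral>t. g (t, x) \<partial>unif01) \<partial>\<mu>)"
  proof (rule Bochner_Integration.integral_cong[OF refl])
    fix x assume x: "x \<in> space \<mu>"
    have [measurable]: "(\<lambda>t. g (t, x)) \<in> borel_measurable borel" using x by measurable
    show "(\<integral>t. g' (t, x) \<partial>unif01) = (\<integral>t. g (t, x) \<partial>unif01)"
      using AE_unif01 by (intro integral_cong_AE) (auto simp: g'_def)
  qed
  finally show ?thesis .
qed

section \<open>Quadratic bounds for \<open>1 - cos\<close> and its average over frequencies\<close>

lemma one_minus_cos_le_2 [simp]: "1 - cos x \<le> 2" for x :: real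
  using cos_ge_minus_one[of x] by linarith

lemma one_minus_cos_nonneg [simp]: "0 \<le> 1 - cos x" for x :: real
  by simp

lemma one_minus_cos_le: "1 - cos x \<le> x\<^sup>2 / 2" for x :: real
proof -
  have "1 - cos x = 2 * (sin (x/2))\<^sup>2" using cos_double_sin[of "x/2"] by simp
  also have "(sin (x/2))\<^sup>2 \<le> (x/2)\<^sup>2"
    using abs_sin_x_le_abs_x[of "x/2"] abs_le_square_iff by blast
  finally show ?thesis by (simp add: power2_eq_square)
qed

lemma one_minus_cos_ge_unit:
  fixes x :: real
  assumes "\<bar>x\<bar> \<le> 1"
  shows "x\<^sup>2 / 4 \<le> 1 - cos x"
proof -
  define y where "y = \<bar>x\<bar> / 2"
  have y: "0 \<le> y" "y \<le> 1/2" using assms by (auto simp: y_def)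
  have "\<bar>sin y - (\<Sum>m<3. sin_coeff m * y ^ m)\<bar> \<le> inverse (fact 3) * \<bar>y\<bar> ^ 3"
    by (rule Maclaurin_sin_bound)
  moreover have "(\<Sum>m<3. sin_coeff m * y ^ m) = y"
    by (simp add: numeral_eq_Suc sin_coeff_def)
  ultimately have "\<bar>sin y - y\<bar> \<le> y ^ 3 / 6" using y by (simp add: fact_numeral)
  moreover have "y ^ 3 \<le> y / 4"
    using y mult_mono[of y "1/2" y "1/2"] mult_left_mono[of "y*y" "1/4" y] by (simp add: power3_eq_cube mult.assoc)
  ultimately have "sin y \<ge> 23/24 * y" by linarith
  then have "(23/24 * y)\<^sup>2 \<le> (sin y)\<^sup>2" using y by (intro power_mono) auto
  moreover have "(sin y)\<^sup>2 = (sin (x/2))\<^sup>2" by (simp add: y_def abs_if)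
  moreover have "y\<^sup>2 = x\<^sup>2 / 4" by (simp add: y_def power_divide)
  moreover have "1 - cos x = 2 * (sin (x/2))\<^sup>2" using cos_double_sin[of "x/2"] by simp
  ultimately show ?thesis by (simp add: power_mult_distrib power_divide) (use zero_le_power2[of x] in linarith)
qed

text \<open>Beyond 1 the monotonicity of cos gives \<open>1 - cos x \<ge> 1/4\<close>, while
  \<open>x\<^sup>2 \<le> 10\<close> up to \<pi>; hence the constant 40.\<close>

lemma one_minus_cos_ge_pi:
  fixes x :: real
  assumes "\<bar>x\<bar> \<le> pi"
  shows "x\<^sup>2 / 40 \<le> 1 - cos x"
proof (cases "\<bar>x\<bar> \<le> 1")
  case True
  then show ?thesis using one_minus_cos_ge_unit[of x] zero_le_power2[of x] by linarith
next
  case False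
  have "cos \<bar>x\<bar> \<le> cos 1" using False assms by (intro cos_monotone_0_pi_le) auto
  then have "cos x \<le> cos 1" by (simp add: abs_if split: if_splits)
  moreover have "1/4 \<le> 1 - cos (1::real)" using one_minus_cos_ge_unit[of 1] by simp
  moreover have "x\<^sup>2 \<le> 10"
  proof -
    have "x\<^sup>2 \<le> pi\<^sup>2" using assms abs_le_square_iff[of x pi] by simp
    also have "\<dots> \<le> (3.15)\<^sup>2" using pi_approx by (intro power_mono) auto
    finally show ?thesis by (simp add: power2_eq_square)
  qed
  ultimately show ?thesis by simp
qed

text \<open>Since \<open>1 - cos x\<close> is half the square of the distance from exp(ix) to 1,
  this is the triangle inequality on the circle, squared. All comparisons of \<open>Psi\<close> at
  nearby points rest on it.\<close>

lemma one_minus_cos_add: "1 - cos (x + y) \<le> 2 * (1 - cos x) + 2 * (1 - cos y)" for x y :: real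
proof -
  define a b where "a = x/2" and "b = y/2"
  have "\<bar>sin (a + b)\<bar> \<le> \<bar>sin a\<bar> + \<bar>sin b\<bar>"
  proof -
    have "\<bar>sin a * cos b\<bar> \<le> \<bar>sin a\<bar>" "\<bar>cos a * sin b\<bar> \<le> \<bar>sin b\<bar>"
      by (auto simp: abs_mult intro: mult_left_le mult_left_le_one_le)
    then show ?thesis unfolding sin_add by linarith
  qed
  then have "(sin (a + b))\<^sup>2 \<le> (\<bar>sin a\<bar> + \<bar>sin b\<bar>)\<^sup>2"
    by (metis abs_ge_zero power2_abs power_mono)
  also have "\<dots> \<le> 2 * (sin a)\<^sup>2 + 2 * (sin b)\<^sup>2"
    using zero_le_power2[of "\<bar>sin a\<bar> - \<bar>sin b\<bar>"] by (simp add: power2_diff power2_sum)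
  finally have "2 * (sin (a + b))\<^sup>2 \<le> 2 * (2 * (sin a)\<^sup>2) + 2 * (2 * (sin b)\<^sup>2)" by simp
  moreover have "2 * (sin (z/2))\<^sup>2 = 1 - cos z" for z :: real using cos_double_sin[of "z/2"] by simp
  ultimately show ?thesis
    unfolding a_def b_def by (metis add_divide_distrib)
qed

lemma integral_one_minus_cos:
  fixes u :: real
  assumes "u \<noteq> 0"
  shows "(\<integral>t. 1 - cos (t * u) \<partial>unif01) = 1 - sin u / u"
proof -
  have "(\<integral>t. 1 - cos (t * u) \<partial>unif01) = (1 - sin (1 * u) / u) - (0 - sin (0 * u) / u)"
    by (rule integral_unif01_FTC) (use assms in \<open>auto intro!: derivative_eq_intros continuous_intros\<close>)
  then show ?thesis by simp
qed

text \<open>Averaging over \<open>t\<close> removes the resonances where \<open>t * u\<close> is a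
  multiple of 2 \<pi>. For \<open>|u| \<le> 2\<close> the quadratic bound holds on the whole range
  and integrates to \<open>u\<^sup>2 / 120\<close>; for larger \<open>u\<close> the average is
  \<open>1 - sin u / u \<ge> 1/2\<close>.\<close>

lemma integral_one_minus_cos_ge:
  fixes u :: real
  shows "min 1 (u\<^sup>2) / 120 \<le> (\<integral>t. 1 - cos (t * u) \<partial>unif01)"
proof (cases "\<bar>u\<bar> \<le> 2")
  case True
  have "u\<^sup>2 / 120 = u\<^sup>2 * 1^3 / 120 - u\<^sup>2 * 0^3 / 120" by simp
  also have "\<dots> = (\<integral>t. u\<^sup>2 * t\<^sup>2 / 40 \<partial>unif01)"
    by (rule integral_unif01_FTC[symmetric]) (auto intro!: derivative_eq_intros continuous_intros)
  also have "\<dots> \<le> (\<integral>t. 1 - cos (t * u) \<partial>unif01)"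
  proof (rule integral_mono_AE)
    show "integrable unif01 (\<lambda>t. u\<^sup>2 * t\<^sup>2 / 40)"
      by (rule integrable_unif01[of _ "u\<^sup>2/40"]) (auto simp: mult_left_le power_le_one divide_right_mono)
    show "integrable unif01 (\<lambda>t. 1 - cos (t * u))"
      by (rule integrable_unif01[of _ 2]) auto
    show "AE t in unif01. u\<^sup>2 * t\<^sup>2 / 40 \<le> 1 - cos (t * u)"
      using AE_unif01
    proof eventually_elim
      case (elim t)
      then have "\<bar>t * u\<bar> \<le> 1 * 2" using True unfolding abs_mult by (intro mult_mono) auto
      then have "\<bar>t * u\<bar> \<le> pi" using pi_gt3 by linarith
      from one_minus_cos_ge_pi[OF this] show ?case by (simp add: power_mult_distrib mult.commute)
    qed
  qed
  finally show ?thesis by (smt (verit) divide_right_mono min.cobounded2)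
next
  case False
  then have "u \<noteq> 0" by auto
  have "\<bar>sin u\<bar> * 2 \<le> \<bar>u\<bar>" using False abs_sin_le_one[of u] by linarith
  then have "\<bar>sin u / u\<bar> \<le> 1 / 2"
    using \<open>u \<noteq> 0\<close> by (simp add: abs_divide divide_simps)
  then have "1/2 \<le> 1 - sin u / u" by linarith
  moreover have "min 1 (u\<^sup>2) / 120 \<le> 1 / 2" by linarith
  ultimately show ?thesis unfolding integral_one_minus_cos[OF \<open>u \<noteq> 0\<close>] by linarith
qed

text \<open>For the symmetrisation of a law with characteristic function \<phi> this is 1 -
  |\<phi>(t)|^2, see \<open>cmod_char_eq_defect\<close>.\<close>

definition defect :: "real measure \<Rightarrow> real \<Rightarrow> real" where
  "defect \<nu> t = (\<integral>x. 1 - cos (t * x) \<partial>\<nu>)"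

context real_distribution
begin

lemma integrable_one_minus_cos [simp, intro]: "integrable M (\<lambda>x. 1 - cos (t * x))"
  by (rule integrable_const_bound[of _ 2]) auto

lemma defect_nonneg: "0 \<le> defect M t"
  unfolding defect_def by (rule Bochner_Integration.integral_nonneg) simp

lemma defect_le_2: "defect M t \<le> 2"
proof -
  have "defect M t \<le> (\<integral>x. 2 \<partial>M)"
    unfolding defect_def by (rule integral_mono) auto
  then show ?thesis using prob_space by simp
qed

lemma defect_add: "defect M (s + t) \<le> 2 * defect M s + 2 * defect M t"
proof -
  have "defect M (s + t) \<le> (\<integral>x. 2 * (1 - cos (s * x)) + 2 * (1 - cos (t * x)) \<partial>M)"
    unfolding defect_def
    using integrable_one_minus_cos[of "s + t"] one_minus_cos_add[of "s * x" "t * x" for x]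
    by (intro integral_mono Bochner_Integration.integrable_add integrable_mult_right integrable_one_minus_cos)
      (auto simp: distrib_right)
  also have "\<dots> = (\<integral>x. 2 * (1 - cos (s * x)) \<partial>M) + (\<integral>x. 2 * (1 - cos (t * x)) \<partial>M)"
    by (intro Bochner_Integration.integral_add integrable_mult_right integrable_one_minus_cos)
  also have "\<dots> = 2 * defect M s + 2 * defect M t"
    unfolding defect_def by (simp only: integral_mult_right_zero)
  finally show ?thesis .
qed

lemma defect_le_moment:
  assumes "integrable M (\<lambda>x. x\<^sup>2)"
  shows "defect M t \<le> t\<^sup>2 / 2 * (\<integral>x. x\<^sup>2 \<partial>M)"
proof -
  have "defect M t \<le> (\<integral>x. t\<^sup>2 / 2 * x\<^sup>2 \<partial>M)"
    unfolding defect_def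
    using assms one_minus_cos_le[of "t * x" for x]
    by (intro integral_mono integrable_mult_right integrable_one_minus_cos) (auto simp: power_mult_distrib)
  then show ?thesis by simp
qed

lemma defect_ge:
  assumes "measure M {x. 1 \<le> \<bar>x\<bar> \<and> \<bar>t * x\<bar> \<le> 1} \<ge> p"
  shows "p * t\<^sup>2 / 4 \<le> defect M t"
proof -
  let ?S = "{x. 1 \<le> \<bar>x\<bar> \<and> \<bar>t * x\<bar> \<le> 1}"
  have [measurable]: "?S \<in> sets M" by simp
  have "p * (t\<^sup>2 / 4) \<le> measure M ?S * (t\<^sup>2 / 4)" using assms by (intro mult_right_mono) auto
  also have "\<dots> = (\<integral>x. indicator ?S x * (t\<^sup>2 / 4) \<partial>M)" by simp
  also have "\<dots> \<le> defect M t"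
    unfolding defect_def
  proof (rule integral_mono)
    show "integrable M (\<lambda>x. indicator ?S x * (t\<^sup>2 / 4))"
      by (intro integrable_mult_left integrable_real_indicator) (auto simp: emeasure_eq_measure)
    fix x
    show "indicator ?S x * (t\<^sup>2 / 4) \<le> 1 - cos (t * x)"
    proof (cases "x \<in> ?S")
      case True
      then have "t\<^sup>2 * 1 \<le> t\<^sup>2 * x\<^sup>2"
        using abs_le_square_iff[of 1 x] by (intro mult_left_mono) auto
      then have "t\<^sup>2 / 4 \<le> (t * x)\<^sup>2 / 4" by (simp add: power_mult_distrib)
      also have "\<dots> \<le> 1 - cos (t * x)" using True by (intro one_minus_cos_ge_unit) auto
      finally show ?thesis using True by simp
    qed auto
  qed auto
  finally show ?thesis by simp
qed

lemma defect_measurable [measurable]: "defect M \<in> borel_measurable borel"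
proof -
  have "(\<lambda>t. \<integral>x. 1 - cos (t * x) \<partial>M) \<in> borel_measurable borel"
    by (rule borel_measurable_lebesgue_integral) measurable
  then show ?thesis by (simp add: defect_def[abs_def])
qed

text \<open>At a single frequency the defect may vanish, as it does for lattice laws. On average
  over \<open>t\<close> it suffices that the law has mass \<open>p\<close> away from 0: Fubini
  reduces the claim to \<open>integral_one_minus_cos_ge\<close> for each \<open>x\<close>.\<close>

lemma integral_defect_ge:
  assumes "measure M {x. 1 \<le> \<bar>x\<bar>} \<ge> p"
  shows "p * min 1 (y\<^sup>2) / 120 \<le> (\<integral>t. defect M (t * y) \<partial>unif01)"
proof -
  let ?S = "{x::real. 1 \<le> \<bar>x\<bar>}"
  have sw: "(\<integral>t. defect M (t * y) \<partial>unif01) = (\<integral>x. (\<integral>t. 1 - cos (t * y * x) \<partial>unif01) \<partial>M)"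
    unfolding defect_def
    by (rule swap_unif01[of M "\<lambda>(t, x). 1 - cos (t * y * x)" 2, simplified])
      (auto simp: prob_space_axioms)
  have m: "(\<lambda>x. \<integral>t. 1 - cos (t * y * x) \<partial>unif01) \<in> borel_measurable M"
  proof -
    interpret U: prob_space unif01 by (rule prob_space_unif01)
    show ?thesis by (rule U.borel_measurable_lebesgue_integral) measurable
  qed
  have bd: "0 \<le> (\<integral>t. 1 - cos (t * z) \<partial>unif01)" "(\<integral>t. 1 - cos (t * z) \<partial>unif01) \<le> 2" for z
  proof -
    interpret U: prob_space unif01 by (rule prob_space_unif01)
    show "0 \<le> (\<integral>t. 1 - cos (t * z) \<partial>unif01)" by (rule Bochner_Integration.integral_nonneg) simp
    have "(\<integral>t. 1 - cos (t * z) \<partial>unif01) \<le> (\<integral>t. 2 \<partial>unif01)"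
      by (rule integral_mono) (auto intro!: integrable_unif01[of _ 2])
    then show "(\<integral>t. 1 - cos (t * z) \<partial>unif01) \<le> 2" by (simp add: U.prob_space[simplified])
  qed
  have "p * (min 1 (y\<^sup>2) / 120) \<le> measure M ?S * (min 1 (y\<^sup>2) / 120)"
    using assms by (intro mult_right_mono) auto
  also have "\<dots> = (\<integral>x. indicator ?S x * (min 1 (y\<^sup>2) / 120) \<partial>M)" by simp
  also have "\<dots> \<le> (\<integral>x. (\<integral>t. 1 - cos (t * y * x) \<partial>unif01) \<partial>M)"
  proof (rule integral_mono)
    show "integrable M (\<lambda>x. indicator ?S x * (min 1 (y\<^sup>2) / 120))"
      by (intro integrable_mult_left integrable_real_indicator) (auto simp: emeasure_eq_measure)
    show "integrable M (\<lambda>x. \<integral>t. 1 - cos (t * y * x) \<partial>unif01)"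
      using m bd[of "y * _"] by (intro integrable_const_bound[of _ 2]) (auto simp: mult.assoc abs_of_nonneg)
    fix x
    show "indicator ?S x * (min 1 (y\<^sup>2) / 120) \<le> (\<integral>t. 1 - cos (t * y * x) \<partial>unif01)"
    proof (cases "x \<in> ?S")
      case True
      then have "y\<^sup>2 * 1 \<le> y\<^sup>2 * x\<^sup>2"
        using abs_le_square_iff[of 1 x] by (intro mult_left_mono) auto
      then have "min 1 (y\<^sup>2) / 120 \<le> min 1 ((y * x)\<^sup>2) / 120" by (auto simp: power_mult_distrib min_def)
      also have "\<dots> \<le> (\<integral>t. 1 - cos (t * (y * x)) \<partial>unif01)" by (rule integral_one_minus_cos_ge)
      finally show ?thesis using True by (simp add: mult.assoc)
    next
      case False
      then show ?thesis using bd(1)[of "y * x"] by (simp add: mult.assoc)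
    qed
  qed
  finally show ?thesis using sw by simp
qed

end

section \<open>Rounding to a lattice\<close>

text \<open>One coordinate of the randomised rounding. Rounding \<open>v / m\<close> up with
  probability \<open>p\<close>, its fractional part, gives an error of mean zero, so only a variance
  of at most \<open>m\<^sup>2\<close> times the sum of \<open>T\<^sup>2\<close> is added. The
  penalty \<mu> charges a nonzero result, which has probability at most
  \<open>min 1 (|v| / m)\<close>. One of the two outcomes does no worse than the mean.\<close>

lemma ex_int_round_step:
  fixes S T :: "'i \<Rightarrow> real" and v m \<mu> :: real
  assumes "m > 0" "\<mu> \<ge> 0" "finite I"
  shows "\<exists>z::int. \<bar>m * real_of_int z - v\<bar> \<le> m \<and>
     (\<Sum>i\<in>I. (S i + T i * (m * real_of_int z - v))\<^sup>2) + \<mu> * (if z \<noteq> (0::int) then 1 else 0)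
      \<le> (\<Sum>i\<in>I. (S i)\<^sup>2) + m\<^sup>2 * (\<Sum>i\<in>I. (T i)\<^sup>2) + \<mu> * min 1 (\<bar>v\<bar> / m)"
proof -
  define z where "z = \<lfloor>v / m\<rfloor>"
  define p where "p = v / m - z"
  have p: "0 \<le> p" "p < 1" unfolding p_def z_def by linarith+
  have v: "v = m * (z + p)" using assms by (simp add: p_def)
  define Q where "Q = (\<lambda>d. \<Sum>i\<in>I. (S i + T i * d)\<^sup>2)"
  have Q: "Q d = (\<Sum>i\<in>I. (S i)\<^sup>2) + 2 * d * (\<Sum>i\<in>I. S i * T i) + d\<^sup>2 * (\<Sum>i\<in>I. (T i)\<^sup>2)" for d
    unfolding Q_def by (simp add: power2_sum power_mult_distrib sum.distrib sum_distrib_left algebra_simps)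
  define g where "g = (\<lambda>z::int. \<mu> * (if z \<noteq> (0::int) then 1 else 0 :: real))"
  define d0 d1 where "d0 = m * real_of_int z - v" and "d1 = m * real_of_int (z + 1) - v"
  have d: "d0 = - (m * p)" "d1 = m * (1 - p)" unfolding d0_def d1_def v by (auto simp: algebra_simps)
  have "(1 - p) * Q d0 + p * Q d1 = (\<Sum>i\<in>I. (S i)\<^sup>2) + p * (1 - p) * (m\<^sup>2 * (\<Sum>i\<in>I. (T i)\<^sup>2))"
    unfolding Q d by (simp add: algebra_simps power2_eq_square)
  also have "\<dots> \<le> (\<Sum>i\<in>I. (S i)\<^sup>2) + 1 * (m\<^sup>2 * (\<Sum>i\<in>I. (T i)\<^sup>2))"
    using p by (intro add_left_mono mult_right_mono) (auto simp: mult_le_one sum_nonneg)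
  finally have 1: "(1 - p) * Q d0 + p * Q d1 \<le> (\<Sum>i\<in>I. (S i)\<^sup>2) + m\<^sup>2 * (\<Sum>i\<in>I. (T i)\<^sup>2)" by simp
  have 2: "(1 - p) * g z + p * g (z + 1) \<le> \<mu> * min 1 (\<bar>v\<bar> / m)"
  proof -
    have vm: "\<bar>v\<bar> / m = \<bar>z + p\<bar>" unfolding v using assms by (simp add: abs_mult)
    \<comment> \<open>Only for \<open>z = 0\<close> and \<open>z = -1\<close> is 0 one of the two
      candidates; the nonzero one then has probability \<open>p\<close> or \<open>1 - p\<close>,
      which is exactly \<open>|v| / m\<close>.\<close>
    consider "z = 0" | "z = -1" | "z \<ge> 1" | "z \<le> -2" by linarith
    then have "(1 - p) * (if z \<noteq> (0::int) then 1 else 0) + p * (if z + 1 \<noteq> (0::int) then 1 else 0) \<le> min 1 (\<bar>v\<bar> / m)"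
    proof cases
      case 3
      then have "1 \<le> \<bar>z + p\<bar>" using p by linarith
      then show ?thesis using p unfolding vm by auto
    next
      case 4
      then have "z + p \<le> - 1" using p by linarith
      then have "1 \<le> \<bar>z + p\<bar>" by linarith
      then show ?thesis using p unfolding vm by auto
    qed (use p in \<open>auto simp: vm\<close>)
    then have "\<mu> * ((1 - p) * (if z \<noteq> (0::int) then 1 else 0) + p * (if z + 1 \<noteq> (0::int) then 1 else 0)) \<le> \<mu> * min 1 (\<bar>v\<bar> / m)"
      using assms by (intro mult_left_mono) auto
    then show ?thesis unfolding g_def by (simp add: algebra_simps)
  qed
  let ?R = "(\<Sum>i\<in>I. (S i)\<^sup>2) + m\<^sup>2 * (\<Sum>i\<in>I. (T i)\<^sup>2) + \<mu> * min 1 (\<bar>v\<bar> / m)"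
  have 3: "(1 - p) * (Q d0 + g z) + p * (Q d1 + g (z + 1)) \<le> ?R"
    using 1 2 by (simp add: algebra_simps)
  have "Q d0 + g z \<le> ?R \<or> Q d1 + g (z + 1) \<le> ?R"
  proof (rule ccontr)
    assume "\<not> ?thesis"
    then have a: "?R < Q d0 + g z" "?R < Q d1 + g (z + 1)" by auto
    have "(1 - p) * ?R < (1 - p) * (Q d0 + g z)" using a p by (intro mult_strict_left_mono) auto
    moreover have "p * ?R \<le> p * (Q d1 + g (z + 1))" using a p by (intro mult_left_mono) auto
    ultimately have "(1 - p) * ?R + p * ?R < (1 - p) * (Q d0 + g z) + p * (Q d1 + g (z + 1))" by linarith
    moreover have "(1 - p) * ?R + p * ?R = ?R" by (simp add: algebra_simps)
    ultimately show False using 3 by linarith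
  qed
  moreover have "\<bar>d0\<bar> \<le> m" "\<bar>d1\<bar> \<le> m" using p assms by (auto simp: d abs_mult mult_left_le)
  ultimately have "(\<bar>d0\<bar> \<le> m \<and> Q d0 + g z \<le> ?R) \<or> (\<bar>d1\<bar> \<le> m \<and> Q d1 + g (z + 1) \<le> ?R)" by blast
  then show ?thesis
  proof
    assume "\<bar>d0\<bar> \<le> m \<and> Q d0 + g z \<le> ?R"
    then show ?thesis unfolding Q_def g_def d0_def by (intro exI[of _ z]) simp
  next
    assume "\<bar>d1\<bar> \<le> m \<and> Q d1 + g (z + 1) \<le> ?R"
    then show ?thesis unfolding Q_def g_def d1_def by (intro exI[of _ "z + 1"]) (simp only: of_int_add of_int_1)
  qed
qed

text \<open>Randomised rounding to the lattice \<open>m\<int>\<^sup>n\<close>, derandomised by the method of conditional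
  expectations: \<open>v\<^sub>k\<close> is rounded up or down with mean \<open>v\<^sub>k\<close>, so that the cross terms vanish.\<close>

lemma ex_lattice_rounding:
  fixes T :: "'i \<Rightarrow> nat \<Rightarrow> real" and v :: "nat \<Rightarrow> real" and m \<mu> :: real
  assumes "m > 0" "\<mu> \<ge> 0" "finite I"
  shows "\<exists>z::nat \<Rightarrow> int. (\<forall>k. k < n \<longrightarrow> \<bar>m * real_of_int (z k) - v k\<bar> \<le> m) \<and> (\<forall>k\<ge>n. z k = (0::int)) \<and>
     (\<Sum>i\<in>I. (\<Sum>k<n. T i k * (m * real_of_int (z k) - v k))\<^sup>2) + \<mu> * card {k. k < n \<and> z k \<noteq> (0::int)}
      \<le> m\<^sup>2 * (\<Sum>i\<in>I. \<Sum>k<n. (T i k)\<^sup>2) + \<mu> * (\<Sum>k<n. min 1 (\<bar>v k\<bar> / m))"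
proof (induction n)
  case 0
  show ?case by (rule exI[of _ "\<lambda>_. 0"]) simp
next
  case (Suc n)
  then obtain z where z: "\<forall>k. k < n \<longrightarrow> \<bar>m * real_of_int (z k) - v k\<bar> \<le> m" "\<forall>k\<ge>n. z k = (0::int)"
    "(\<Sum>i\<in>I. (\<Sum>k<n. T i k * (m * real_of_int (z k) - v k))\<^sup>2) + \<mu> * card {k. k < n \<and> z k \<noteq> (0::int)}
      \<le> m\<^sup>2 * (\<Sum>i\<in>I. \<Sum>k<n. (T i k)\<^sup>2) + \<mu> * (\<Sum>k<n. min 1 (\<bar>v k\<bar> / m))"
    by (elim exE conjE) (rule that)
  obtain w :: int where w: "\<bar>m * real_of_int w - v n\<bar> \<le> m"
    "(\<Sum>i\<in>I. ((\<Sum>k<n. T i k * (m * real_of_int (z k) - v k)) + T i n * (m * real_of_int w - v n))\<^sup>2) + \<mu> * (if w \<noteq> (0::int) then 1 else 0)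
      \<le> (\<Sum>i\<in>I. (\<Sum>k<n. T i k * (m * real_of_int (z k) - v k))\<^sup>2) + m\<^sup>2 * (\<Sum>i\<in>I. (T i n)\<^sup>2) + \<mu> * min 1 (\<bar>v n\<bar> / m)"
    using ex_int_round_step[OF assms, where v = "v n" and S = "\<lambda>i. \<Sum>k<n. T i k * (m * real_of_int (z k) - v k)" and T = "\<lambda>i. T i n"]
    by (elim exE conjE) (rule that)
  define z' where "z' = z(n := w)"
  have eq: "(\<Sum>k<n. T i k * (m * real_of_int (z' k) - v k)) = (\<Sum>k<n. T i k * (m * real_of_int (z k) - v k))" for i
    by (intro sum.cong) (auto simp: z'_def)
  have "{k. k < Suc n \<and> z' k \<noteq> (0::int)} = {k. k < n \<and> z k \<noteq> (0::int)} \<union> (if w \<noteq> (0::int) then {n} else {})"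
    by (auto simp: z'_def less_Suc_eq)
  then have c: "real (card {k. k < Suc n \<and> z' k \<noteq> (0::int)}) = card {k. k < n \<and> z k \<noteq> (0::int)} + (if w \<noteq> (0::int) then 1 else 0)"
    by (auto simp: card_insert_if)
  have "(\<Sum>i\<in>I. (\<Sum>k<Suc n. T i k * (m * real_of_int (z' k) - v k))\<^sup>2) + \<mu> * card {k. k < Suc n \<and> z' k \<noteq> (0::int)}
     \<le> m\<^sup>2 * (\<Sum>i\<in>I. \<Sum>k<Suc n. (T i k)\<^sup>2) + \<mu> * (\<Sum>k<Suc n. min 1 (\<bar>v k\<bar> / m))"
    using add_mono[OF z(3) w(2)] unfolding c
    by (cases "w = 0") (simp_all add: eq sum.distrib distrib_left, simp_all add: z'_def algebra_simps)
  then show ?case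
    using z w(1) by (intro exI[of _ z']) (auto simp: z'_def less_Suc_eq)
qed

text \<open>Chernoff's method for counting: every point counted has exp(T - \<Sum>g) \<ge> 1, and
  the sum of these weights over the whole box factorises over the coordinates.\<close>

lemma card_weighted_le:
  fixes g :: "nat \<Rightarrow> int \<Rightarrow> real"
  assumes "finite E"
  shows "real (card {z \<in> PiE {..<n} (\<lambda>_. E). (\<Sum>k<n. g k (z k)) \<le> T}) \<le> exp T * (\<Prod>k<n. \<Sum>z\<in>E. exp (- g k z))"
proof -
  let ?Z = "{z \<in> PiE {..<n} (\<lambda>_. E). (\<Sum>k<n. g k (z k)) \<le> T}"
  have fin: "finite (PiE {..<n} (\<lambda>_. E))" using assms by (intro finite_PiE) auto
  have "real (card ?Z) = (\<Sum>z\<in>?Z. 1)" by simp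
  also have "\<dots> \<le> (\<Sum>z\<in>?Z. exp T * (\<Prod>k<n. exp (- g k (z k))))"
  proof (rule sum_mono)
    fix z assume "z \<in> ?Z"
    then have "0 \<le> T + (\<Sum>k<n. - g k (z k))" by (simp add: sum_negf)
    then have "1 \<le> exp (T + (\<Sum>k<n. - g k (z k)))" by simp
    also have "\<dots> = exp T * (\<Prod>k<n. exp (- g k (z k)))" by (simp add: exp_add exp_sum)
    finally show "1 \<le> exp T * (\<Prod>k<n. exp (- g k (z k)))" .
  qed
  also have "\<dots> \<le> (\<Sum>z\<in>PiE {..<n} (\<lambda>_. E). exp T * (\<Prod>k<n. exp (- g k (z k))))"
  proof (rule sum_mono2[OF fin])
    show "0 \<le> exp T * (\<Prod>k<n. exp (- g k (z k)))" for z
      by (intro mult_nonneg_nonneg prod_nonneg) auto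
  qed blast
  also have "\<dots> = exp T * (\<Prod>k<n. \<Sum>z\<in>E. exp (- g k z))"
    using prod_sum_PiE[of "{..<n}" "\<lambda>_. E" "\<lambda>k z. exp (- g k z)"] assms
    by (simp only: sum_distrib_left[symmetric] finite_lessThan simp_thms)
  finally show ?thesis .
qed

section \<open>Geometric sums over the integers and counting in short intervals\<close>

lemma sum_exp_nat_le:
  fixes a :: real
  assumes "a > 0"
  shows "(\<Sum>k<N. exp (- a * real k)) \<le> 1 + 1 / a"
proof -
  have e: "exp (- a) < 1" using assms by simp
  have "(\<Sum>k<N. exp (- a * real k)) = (\<Sum>k<N. exp (- a) ^ k)"
    by (intro sum.cong) (auto simp: exp_of_nat_mult[symmetric] mult.commute)
  also have "\<dots> \<le> 1 / (1 - exp (- a))"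
    using e by (auto simp: sum_gp_strict intro!: divide_right_mono)
  also have "\<dots> \<le> 1 + 1 / a"
  proof -
    have "1 + a \<le> exp a" by (rule exp_ge_add_one_self)
    then have "exp (-a) \<le> 1 / (1 + a)" using assms by (simp add: exp_minus field_simps)
    then have "a / (1 + a) \<le> 1 - exp (-a)" using assms by (simp add: field_simps)
    then have "1 / (1 - exp (-a)) \<le> 1 / (a / (1 + a))" using assms by (intro divide_left_mono) auto
    then show ?thesis using assms by (simp add: field_simps)
  qed
  finally show ?thesis .
qed

lemma sum_int_symmetric_le:
  fixes f :: "int \<Rightarrow> real"
  assumes "\<And>z. f z \<ge> 0" "\<And>z. f (- z) = f z"
  shows "(\<Sum>z\<in>{-int B..int B}. f z) \<le> f 0 + 2 * (\<Sum>k\<in>{1..B}. f (int k))"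
proof -
  have "{-int B..int B} = insert 0 (int ` {1..B} \<union> (\<lambda>k. - int k) ` {1..B})"
    (is "_ = insert 0 (?P \<union> ?N)")
  proof (intro Set.set_eqI iffI)
    fix z assume z: "z \<in> {-int B..int B}"
    consider "z = 0" | "z > 0" | "z < 0" by linarith
    then show "z \<in> insert 0 (?P \<union> ?N)"
    proof cases
      case 2
      then have "z = int (nat z)" "nat z \<in> {1..B}" using z by auto
      then show ?thesis by blast
    next
      case 3
      then have "z = - int (nat (- z))" "nat (- z) \<in> {1..B}" using z by auto
      then show ?thesis by blast
    qed auto
  qed auto
  then have "(\<Sum>z\<in>{-int B..int B}. f z) = (\<Sum>z\<in>insert 0 (?P \<union> ?N). f z)" by simp
  also have "\<dots> = f 0 + (\<Sum>z\<in>?P \<union> ?N. f z)" by (subst sum.insert) auto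
  also have "(\<Sum>z\<in>?P \<union> ?N. f z) = (\<Sum>z\<in>?P. f z) + (\<Sum>z\<in>?N. f z)"
    by (intro sum.union_disjoint) auto
  also have "(\<Sum>z\<in>?P. f z) = (\<Sum>k\<in>{1..B}. f (int k))" by (subst sum.reindex) (auto simp: inj_on_def)
  also have "(\<Sum>z\<in>?N. f z) = (\<Sum>k\<in>{1..B}. f (int k))"
    by (subst sum.reindex) (auto simp: inj_on_def assms)
  finally show ?thesis by simp
qed

lemma sum_exp_int_le:
  fixes a :: real
  assumes "a > 0"
  shows "(\<Sum>z\<in>{-int B..int B}. exp (- a * \<bar>real_of_int z\<bar>)) \<le> 1 + 2 / a"
proof -
  have "(\<Sum>z\<in>{-int B..int B}. exp (- a * \<bar>real_of_int z\<bar>)) \<le> 1 + 2 * (\<Sum>k\<in>{1..B}. exp (- a * real k))"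
    using sum_int_symmetric_le[of "\<lambda>z. exp (- a * \<bar>real_of_int z\<bar>)" B] by simp
  moreover have "(\<Sum>k<Suc B. exp (- a * real k)) = 1 + (\<Sum>k\<in>{1..B}. exp (- a * real k))"
    unfolding lessThan_Suc_atMost atMost_atLeast0
    by (subst sum.atLeast_Suc_atMost) auto
  ultimately show ?thesis using sum_exp_nat_le[OF assms, of "Suc B"] by simp
qed

lemma card_nat_interval_le:
  fixes \<xi> l w :: real
  assumes "\<xi> > 0" "w \<ge> 0" "\<And>z z'. z \<in> S \<Longrightarrow> z' \<in> S \<Longrightarrow> \<bar>real z * \<xi> - real z' * \<xi>\<bar> \<le> w"
  shows "real (card S) \<le> 1 + w / \<xi>"
proof (cases "S = {}")
  case False
  define z0 where "z0 = (LEAST z. z \<in> S)"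
  have z0: "z0 \<in> S" unfolding z0_def using False LeastI_ex[of "\<lambda>z. z \<in> S"] by auto
  have "S \<subseteq> {z0..z0 + nat \<lfloor>w / \<xi>\<rfloor>}"
  proof
    fix z assume z: "z \<in> S"
    then have "z0 \<le> z" unfolding z0_def by (rule Least_le)
    moreover have "(real z - real z0) * \<xi> \<le> w" using assms(3)[OF z z0] by (simp add: left_diff_distrib)
    then have "real z - real z0 \<le> w / \<xi>" using assms by (simp add: pos_le_divide_eq)
    then have "int z - int z0 \<le> \<lfloor>w / \<xi>\<rfloor>" by (simp add: le_floor_iff)
    ultimately show "z \<in> {z0..z0 + nat \<lfloor>w / \<xi>\<rfloor>}" by auto
  qed
  then have "card S \<le> card {z0..z0 + nat \<lfloor>w / \<xi>\<rfloor>}" by (intro card_mono) auto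
  also have "\<dots> = 1 + nat \<lfloor>w / \<xi>\<rfloor>" by simp
  finally have "real (card S) \<le> 1 + real (nat \<lfloor>w / \<xi>\<rfloor>)" by linarith
  also have "real (nat \<lfloor>w / \<xi>\<rfloor>) \<le> w / \<xi>" using assms by (simp add: of_nat_floor)
  finally show ?thesis by simp
qed (use assms in simp)

section \<open>Esseen's inequality and symmetrisation\<close>

text \<open>The Fourier transform of the triangle function is nonnegative but has zeros; the sum of it
  and its translate by \<open>\<pi>\<close> is bounded below by a multiple of \<open>1 / (1 + x\<^sup>2)\<close>.\<close>

definition fejer :: "real \<Rightarrow> real" where
  "fejer x = (\<integral>t. 2 * (1 - t) * cos (t * x) \<partial>unif01)"

lemma abs_triangle_le:
  fixes t c :: real
  assumes "t \<in> {0..1}" "\<bar>c\<bar> \<le> 1"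
  shows "\<bar>2 * (1 - t) * c\<bar> \<le> 2"
proof -
  have "\<bar>2 * (1 - t) * c\<bar> = 2 * (1 - t) * \<bar>c\<bar>" using assms by (simp add: abs_mult)
  also have "\<dots> \<le> 2 * 1" using assms by (intro mult_mono) auto
  finally show ?thesis by simp
qed

lemma fejer_0: "fejer 0 = 1"
proof -
  have "fejer 0 = (\<integral>t. 2 * (1 - t) \<partial>unif01)" by (simp add: fejer_def)
  also have "\<dots> = (2 * 1 - 1^2) - (2 * 0 - 0^2)"
    by (rule integral_unif01_FTC) (auto intro!: derivative_eq_intros continuous_intros)
  finally show ?thesis by simp
qed

lemma fejer_eq:
  assumes "x \<noteq> 0"
  shows "fejer x = 2 * (1 - cos x) / x\<^sup>2"
proof -
  have "fejer x = 2 * ((1 - 1) * sin (1 * x) / x - cos (1 * x) / x\<^sup>2) - 2 * ((1 - 0) * sin (0 * x) / x - cos (0 * x) / x\<^sup>2)"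
    unfolding fejer_def
    by (rule integral_unif01_FTC)
      (use assms in \<open>auto intro!: derivative_eq_intros continuous_intros simp: field_simps power2_eq_square\<close>)
  then show ?thesis by (simp add: right_diff_distrib diff_divide_distrib)
qed

lemma fejer_nonneg: "0 \<le> fejer x"
  by (cases "x = 0") (auto simp: fejer_0 fejer_eq)

text \<open>Since \<open>cos (x - pi) = - cos x\<close>, the numerators 2 (1 - cos) of the two
  summands add up to 4, so they cannot vanish together, and \<open>S\<close> dominates both
  denominators.\<close>

lemma fejer_pair_ge: "1 / (1 + x\<^sup>2) \<le> 5 * (fejer x + fejer (x - pi))"
proof (cases "x = 0 \<or> x = pi")
  case True
  define F where "F = fejer x + fejer (x - pi)"
  have "1 \<le> F" using True fejer_nonneg[of "x - pi"] fejer_nonneg[of x]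
    unfolding F_def by (auto simp: fejer_0)
  moreover have "1 / (1 + x\<^sup>2) \<le> 1"
    by (subst divide_le_eq_1_pos) (auto intro: add_pos_nonneg)
  ultimately have "1 / (1 + x\<^sup>2) \<le> 5 * F" by (smt (verit))
  then show ?thesis unfolding F_def .
next
  case False
  define S where "S = 2 * x\<^sup>2 + 20"
  have pi10: "pi\<^sup>2 \<le> 10"
  proof -
    have "pi\<^sup>2 \<le> (3.15)\<^sup>2" using pi_approx by (intro power_mono) auto
    then show ?thesis by (simp add: power2_eq_square)
  qed
  have S1: "x\<^sup>2 \<le> S" and S3: "S > 0"
    using zero_le_power2[of x] unfolding S_def by linarith+
  have S2: "(x - pi)\<^sup>2 \<le> S"
    using pi10 zero_le_power2[of "x + pi"] unfolding S_def power2_diff power2_sum by linarith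
  note S = S1 S2 S3
  have "4 / S = 2 * (1 - cos x) / S + 2 * (1 - cos (x - pi)) / S"
    by (simp add: add_divide_distrib[symmetric])
  also have "\<dots> \<le> 2 * (1 - cos x) / x\<^sup>2 + 2 * (1 - cos (x - pi)) / (x - pi)\<^sup>2"
    using S False
    by (intro add_mono divide_left_mono mult_pos_pos mult_nonneg_nonneg one_minus_cos_nonneg) auto
  also have "\<dots> = fejer x + fejer (x - pi)" using False by (simp add: fejer_eq)
  finally have "4 / S \<le> fejer x + fejer (x - pi)" .
  then have "5 * (4 / S) \<le> 5 * (fejer x + fejer (x - pi))" by (rule mult_left_mono) simp
  moreover have "1 / (1 + x\<^sup>2) \<le> 5 * (4 / S)"
  proof -
    have "1 / (1 + x\<^sup>2) = (20 * 1) / (20 * (1 + x\<^sup>2))"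
      by (rule mult_divide_mult_cancel_left[symmetric]) simp
    also have "\<dots> \<le> (20 * 1) / S"
    proof (rule divide_left_mono)
      have p: "0 < 1 + x\<^sup>2" by (rule add_pos_nonneg) auto
      then show "0 < 20 * (1 + x\<^sup>2) * S" using S3 by (intro mult_pos_pos) auto
      show "S \<le> 20 * (1 + x\<^sup>2)" using zero_le_power2[of x] unfolding S_def by (simp add: algebra_simps)
    qed simp
    finally show ?thesis by simp
  qed
  ultimately show ?thesis by (rule order_trans[rotated])
qed

context real_distribution
begin

lemma Re_char: "Re (char M s) = (\<integral>x. cos (s * x) \<partial>M)"
  and Im_char: "Im (char M s) = (\<integral>x. sin (s * x) \<partial>M)"
proof -
  have i: "integrable M (\<lambda>x. iexp (s * x))" by (rule integrable_iexp) auto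
  have "Re (char M s) = (\<integral>x. Re (iexp (s * x)) \<partial>M)"
    unfolding char_def by (rule integral_Re[symmetric, OF i])
  then show "Re (char M s) = (\<integral>x. cos (s * x) \<partial>M)" by (simp add: Re_exp)
  have "Im (char M s) = (\<integral>x. Im (iexp (s * x)) \<partial>M)"
    unfolding char_def by (rule integral_Im[symmetric, OF i])
  then show "Im (char M s) = (\<integral>x. sin (s * x) \<partial>M)" by (simp add: Im_exp)
qed

lemma integrable_cos [simp]: "integrable M (\<lambda>x. cos (s * x + u))"
  by (rule integrable_const_bound[of _ 1]) auto

lemma integrable_sin [simp]: "integrable M (\<lambda>x. sin (s * x + u))"
  by (rule integrable_const_bound[of _ 1]) auto

text \<open>Recentring at \<open>u\<close> multiplies the characteristic function by a number of
  modulus one. Bounds through its modulus are therefore uniform in \<open>u\<close>, as the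
  concentration function demands.\<close>

lemma integral_cos_le_char: "(\<integral>x. cos (s * (x - u)) \<partial>M) \<le> cmod (char M s)"
proof -
  have "(\<integral>x. cos (s * (x - u)) \<partial>M) = (\<integral>x. cos (s * u) * cos (s * x) + sin (s * u) * sin (s * x) \<partial>M)"
    by (simp add: right_diff_distrib cos_diff mult.commute)
  also have "\<dots> = cos (s * u) * Re (char M s) + sin (s * u) * Im (char M s)"
    using integrable_cos[of s 0] integrable_sin[of s 0] by (simp add: Re_char Im_char)
  also have "\<dots> = Re (cnj (cis (s * u)) * char M s)" by simp
  also have "\<dots> \<le> cmod (cnj (cis (s * u)) * char M s)" by (rule complex_Re_le_cmod)
  also have "\<dots> = cmod (char M s)" by (simp add: norm_mult)
  finally show ?thesis .
qed

lemma integral_fejer_le: "(\<integral>x. fejer (D * (x - u)) \<partial>M) \<le> 2 * (\<integral>t. cmod (char M (t * D)) \<partial>unif01)"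
proof -
  interpret U: prob_space unif01 by (rule prob_space_unif01)
  let ?g = "\<lambda>(t::real, x). 2 * (1 - t) * cos (t * (D * (x - u)))"
  have cm [measurable]: "char M \<in> borel_measurable borel" by (rule char_measurable)
  have sw: "(\<integral>t. (\<integral>x. ?g (t, x) \<partial>M) \<partial>unif01) = (\<integral>x. (\<integral>t. ?g (t, x) \<partial>unif01) \<partial>M)"
  proof (rule swap_unif01[OF prob_space_axioms])
    show "\<bar>?g (t, x)\<bar> \<le> 2" if "t \<in> {0..1}" for t x
      unfolding prod.case by (rule abs_triangle_le[OF that]) simp
  qed measurable
  have "(\<integral>x. fejer (D * (x - u)) \<partial>M) = (\<integral>t. (\<integral>x. ?g (t, x) \<partial>M) \<partial>unif01)"
    unfolding sw fejer_def by simp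
  also have "\<dots> = (\<integral>t. 2 * (1 - t) * (\<integral>x. cos (t * D * (x - u)) \<partial>M) \<partial>unif01)"
    by (simp add: mult.assoc)
  also have "\<dots> \<le> (\<integral>t. 2 * cmod (char M (t * D)) \<partial>unif01)"
  proof (rule integral_mono_AE)
    have "\<bar>\<integral>x. cos (t * D * (x - u)) \<partial>M\<bar> \<le> 1" for t
    proof -
      have "\<bar>\<integral>x. cos (t * D * (x - u)) \<partial>M\<bar> \<le> (\<integral>x. \<bar>cos (t * D * (x - u))\<bar> \<partial>M)" by (rule integral_abs_bound)
      also have "\<dots> \<le> (\<integral>x. 1 \<partial>M)"
        using integrable_cos[of "t * D" "- (t * D * u)"] by (intro integral_mono) (auto simp: right_diff_distrib)
      finally show ?thesis using prob_space by simp
    qed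
    then show "integrable unif01 (\<lambda>t. 2 * (1 - t) * (\<integral>x. cos (t * D * (x - u)) \<partial>M))"
      by (intro integrable_unif01[of _ 2] abs_triangle_le) auto
    show "integrable unif01 (\<lambda>t. 2 * cmod (char M (t * D)))"
      using cmod_char_le_1 by (intro integrable_unif01[of _ 2]) auto
    show "AE t in unif01. 2 * (1 - t) * (\<integral>x. cos (t * D * (x - u)) \<partial>M) \<le> 2 * cmod (char M (t * D))"
      using AE_unif01
    proof eventually_elim
      case (elim t)
      then have "(1 - t) * (\<integral>x. cos (t * D * (x - u)) \<partial>M) \<le> (1 - t) * cmod (char M (t * D))"
        using integral_cos_le_char[of "t * D" u] by (intro mult_left_mono) auto
      also have "\<dots> \<le> 1 * cmod (char M (t * D))" using elim by (intro mult_right_mono) auto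
      finally have "2 * ((1 - t) * (\<integral>x. cos (t * D * (x - u)) \<partial>M)) \<le> 2 * cmod (char M (t * D))" by linarith
      then show ?case by (simp only: mult.assoc)
    qed
  qed
  finally show ?thesis by simp
qed

text \<open>The Cauchy kernel is at most 5 times the sum of the Fejer kernel and its translate.
  Translation by \<pi> moves the centre \<open>u\<close> by \<pi> / D, which does not affect the
  Fourier bound; 20 is 5 * (2 + 2).\<close>

lemma esseen:
  assumes "D > 0"
  shows "(\<integral>x. 1 / (1 + (D * (x - u))\<^sup>2) \<partial>M) \<le> 20 * (\<integral>t. cmod (char M (t * D)) \<partial>unif01)"
proof -
  interpret U: prob_space unif01 by (rule prob_space_unif01)
  have fm: "fejer \<in> borel_measurable borel"
    unfolding fejer_def[abs_def] by (rule U.borel_measurable_lebesgue_integral) measurable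
  have fb: "fejer x \<le> 4" for x
  proof -
    have "fejer x \<le> (\<integral>t. 4 \<partial>unif01)"
      unfolding fejer_def
    proof (rule integral_mono_AE)
      show "integrable unif01 (\<lambda>t. 2 * (1 - t) * cos (t * x))"
        by (intro integrable_unif01[of _ 2] abs_triangle_le) auto
      show "AE t in unif01. 2 * (1 - t) * cos (t * x) \<le> 4"
        using AE_unif01
      proof eventually_elim
        case (elim t)
        show ?case using abs_triangle_le[OF elim abs_cos_le_one, of "t * x"] by linarith
      qed
    qed auto
    then show ?thesis using U.prob_space by simp
  qed
  have int: "integrable M (\<lambda>x. fejer (D * (x - w)))" for w
    using fm fejer_nonneg fb by (intro integrable_const_bound[of _ 4]) auto
  have sh: "D * (x - u) - pi = D * (x - (u + pi / D))" for x using assms by (simp add: field_simps)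
  have "(\<integral>x. 1 / (1 + (D * (x - u))\<^sup>2) \<partial>M) \<le> (\<integral>x. 5 * (fejer (D * (x - u)) + fejer (D * (x - (u + pi / D)))) \<partial>M)"
  proof (rule integral_mono)
    show "integrable M (\<lambda>x. 1 / (1 + (D * (x - u))\<^sup>2))"
      by (intro integrable_const_bound[of _ 1]) (auto simp: add_pos_nonneg abs_of_nonneg)
    show "integrable M (\<lambda>x. 5 * (fejer (D * (x - u)) + fejer (D * (x - (u + pi / D)))))"
      using int[of u] int[of "u + pi / D"] by (intro integrable_mult_right Bochner_Integration.integrable_add) auto
    show "1 / (1 + (D * (x - u))\<^sup>2) \<le> 5 * (fejer (D * (x - u)) + fejer (D * (x - (u + pi / D))))" for x
      using fejer_pair_ge[of "D * (x - u)"] unfolding sh .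
  qed
  also have "\<dots> = 5 * ((\<integral>x. fejer (D * (x - u)) \<partial>M) + (\<integral>x. fejer (D * (x - (u + pi / D))) \<partial>M))"
    using int[of u] int[of "u + pi / D"] by simp
  also have "\<dots> \<le> 5 * (2 * (\<integral>t. cmod (char M (t * D)) \<partial>unif01) + 2 * (\<integral>t. cmod (char M (t * D)) \<partial>unif01))"
    using integral_fejer_le by (intro mult_left_mono add_mono) auto
  finally show ?thesis by simp
qed

end

section \<open>Symmetrisation: from the modulus of a characteristic function to the defect\<close>

definition symm :: "real measure \<Rightarrow> real measure" where
  "symm \<mu> = distr (\<mu> \<Otimes>\<^sub>M \<mu>) borel (\<lambda>(x, y). x - y)"

context real_distribution
begin

lemma sets_pair_borel: "sets (M \<Otimes>\<^sub>M M) = sets (borel \<Otimes>\<^sub>M borel)"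
  by (rule sets_pair_measure_cong) auto

lemma real_distribution_symm: "real_distribution (symm M)"
proof -
  interpret P: pair_prob_space M M ..
  have "prob_space (symm M)" unfolding symm_def by (rule P.prob_space_distr) measurable
  then show ?thesis by (intro real_distribution.intro real_distribution_axioms.intro) (auto simp: symm_def)
qed

lemma cmod_char_eq_defect: "(cmod (char M t))\<^sup>2 = 1 - defect (symm M) t"
proof -
  interpret P: pair_prob_space M M ..
  interpret S: real_distribution "symm M" by (rule real_distribution_symm)
  let ?C = "\<integral>x. cos (t * x) \<partial>M" and ?S = "\<integral>x. sin (t * x) \<partial>M"
  have i: "integrable M (\<lambda>x. cos (t * x))" "integrable M (\<lambda>x. sin (t * x))"
    using integrable_cos[of t 0] integrable_sin[of t 0] by auto
  have "defect (symm M) t = (\<integral>p. 1 - cos (t * (case p of (x, y) \<Rightarrow> x - y)) \<partial>(M \<Otimes>\<^sub>M M))"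
    unfolding defect_def symm_def by (subst integral_distr) auto
  also have "\<dots> = (\<integral>(x, y). 1 - cos (t * (x - y)) \<partial>(M \<Otimes>\<^sub>M M))"
    by (intro Bochner_Integration.integral_cong) auto
  also have "\<dots> = (\<integral>x. (\<integral>y. 1 - cos (t * (x - y)) \<partial>M) \<partial>M)"
  proof (rule P.integral_fst[symmetric])
    have "(\<lambda>(x, y). 1 - cos (t * (x - y))) \<in> borel_measurable (M \<Otimes>\<^sub>M M)"
      by (subst measurable_cong_sets[OF sets_pair_borel refl]) measurable
    then show "integrable (M \<Otimes>\<^sub>M M) (\<lambda>(x, y). 1 - cos (t * (x - y)))"
      by (intro P.integrable_const_bound[of _ 2]) auto
  qed
  also have "\<dots> = (\<integral>x. 1 - (cos (t * x) * ?C + sin (t * x) * ?S) \<partial>M)"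
  proof (rule Bochner_Integration.integral_cong[OF refl])
    fix x
    have "(\<integral>y. 1 - cos (t * (x - y)) \<partial>M) = (\<integral>y. 1 - (cos (t * x) * cos (t * y) + sin (t * x) * sin (t * y)) \<partial>M)"
      by (simp add: right_diff_distrib cos_diff)
    also have "\<dots> = 1 - (cos (t * x) * ?C + sin (t * x) * ?S)"
      using i prob_space by simp
    finally show "(\<integral>y. 1 - cos (t * (x - y)) \<partial>M) = 1 - (cos (t * x) * ?C + sin (t * x) * ?S)" .
  qed
  also have "\<dots> = 1 - (?C * ?C + ?S * ?S)"
    using i prob_space by simp
  also have "?C * ?C + ?S * ?S = (cmod (char M t))\<^sup>2"
    using cmod_power2[of "char M t"] by (simp add: Re_char Im_char power2_eq_square)
  finally show ?thesis by simp
qed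

text \<open>By 1 - d \<le> exp(-d) with d the defect, applied to the squared modulus. In exponential
  form, a product over independent coordinates becomes a sum of defects.\<close>

lemma cmod_char_le_exp: "cmod (char M t) \<le> exp (- defect (symm M) t / 2)"
proof -
  have "(cmod (char M t))\<^sup>2 \<le> exp (- defect (symm M) t)"
    unfolding cmod_char_eq_defect using exp_ge_add_one_self[of "- defect (symm M) t"] by simp
  also have "\<dots> = (exp (- defect (symm M) t / 2))\<^sup>2"
    by (simp add: power2_eq_square exp_add[symmetric])
  finally show ?thesis by (rule power2_le_imp_le) simp
qed

text \<open>Conditionally on one copy \<open>x\<close>, the other lies within 1 of \<open>x\<close>
  with probability at most \<open>b\<close>.\<close>

lemma measure_symm_ge:
  assumes "\<And>u. measure M {x. \<bar>x - u\<bar> < 1} \<le> b"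
  shows "1 - b \<le> measure (symm M) {x. 1 \<le> \<bar>x\<bar>}"
proof -
  interpret P: pair_prob_space M M ..
  interpret S: real_distribution "symm M" by (rule real_distribution_symm)
  have b: "0 \<le> b" using assms[of 0] measure_nonneg order_trans by blast
  let ?A = "{p :: real \<times> real. \<bar>fst p - snd p\<bar> < 1}"
  have A: "?A \<in> sets (M \<Otimes>\<^sub>M M)" unfolding sets_pair_borel
    by (rule borel_open[of ?A, unfolded borel_prod[symmetric]]) (intro open_Collect_less continuous_intros)
  have "emeasure (M \<Otimes>\<^sub>M M) ?A = (\<integral>\<^sup>+x. emeasure M (Pair x -` ?A) \<partial>M)"
    by (rule emeasure_pair_measure_alt[OF A])
  also have "\<dots> \<le> (\<integral>\<^sup>+x. ennreal b \<partial>M)"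
  proof (rule nn_integral_mono)
    fix x
    have "Pair x -` ?A = {y. \<bar>y - x\<bar> < 1}" by (auto simp: abs_minus_commute)
    then show "emeasure M (Pair x -` ?A) \<le> ennreal b"
      using assms[of x] by (simp add: emeasure_eq_measure ennreal_leI)
  qed
  also have "\<dots> = ennreal b" using emeasure_space_1 by simp
  finally have "measure (M \<Otimes>\<^sub>M M) ?A \<le> b"
    by (simp add: P.emeasure_eq_measure b)
  moreover have "measure (symm M) {x. \<bar>x\<bar> < 1} = measure (M \<Otimes>\<^sub>M M) ?A"
    unfolding symm_def
    by (subst measure_distr) (auto simp: space_pair_measure intro!: arg_cong[where f = "measure (M \<Otimes>\<^sub>M M)"])
  moreover have "measure (symm M) {x. 1 \<le> \<bar>x\<bar>} = 1 - measure (symm M) {x. \<bar>x\<bar> < 1}"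
  proof -
    have "{x::real. 1 \<le> \<bar>x\<bar>} = space (symm M) - {x. \<bar>x\<bar> < 1}" by (auto simp: symm_def)
    then have "measure (symm M) {x. 1 \<le> \<bar>x\<bar>} = measure (symm M) (space (symm M) - {x. \<bar>x\<bar> < 1})" by (simp only:)
    also have "\<dots> = 1 - measure (symm M) {x. \<bar>x\<bar> < 1}" by (rule S.prob_compl) simp
    finally show ?thesis .
  qed
  ultimately show ?thesis by simp
qed

lemma symm_second_moment:
  assumes "integrable M (\<lambda>x. x\<^sup>2)"
  shows "integrable (symm M) (\<lambda>x. x\<^sup>2)" and "(\<integral>x. x\<^sup>2 \<partial>symm M) \<le> 4 * (\<integral>x. x\<^sup>2 \<partial>M)"
proof -
  interpret P: pair_prob_space M M ..
  have f: "distr (M \<Otimes>\<^sub>M M) M fst = M"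
    by (rule distr_pair_fst)
  have i: "integrable (M \<Otimes>\<^sub>M M) (\<lambda>p. (fst p)\<^sup>2)" "(\<integral>p. (fst p)\<^sup>2 \<partial>(M \<Otimes>\<^sub>M M)) = (\<integral>x. x\<^sup>2 \<partial>M)"
    using integrable_distr_eq[of fst "M \<Otimes>\<^sub>M M" M "\<lambda>x. x\<^sup>2"] integral_distr[of fst "M \<Otimes>\<^sub>M M" M "\<lambda>x. x\<^sup>2"] assms
    unfolding f by auto
  have j: "integrable (M \<Otimes>\<^sub>M M) (\<lambda>p. (snd p)\<^sup>2)" "(\<integral>p. (snd p)\<^sup>2 \<partial>(M \<Otimes>\<^sub>M M)) = (\<integral>x. x\<^sup>2 \<partial>M)"
    using P.integrable_product_swap[OF i(1)] P.integral_product_swap[of "\<lambda>p. (fst p)\<^sup>2"] i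
    by (auto simp: case_prod_unfold)
  have k: "integrable (M \<Otimes>\<^sub>M M) (\<lambda>p. 2 * (fst p)\<^sup>2 + 2 * (snd p)\<^sup>2)" using i j by simp
  have le: "(case p of (x, y) \<Rightarrow> x - y)\<^sup>2 \<le> 2 * (fst p)\<^sup>2 + 2 * (snd p)\<^sup>2" for p :: "real \<times> real"
    using zero_le_power2[of "fst p + snd p"] by (auto simp: power2_diff power2_sum split: prod.splits)
  have l: "integrable (M \<Otimes>\<^sub>M M) (\<lambda>p. (case p of (x, y) \<Rightarrow> x - y)\<^sup>2)"
    by (rule Bochner_Integration.integrable_bound[OF k]) (use le in \<open>auto simp: abs_of_nonneg split: prod.splits\<close>)
  then show "integrable (symm M) (\<lambda>x. x\<^sup>2)"
    unfolding symm_def by (subst integrable_distr_eq) auto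
  have "(\<integral>x. x\<^sup>2 \<partial>symm M) = (\<integral>p. (case p of (x, y) \<Rightarrow> x - y)\<^sup>2 \<partial>(M \<Otimes>\<^sub>M M))"
    unfolding symm_def by (subst integral_distr) auto
  also have "\<dots> \<le> (\<integral>p. 2 * (fst p)\<^sup>2 + 2 * (snd p)\<^sup>2 \<partial>(M \<Otimes>\<^sub>M M))"
    by (rule integral_mono[OF l k le])
  also have "\<dots> = 4 * (\<integral>x. x\<^sup>2 \<partial>M)" using i j by simp
  finally show "(\<integral>x. x\<^sup>2 \<partial>symm M) \<le> 4 * (\<integral>x. x\<^sup>2 \<partial>M)" .
qed

end

section \<open>Counting structured lattice points\<close>

text \<open>A block of \<open>L\<close> multiples of \<xi> spans a length at most 1, less than the
  period. Its points within \<omega> of 2 \<pi> \<int> all belong to the same multiple of 2 \<pi>,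
  so there are at most 1 + 2 \<omega> / \<xi> of them. Every other point has weight at most
  exp(-\<beta> \<omega>^2 / 40), and the block has at most 1 / \<xi> points.\<close>

lemma exp_cos_block_le:
  fixes \<xi> \<omega> \<beta> :: real
  assumes \<xi>: "0 < \<xi>" "real L * \<xi> \<le> 1" and \<omega>: "0 < \<omega>" "\<omega> \<le> 1" and "0 \<le> \<beta>"
  shows "(\<Sum>z\<in>{z0..<z0 + L}. exp (- \<beta> * (1 - cos (real z * \<xi>)))) \<le> 1 + 2 * \<omega> / \<xi> + exp (- \<beta> * \<omega>\<^sup>2 / 40) / \<xi>"
proof -
  define S where "S = {z \<in> {z0..<z0 + L}. \<exists>j::int. \<bar>real z * \<xi> - real_of_int j * (2 * pi)\<bar> < \<omega>}"
  let ?B = "{z0..<z0 + L}" and ?e = "exp (- \<beta> * \<omega>\<^sup>2 / 40)"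
  have *: "exp (- \<beta> * (1 - cos (real z * \<xi>))) \<le> (if z \<in> S then 1 else 0) + ?e" if z: "z \<in> ?B" for z
  proof (cases "z \<in> S")
    case True
    have "- \<beta> * (1 - cos (real z * \<xi>)) \<le> 0"
      using \<open>0 \<le> \<beta>\<close> one_minus_cos_nonneg by (simp add: mult_nonneg_nonneg)
    then have "exp (- \<beta> * (1 - cos (real z * \<xi>))) \<le> 1" by (simp only: exp_le_one_iff)
    then show ?thesis using True by (simp add: add_increasing2)
  next
    case False
    define j where "j = round (real z * \<xi> / (2 * pi))"
    define y where "y = real z * \<xi> - real_of_int j * (2 * pi)"
    have "\<bar>real_of_int j - real z * \<xi> / (2 * pi)\<bar> \<le> 1/2"
      unfolding j_def by (rule of_int_round_abs_le)
    then have "\<bar>real_of_int j - real z * \<xi> / (2 * pi)\<bar> * (2 * pi) \<le> 1/2 * (2 * pi)"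
      by (rule mult_right_mono) simp
    also have "\<bar>real_of_int j - real z * \<xi> / (2 * pi)\<bar> * (2 * pi) = \<bar>(real_of_int j - real z * \<xi> / (2 * pi)) * (2 * pi)\<bar>"
      by (simp add: abs_mult)
    also have "(real_of_int j - real z * \<xi> / (2 * pi)) * (2 * pi) = - y"
      by (simp add: y_def left_diff_distrib)
    finally have y: "\<bar>y\<bar> \<le> pi" by simp
    have "cos (real z * \<xi> - real_of_int j * (2 * of_real pi)) = cos (real z * \<xi>)"
      by (rule cos.minus_of_int)
    then have "cos y = cos (real z * \<xi>)" unfolding y_def by (simp only: of_real_eq_id id_apply)
    moreover have "\<omega> \<le> \<bar>y\<bar>" using False z unfolding S_def y_def by (auto simp: not_less)
    then have "\<omega>\<^sup>2 \<le> y\<^sup>2" using \<omega> power_mono[of \<omega> "\<bar>y\<bar>" 2] by simp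
    ultimately have "\<omega>\<^sup>2 / 40 \<le> 1 - cos (real z * \<xi>)" using one_minus_cos_ge_pi[OF y] by linarith
    then have "\<beta> * (\<omega>\<^sup>2 / 40) \<le> \<beta> * (1 - cos (real z * \<xi>))" using \<open>0 \<le> \<beta>\<close> by (rule mult_left_mono)
    then show ?thesis using False by simp
  qed
  have cardS: "real (card S) \<le> 1 + 2 * \<omega> / \<xi>"
  proof (rule card_nat_interval_le)
    fix z z' assume "z \<in> S" "z' \<in> S"
    then obtain j j' :: int where j: "\<bar>real z * \<xi> - real_of_int j * (2 * pi)\<bar> < \<omega>"
      "\<bar>real z' * \<xi> - real_of_int j' * (2 * pi)\<bar> < \<omega>" and zz: "z \<in> ?B" "z' \<in> ?B"
      unfolding S_def by blast
    have "\<bar>real z - real z'\<bar> \<le> real L" using zz by auto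
    then have "\<bar>real z - real z'\<bar> * \<xi> \<le> real L * \<xi>"
      using \<xi> by (intro mult_right_mono) auto
    also note \<xi>(2)
    finally have d: "\<bar>real z * \<xi> - real z' * \<xi>\<bar> \<le> 1"
      using \<xi> unfolding left_diff_distrib[symmetric] abs_mult by simp
    \<comment> \<open>Two points of \<open>S\<close> are at distance at most 1, so their multiples
      of 2 \<pi> are less than 1 + 2 \<omega> \<le> 3 apart.\<close>
    have "j = j'"
    proof (rule ccontr)
      assume "j \<noteq> j'"
      then have "1 \<le> \<bar>real_of_int j - real_of_int j'\<bar>" by linarith
      then have "1 * (2 * pi) \<le> \<bar>real_of_int j - real_of_int j'\<bar> * (2 * pi)" by (rule mult_right_mono) simp
      also have "\<dots> = \<bar>real_of_int j * (2 * pi) - real_of_int j' * (2 * pi)\<bar>"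
        unfolding left_diff_distrib[symmetric] abs_mult by simp
      finally show False using j d \<omega> pi_gt3 by linarith
    qed
    then have "\<bar>real z' * \<xi> - real_of_int j * (2 * pi)\<bar> < \<omega>" using j(2) by simp
    then show "\<bar>real z * \<xi> - real z' * \<xi>\<bar> \<le> 2 * \<omega>" using j(1) by linarith
  qed (use \<xi> \<omega> in auto)
  have "(\<Sum>z\<in>?B. exp (- \<beta> * (1 - cos (real z * \<xi>)))) \<le> (\<Sum>z\<in>?B. (if z \<in> S then 1 else 0) + ?e)"
    by (intro sum_mono *)
  also have "\<dots> = real (card S) + real L * ?e"
  proof -
    have "(\<Sum>z\<in>?B. (if z \<in> S then 1 else 0 :: real)) = (\<Sum>z\<in>S. 1)"
      by (rule sum.mono_neutral_cong_right) (auto simp: S_def)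
    then show ?thesis by (simp add: sum.distrib)
  qed
  also have "real L * ?e \<le> 1 / \<xi> * ?e"
    using \<xi> by (intro mult_right_mono) (auto simp: pos_le_divide_eq)
  finally show ?thesis using cardS by simp
qed

text \<open>The integers are cut into blocks of length \<open>L\<close>, about 1 / \<xi>. In a block
  the geometric weight is bounded by its value at the left end, and \<open>exp_cos_block_le\<close>
  saves the factor \<xi> + 2 \<omega> + exp(...). The other factor 1 / \<xi> + 2 / a is, up to
  constants, what the weight alone would give.\<close>

lemma exp_cos_lattice_sum_le:
  fixes \<xi> \<omega> \<beta> a :: real
  assumes \<xi>: "0 < \<xi>" "\<xi> \<le> 1" and \<omega>: "0 < \<omega>" "\<omega> \<le> 1" and "0 \<le> \<beta>" "0 < a"
  shows "(\<Sum>z\<in>{-int N..int N}. exp (- a * \<bar>real_of_int z\<bar>) * exp (- \<beta> * (1 - cos (real_of_int z * \<xi>))))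
    \<le> 2 * (\<xi> + 2 * \<omega> + exp (- \<beta> * \<omega>\<^sup>2 / 40)) * (1 / \<xi> + 2 / a)"
proof -
  define L where "L = nat \<lfloor>1 / \<xi>\<rfloor>"
  define f where "f = (\<lambda>k::nat. exp (- a * real k) * exp (- \<beta> * (1 - cos (real k * \<xi>))))"
  define G where "G = 1 + 2 * \<omega> / \<xi> + exp (- \<beta> * \<omega>\<^sup>2 / 40) / \<xi>"
  have G: "0 \<le> G" using \<xi> \<omega> by (simp add: G_def)
  have one: "1 \<le> 1 / \<xi>" using \<xi> by simp
  have L: "real L = of_int \<lfloor>1 / \<xi>\<rfloor>" 
  proof -
    have "0 \<le> \<lfloor>1 / \<xi>\<rfloor>" using one \<xi> by (simp add: le_floor_iff)
    then show ?thesis by (simp add: L_def)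
  qed
  have L1: "1 \<le> L"
  proof -
    have "1 \<le> \<lfloor>1 / \<xi>\<rfloor>" using one by (subst le_floor_iff) simp
    then show ?thesis unfolding L_def by linarith
  qed
  have Lub: "real L \<le> 1 / \<xi>" unfolding L by simp
  have "1 / \<xi> < real L + 1" unfolding L by linarith
  then have Llb: "1 / (2 * \<xi>) \<le> real L" using L1 by simp
  have Lx: "real L * \<xi> \<le> 1" using Lub \<xi> by (simp add: pos_le_divide_eq)
  have f0: "0 \<le> f k" for k by (simp add: f_def)
  have "(\<Sum>z\<in>{-int N..int N}. exp (- a * \<bar>real_of_int z\<bar>) * exp (- \<beta> * (1 - cos (real_of_int z * \<xi>))))
     \<le> f 0 + 2 * (\<Sum>k\<in>{1..N}. f k)"
    using sum_int_symmetric_le[of "\<lambda>z. exp (- a * \<bar>real_of_int z\<bar>) * exp (- \<beta> * (1 - cos (real_of_int z * \<xi>)))" N]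
    by (simp add: f_def)
  also have "\<dots> \<le> 2 * (\<Sum>k<Suc N. f k)"
  proof -
    have "(\<Sum>k<Suc N. f k) = f 0 + (\<Sum>k\<in>{1..N}. f k)"
      unfolding lessThan_Suc_atMost atMost_atLeast0 by (subst sum.atLeast_Suc_atMost) auto
    then show ?thesis using f0[of 0] by simp
  qed
  \<comment> \<open>The range is padded to a whole number of blocks; the added terms are
    nonnegative.\<close>
  also have "(\<Sum>k<Suc N. f k) \<le> (\<Sum>k<Suc N * L. f k)"
  proof (rule sum_mono2)
    have "Suc N * 1 \<le> Suc N * L" using L1 by (intro mult_le_mono2)
    then show "{..<Suc N} \<subseteq> {..<Suc N * L}" by auto
  qed (use f0 in auto)
  also have "\<dots> = (\<Sum>m<Suc N. sum f {m * L..<m * L + L})"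
    by (rule sum.nat_group[symmetric])
  also have "\<dots> \<le> (\<Sum>m<Suc N. exp (- (a * real L) * real m) * G)"
  proof (rule sum_mono)
    fix m
    have "sum f {m * L..<m * L + L} \<le> (\<Sum>k\<in>{m * L..<m * L + L}. exp (- (a * real L) * real m) * exp (- \<beta> * (1 - cos (real k * \<xi>))))"
    proof (rule sum_mono)
      fix k assume "k \<in> {m * L..<m * L + L}"
      then have "m * L \<le> k" by simp
      then have "real m * real L \<le> real k" by (simp only: of_nat_mult[symmetric] of_nat_le_iff)
      then have "a * (real m * real L) \<le> a * real k" using \<open>0 < a\<close> by (intro mult_left_mono) auto
      then show "f k \<le> exp (- (a * real L) * real m) * exp (- \<beta> * (1 - cos (real k * \<xi>)))"
        unfolding f_def by (intro mult_right_mono) (auto simp: mult_ac)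
    qed
    also have "\<dots> = exp (- (a * real L) * real m) * (\<Sum>k\<in>{m * L..<m * L + L}. exp (- \<beta> * (1 - cos (real k * \<xi>))))"
      by (simp add: sum_distrib_left)
    also have "\<dots> \<le> exp (- (a * real L) * real m) * G"
      unfolding G_def using exp_cos_block_le[OF \<xi>(1) Lx \<omega> \<open>0 \<le> \<beta>\<close>] by (intro mult_left_mono) auto
    finally show "sum f {m * L..<m * L + L} \<le> exp (- (a * real L) * real m) * G" .
  qed
  also have "\<dots> = (\<Sum>m<Suc N. exp (- (a * real L) * real m)) * G" by (simp only: sum_distrib_right)
  also have "\<dots> \<le> (1 + 1 / (a * real L)) * G"
    using L1 \<open>0 < a\<close> by (intro mult_right_mono[OF _ G] sum_exp_nat_le) auto
  also have "\<dots> \<le> (1 + 2 * \<xi> / a) * G"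
  proof -
    have "1 / (a * real L) \<le> 1 / (a * (1 / (2 * \<xi>)))"
      using Llb \<open>0 < a\<close> \<xi> L1 by (intro divide_left_mono mult_left_mono mult_pos_pos) auto
    then show ?thesis using \<open>0 < a\<close> \<xi> by (intro mult_right_mono[OF _ G]) (auto simp: field_simps)
  qed
  also have "(1 + 2 * \<xi> / a) * G = (\<xi> + 2 * \<omega> + exp (- \<beta> * \<omega>\<^sup>2 / 40)) * (1 / \<xi> + 2 / a)"
    unfolding G_def using \<xi> \<open>0 < a\<close> by (simp add: field_simps)
  finally show ?thesis by (simp only: mult.assoc)
qed

text \<open>The next bound combines Jensen's inequality, which moves the expectation inside \<open>defect\<close> out
  of the exponential, with the equidistribution of an arithmetic progression modulo \<open>2 \<pi>\<close>.\<close>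

lemma (in real_distribution) exp_defect_lattice_sum_le:
  fixes a h l u p \<beta> \<omega> :: real
  assumes p: "0 < p" "p \<le> measure M {x. l \<le> \<bar>x\<bar> \<and> \<bar>x\<bar> \<le> u}"
    and pos: "0 < a" "0 < h" "0 < l" "h * u \<le> 1" and \<omega>: "0 < \<omega>" "\<omega> \<le> 1" and "0 \<le> \<beta>"
  shows "(\<Sum>z\<in>{-int N..int N}. exp (- a * \<bar>real_of_int z\<bar>) * exp (- \<beta> * defect M (h * real_of_int z)))
    \<le> 2 * (h * u + 2 * \<omega> + exp (- \<beta> * p * \<omega>\<^sup>2 / 40)) * (1 / (h * l) + 2 / a)"
proof -
  define G where "G = {x :: real. l \<le> \<bar>x\<bar> \<and> \<bar>x\<bar> \<le> u}"
  define P where "P = measure M G"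
  have G [measurable]: "G \<in> sets borel" unfolding G_def by measurable
  have P: "p \<le> P" "0 < P" using p by (auto simp: P_def G_def)
  define R where "R = 2 * (h * u + 2 * \<omega> + exp (- \<beta> * p * \<omega>\<^sup>2 / 40)) * (1 / (h * l) + 2 / a)"
  define w where "w = (\<lambda>z x. exp (- (\<beta> * P) * (1 - cos (h * real_of_int z * x))))"
  have w01: "0 \<le> w z x" "w z x \<le> 1" for z x
    unfolding w_def using \<open>0 \<le> \<beta>\<close> P by (auto intro!: mult_nonneg_nonneg)
  have wm [measurable]: "w z \<in> borel_measurable borel" for z unfolding w_def by measurable
  have intw: "integrable M (\<lambda>x. indicator G x * w z x)" for z
    using w01 by (intro integrable_const_bound[of _ 1]) (auto simp: indicator_def)
  \<comment> \<open>Jensen's inequality for the conditional law given \<open>G\<close>, whose mass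
    \<open>P\<close> explains the exponent \<beta> P in \<open>w\<close>. It is proved by the
    tangent line of exp at the conditional mean -\<beta> m, with equality after integration.\<close>
  have jensen: "P * exp (- \<beta> * defect M (h * real_of_int z)) \<le> (\<integral>x. indicator G x * w z x \<partial>M)" for z
  proof -
    let ?g = "\<lambda>x. 1 - cos (h * real_of_int z * x)"
    define m where "m = (\<integral>x. indicator G x * ?g x \<partial>M)"
    have ig: "integrable M (\<lambda>x. indicator G x * ?g x)"
      by (intro integrable_const_bound[of _ 2]) (auto simp: indicator_def)
    have iG: "integrable M (indicator G :: real \<Rightarrow> real)"
      by (intro integrable_real_indicator) (auto simp: emeasure_eq_measure)
    have "m \<le> defect M (h * real_of_int z)"
      unfolding m_def defect_def by (intro integral_mono ig) (auto simp: indicator_def)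
    then have "P * exp (- \<beta> * defect M (h * real_of_int z)) \<le> P * exp (- \<beta> * m)"
      using P \<open>0 \<le> \<beta>\<close> by (intro mult_left_mono) (auto intro: mult_left_mono)
    also have "\<dots> = (\<integral>x. exp (- \<beta> * m) * (1 + \<beta> * m) * indicator G x - exp (- \<beta> * m) * (\<beta> * P) * (indicator G x * ?g x) \<partial>M)"
    proof -
      have "(\<integral>x. exp (- \<beta> * m) * (1 + \<beta> * m) * indicator G x - exp (- \<beta> * m) * (\<beta> * P) * (indicator G x * ?g x) \<partial>M)
        = exp (- \<beta> * m) * (1 + \<beta> * m) * (\<integral>x. indicator G x \<partial>M) - exp (- \<beta> * m) * (\<beta> * P) * m"
        unfolding m_def
        by (subst Bochner_Integration.integral_diff) (use ig iG in \<open>auto intro!: integrable_mult_right\<close>)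
      also have "(\<integral>x. indicator G x \<partial>M) = P" by (simp add: P_def)
      finally show ?thesis by (simp add: algebra_simps)
    qed
    also have "\<dots> \<le> (\<integral>x. indicator G x * w z x \<partial>M)"
    proof (rule integral_mono)
      fix x
      have "1 + (\<beta> * m - (\<beta> * P) * ?g x) \<le> exp (\<beta> * m - (\<beta> * P) * ?g x)" by (rule exp_ge_add_one_self)
      then have "exp (- \<beta> * m) * (1 + (\<beta> * m - (\<beta> * P) * ?g x)) \<le> exp (- \<beta> * m) * exp (\<beta> * m - (\<beta> * P) * ?g x)"
        by (rule mult_left_mono) simp
      also have "\<dots> = w z x" unfolding w_def by (simp add: exp_add[symmetric])
      finally show "exp (- \<beta> * m) * (1 + \<beta> * m) * indicator G x - exp (- \<beta> * m) * (\<beta> * P) * (indicator G x * ?g x) \<le> indicator G x * w z x"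
        by (auto simp: indicator_def algebra_simps)
    qed (use ig iG intw in \<open>auto intro!: integrable_mult_right Bochner_Integration.integrable_diff\<close>)
    finally show ?thesis .
  qed
  have pt: "(\<Sum>z\<in>{-int N..int N}. exp (- a * \<bar>real_of_int z\<bar>) * w z x) \<le> R" if x: "x \<in> G" for x
  proof -
    define \<xi> where "\<xi> = h * \<bar>x\<bar>"
    have xi: "0 < \<xi>" "\<xi> \<le> h * u" "h * l \<le> \<xi>" using x pos by (auto simp: \<xi>_def G_def intro!: mult_left_mono)
    have "w z x = exp (- (\<beta> * P) * (1 - cos (real_of_int z * \<xi>)))" for z
    proof -
      have "cos (h * real_of_int z * x) = cos (real_of_int z * \<xi>)"
        by (cases "x \<ge> 0") (auto simp: \<xi>_def mult_ac)
      then show ?thesis by (simp add: w_def)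
    qed
    then have "(\<Sum>z\<in>{-int N..int N}. exp (- a * \<bar>real_of_int z\<bar>) * w z x)
      \<le> 2 * (\<xi> + 2 * \<omega> + exp (- (\<beta> * P) * \<omega>\<^sup>2 / 40)) * (1 / \<xi> + 2 / a)"
      using exp_cos_lattice_sum_le[of \<xi> \<omega> "\<beta> * P" a N] xi pos \<omega> \<open>0 \<le> \<beta>\<close> P by (simp add: mult_nonneg_nonneg)
    also have "\<dots> \<le> R"
      unfolding R_def
    proof (intro mult_mono add_mono)
      have "\<beta> * p * \<omega>\<^sup>2 \<le> \<beta> * P * \<omega>\<^sup>2" using \<open>0 \<le> \<beta>\<close> P by (intro mult_right_mono mult_left_mono) auto
      then show "exp (- (\<beta> * P) * \<omega>\<^sup>2 / 40) \<le> exp (- \<beta> * p * \<omega>\<^sup>2 / 40)" by simp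
      show "1 / \<xi> \<le> 1 / (h * l)" using xi pos by (intro divide_left_mono mult_pos_pos) auto
    qed (use xi pos \<omega> in \<open>auto intro!: add_nonneg_nonneg\<close>)
    finally show ?thesis .
  qed
  let ?Z = "{-int N..int N}"
  have R0: "0 \<le> R"
  proof -
    have "G \<noteq> {}" using P by (auto simp: P_def)
    then obtain x where "x \<in> G" by blast
    have "0 \<le> (\<Sum>z\<in>{-int N..int N}. exp (- a * \<bar>real_of_int z\<bar>) * w z x)"
      using w01 by (intro sum_nonneg mult_nonneg_nonneg) auto
    also note pt[OF \<open>x \<in> G\<close>]
    finally show ?thesis .
  qed
  have "P * (\<Sum>z\<in>?Z. exp (- a * \<bar>real_of_int z\<bar>) * exp (- \<beta> * defect M (h * real_of_int z)))
    = (\<Sum>z\<in>?Z. exp (- a * \<bar>real_of_int z\<bar>) * (P * exp (- \<beta> * defect M (h * real_of_int z))))"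
    by (simp add: sum_distrib_left mult_ac)
  also have "\<dots> \<le> (\<Sum>z\<in>?Z. exp (- a * \<bar>real_of_int z\<bar>) * (\<integral>x. indicator G x * w z x \<partial>M))"
    by (intro sum_mono mult_left_mono jensen) auto
  also have "\<dots> = (\<integral>x. (\<Sum>z\<in>?Z. exp (- a * \<bar>real_of_int z\<bar>) * (indicator G x * w z x)) \<partial>M)"
    using intw by (subst Bochner_Integration.integral_sum) auto
  also have "\<dots> \<le> (\<integral>x. indicator G x * R \<partial>M)"
  proof (rule integral_mono)
    show "integrable M (\<lambda>x. \<Sum>z\<in>?Z. exp (- a * \<bar>real_of_int z\<bar>) * (indicator G x * w z x))"
      using intw by auto
    show "integrable M (\<lambda>x. indicator G x * R)"
      by (intro integrable_mult_left integrable_real_indicator) (auto simp: emeasure_eq_measure)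
    show "(\<Sum>z\<in>?Z. exp (- a * \<bar>real_of_int z\<bar>) * (indicator G x * w z x)) \<le> indicator G x * R" for x
      using pt[of x] by (auto simp: indicator_def)
  qed
  also have "\<dots> = P * R" by (simp add: P_def)
  finally show ?thesis using P unfolding R_def by simp
qed

section \<open>Heavy coordinates: a lower bound for the defect without them, a lattice count with
  them\<close>

definition heavy :: "(nat \<Rightarrow> real measure) \<Rightarrow> nat \<Rightarrow> real \<Rightarrow> real \<Rightarrow> real \<Rightarrow> nat set" where
  "heavy \<nu> n q \<tau> s = {k. k < n \<and> q \<le> measure (\<nu> k) {x. \<tau> \<le> s * \<bar>x\<bar>}}"

lemma finite_heavy [simp]: "finite (heavy \<nu> n q \<tau> s)"
  by (simp add: heavy_def)

lemma heavy_mono: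
  assumes "\<And>k. k < n \<Longrightarrow> real_distribution (\<nu> k)" "s \<le> s'"
  shows "heavy \<nu> n q \<tau> s \<subseteq> heavy \<nu> n q \<tau> s'"
proof
  fix k assume k: "k \<in> heavy \<nu> n q \<tau> s"
  then interpret real_distribution "\<nu> k" using assms by (auto simp: heavy_def)
  have "{x. \<tau> \<le> s * \<bar>x\<bar>} \<subseteq> {x. \<tau> \<le> s' * \<bar>x\<bar>}"
    using mult_right_mono[OF assms(2) abs_ge_zero] by (auto intro: order_trans)
  then have "measure (\<nu> k) {x. \<tau> \<le> s * \<bar>x\<bar>} \<le> measure (\<nu> k) {x. \<tau> \<le> s' * \<bar>x\<bar>}"
    by (intro finite_measure_mono) auto
  then show "k \<in> heavy \<nu> n q \<tau> s'" using k by (auto simp: heavy_def)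
qed

lemma card_ge_mult_le_sum:
  fixes f :: "nat \<Rightarrow> real"
  assumes "finite A" "B \<subseteq> A" "\<And>k. k \<in> A \<Longrightarrow> 0 \<le> f k" "\<And>k. k \<in> B \<Longrightarrow> c \<le> f k"
  shows "real (card B) * c \<le> (\<Sum>k\<in>A. f k)"
proof -
  have "real (card B) * c \<le> (\<Sum>k\<in>B. f k)" using sum_mono[of B "\<lambda>_. c" f] assms by simp
  also have "\<dots> \<le> (\<Sum>k\<in>A. f k)" using assms by (intro sum_mono2) auto
  finally show ?thesis .
qed

text \<open>From the \<delta> n coordinates with \<open>|y k| \<ge> \<kappa>\<close> remove the
  heavy ones, at most half, and those with \<open>|y k| > 1 / \<tau>\<close>. By the norm bound the
  latter number at most 4 \<tau>^2 = \<delta> n / 4, which fixes \<tau> = sqrt(\<delta> n) / 4. For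
  each remaining coordinate the angle \<open>s * y k * x\<close> has modulus at most 1 with
  probability at least \<open>q\<close> while \<open>|x| \<ge> 1\<close>, so the cosine is in its
  quadratic range.\<close>

lemma sum_defect_ge_of_not_heavy:
  fixes \<nu> :: "nat \<Rightarrow> real measure" and y :: "nat \<Rightarrow> real" and \<delta> q \<kappa> s :: real
  assumes \<nu>: "\<And>k. k < n \<Longrightarrow> real_distribution (\<nu> k)"
    and q: "\<And>k. k < n \<Longrightarrow> 2 * q \<le> measure (\<nu> k) {x. 1 \<le> \<bar>x\<bar>}" "0 < q"
    and n: "0 < n" and \<delta>: "0 < \<delta>" and s: "0 \<le> s"
    and light: "real (card (heavy \<nu> n q (sqrt (\<delta> * n) / 4) s)) \<le> \<delta> * n / 2"
    and spread: "\<delta> * n \<le> real (card {k. k < n \<and> \<kappa> \<le> \<bar>y k\<bar>})" and \<kappa>: "0 \<le> \<kappa>"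
    and norm: "(\<Sum>k<n. (y k)\<^sup>2) \<le> 4"
  shows "\<delta> * n / 4 * (q * (s * \<kappa>)\<^sup>2 / 4) \<le> (\<Sum>k<n. defect (\<nu> k) (s * y k))"
proof -
  define \<tau> where "\<tau> = sqrt (\<delta> * n) / 4"
  have \<tau>: "0 < \<tau>" "\<tau>\<^sup>2 = \<delta> * n / 16" using n \<delta> by (auto simp: \<tau>_def power_divide)
  let ?H = "heavy \<nu> n q \<tau> s" and ?S = "{k. k < n \<and> \<kappa> \<le> \<bar>y k\<bar>}" and ?L = "{k. k < n \<and> 1 / \<tau> < \<bar>y k\<bar>}"
  define B where "B = ?S - ?H - ?L"
  have "real (card ?L) * (1 / \<tau>)\<^sup>2 \<le> (\<Sum>k\<in>{..<n}. (y k)\<^sup>2)"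
  proof (rule card_ge_mult_le_sum)
    fix k assume "k \<in> ?L"
    then show "(1 / \<tau>)\<^sup>2 \<le> (y k)\<^sup>2" using \<tau> abs_le_square_iff[of "1/\<tau>" "y k"] by auto
  qed auto
  then have "real (card ?L) * (1 / \<tau>)\<^sup>2 \<le> 4" using norm by linarith
  then have "real (card ?L) \<le> 4 * \<tau>\<^sup>2" using \<tau>(1) by (simp add: power_divide divide_simps)
  then have L: "real (card ?L) \<le> \<delta> * n / 4" unfolding \<tau> by simp
  have "card ?S \<le> card (B \<union> (?H \<union> ?L))" unfolding B_def by (intro card_mono) auto
  also have "\<dots> \<le> card B + (card ?H + card ?L)"
    by (intro order_trans[OF card_Un_le] add_left_mono card_Un_le)
  finally have "real (card ?S) \<le> real (card B) + real (card ?H) + real (card ?L)" by simp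
  then have B: "\<delta> * n / 4 \<le> real (card B)" using L light spread unfolding \<tau>_def by linarith
  have "\<delta> * n / 4 * (q * (s * \<kappa>)\<^sup>2 / 4) \<le> real (card B) * (q * (s * \<kappa>)\<^sup>2 / 4)"
    using B q(2) by (intro mult_right_mono) auto
  also have "\<dots> \<le> (\<Sum>k\<in>{..<n}. defect (\<nu> k) (s * y k))"
  proof (rule card_ge_mult_le_sum)
    show "B \<subseteq> {..<n}" by (auto simp: B_def)
    show "0 \<le> defect (\<nu> k) (s * y k)" if "k \<in> {..<n}" for k
      using real_distribution.defect_nonneg[OF \<nu>] that by auto
    fix k assume k: "k \<in> B"
    then have kn: "k < n" by (auto simp: B_def)
    interpret real_distribution "\<nu> k" by (rule \<nu>[OF kn])
    let ?U = "{x::real. 1 \<le> \<bar>x\<bar> \<and> \<bar>s * y k * x\<bar> \<le> 1}"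
    have "{x::real. 1 \<le> \<bar>x\<bar>} \<subseteq> ?U \<union> {x. \<tau> \<le> s * \<bar>x\<bar>}"
    proof
      fix x :: real assume x: "x \<in> {x. 1 \<le> \<bar>x\<bar>}"
      show "x \<in> ?U \<union> {x. \<tau> \<le> s * \<bar>x\<bar>}"
      proof (cases "\<tau> \<le> s * \<bar>x\<bar>")
        case False
        have "\<bar>s * y k * x\<bar> = (s * \<bar>x\<bar>) * \<bar>y k\<bar>" using s by (simp add: abs_mult)
        also have "\<dots> \<le> \<tau> * (1 / \<tau>)" using False k s \<tau> by (intro mult_mono) (auto simp: B_def)
        finally show ?thesis using x \<tau> by simp
      qed auto
    qed
    then have "measure (\<nu> k) {x. 1 \<le> \<bar>x\<bar>} \<le> measure (\<nu> k) (?U \<union> {x. \<tau> \<le> s * \<bar>x\<bar>})"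
      by (intro finite_measure_mono) auto
    also have "\<dots> \<le> measure (\<nu> k) ?U + measure (\<nu> k) {x. \<tau> \<le> s * \<bar>x\<bar>}"
      by (intro measure_Un_le) auto
    finally have "q \<le> measure (\<nu> k) ?U" using q(1)[OF kn] k kn by (auto simp: B_def heavy_def)
    from defect_ge[OF this] have "q * (s * y k)\<^sup>2 / 4 \<le> defect (\<nu> k) (s * y k)" .
    moreover have "(s * \<kappa>)\<^sup>2 \<le> (s * y k)\<^sup>2"
      using k s \<kappa> by (intro power2_mono) (auto simp: abs_mult B_def intro: mult_left_mono)
    then have "q * (s * \<kappa>)\<^sup>2 / 4 \<le> q * (s * y k)\<^sup>2 / 4" using q(2) by simp
    ultimately show "q * (s * \<kappa>)\<^sup>2 / 4 \<le> defect (\<nu> k) (s * y k)" by linarith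
  qed auto
  finally show ?thesis .
qed

text \<open>\<open>card_weighted_le\<close> with a price \<theta> per unit of the l1 norm and a
  price \<open>L\<close> per nonzero coordinate. A coordinate then contributes at most 1 + 2 exp(-L)
  / \<theta>, which a large \<open>L\<close> brings close to 1; the exponent can thus be made a
  small multiple of \<open>n\<close>.\<close>

lemma card_sparse_lattice_le:
  fixes B \<sigma> \<theta> L :: real and n N :: nat
  assumes \<theta>: "0 < \<theta>" and L: "0 \<le> L"
  shows "real (card {z \<in> PiE {..<n} (\<lambda>_. {-int N..int N}).
      (\<Sum>k<n. \<bar>real_of_int (z k)\<bar>) \<le> B * real n \<and> real (card {k. k < n \<and> z k \<noteq> 0}) \<le> \<sigma> * real n})
    \<le> exp (real n * (\<theta> * B + L * \<sigma> + 2 * exp (- L) / \<theta>))"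
proof -
  let ?E = "{-int N..int N}"
  define g where "g = (\<lambda>(k::nat) (z::int). \<theta> * \<bar>real_of_int z\<bar> + (if z = 0 then 0 else L))"
  let ?T = "real n * (\<theta> * B + L * \<sigma>)"
  have "{z \<in> PiE {..<n} (\<lambda>_. ?E). (\<Sum>k<n. \<bar>real_of_int (z k)\<bar>) \<le> B * real n \<and> real (card {k. k < n \<and> z k \<noteq> 0}) \<le> \<sigma> * real n}
      \<subseteq> {z \<in> PiE {..<n} (\<lambda>_. ?E). (\<Sum>k<n. g k (z k)) \<le> ?T}"
  proof safe
    fix z :: "nat \<Rightarrow> int"
    assume a: "(\<Sum>k<n. \<bar>real_of_int (z k)\<bar>) \<le> B * real n" "real (card {k. k < n \<and> z k \<noteq> 0}) \<le> \<sigma> * real n"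
    have "(\<Sum>k<n. if z k = 0 then 0 else L) = (\<Sum>k\<in>{k. k < n \<and> z k \<noteq> 0}. L)"
      by (rule sum.mono_neutral_cong_right) auto
    then have "(\<Sum>k<n. g k (z k)) = \<theta> * (\<Sum>k<n. \<bar>real_of_int (z k)\<bar>) + L * real (card {k. k < n \<and> z k \<noteq> 0})"
      by (simp add: g_def sum.distrib sum_distrib_left)
    also have "\<dots> \<le> \<theta> * (B * real n) + L * (\<sigma> * real n)"
      using a \<theta> L by (intro add_mono mult_left_mono) auto
    finally show "(\<Sum>k<n. g k (z k)) \<le> ?T" by (simp add: algebra_simps)
  qed
  then have "card {z \<in> PiE {..<n} (\<lambda>_. ?E). (\<Sum>k<n. \<bar>real_of_int (z k)\<bar>) \<le> B * real n \<and> real (card {k. k < n \<and> z k \<noteq> 0}) \<le> \<sigma> * real n}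
      \<le> card {z \<in> PiE {..<n} (\<lambda>_. ?E). (\<Sum>k<n. g k (z k)) \<le> ?T}" (is "?c \<le> _")
    by (intro card_mono finite_subset[OF _ finite_PiE[of "{..<n}" "\<lambda>_. ?E"]]) auto
  then have "real ?c \<le> exp ?T * (\<Prod>k<n. \<Sum>z\<in>?E. exp (- g k z))"
    using card_weighted_le[of ?E n g ?T] by (meson finite_atLeastAtMost_int of_nat_mono order_trans)
  also have "\<dots> \<le> exp ?T * (\<Prod>k<n. exp (2 * exp (- L) / \<theta>))"
  proof (intro mult_left_mono prod_mono conjI sum_nonneg)
    fix k
    have "(\<Sum>z\<in>?E. exp (- g k z)) \<le> exp (- g k 0) + 2 * (\<Sum>j\<in>{1..N}. exp (- g k (int j)))"
      by (rule sum_int_symmetric_le) (auto simp: g_def)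
    also have "\<dots> = 1 + 2 * exp (- L) * (\<Sum>j\<in>{1..N}. exp (- \<theta> * real j))"
      by (simp add: g_def sum_distrib_left exp_add[symmetric] exp_diff exp_minus field_simps)
    also have "(\<Sum>j\<in>{1..N}. exp (- \<theta> * real j)) \<le> 1 / \<theta>"
    proof -
      have "(\<Sum>j<Suc N. exp (- \<theta> * real j)) = 1 + (\<Sum>j\<in>{1..N}. exp (- \<theta> * real j))"
        unfolding lessThan_Suc_atMost atMost_atLeast0 by (subst sum.atLeast_Suc_atMost) auto
      then show ?thesis using sum_exp_nat_le[OF \<theta>, of "Suc N"] by simp
    qed
    then have "1 + 2 * exp (- L) * (\<Sum>j\<in>{1..N}. exp (- \<theta> * real j)) \<le> 1 + 2 * exp (- L) * (1 / \<theta>)"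
      by (intro add_left_mono mult_left_mono) auto
    also have "\<dots> \<le> exp (2 * exp (- L) / \<theta>)" using exp_ge_add_one_self[of "2 * exp (- L) / \<theta>"] by simp
    finally show "(\<Sum>z\<in>?E. exp (- g k z)) \<le> exp (2 * exp (- L) / \<theta>)" .
  qed auto
  also have "\<dots> = exp (real n * (\<theta> * B + L * \<sigma> + 2 * exp (- L) / \<theta>))"
    by (simp add: exp_of_nat_mult[symmetric] exp_add[symmetric] algebra_simps)
  finally show ?thesis .
qed

text \<open>Under the l1 constraint alone a coordinate contributes a factor \<Gamma> D. On
  \<open>G\<close>, the heavy coordinates of moderate second moment, equidistribution modulo 2 \<pi>
  leaves only the proportion exp(-4 \<Lambda> / \<delta>) of it. As \<open>G\<close> has at least
  \<delta> n / 4 elements, the total gain is exp(-\<Lambda> n). Heaviness bounds the entries below,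
  so that the angles sweep far enough; the moment bounds them above, so that the angular steps
  \<open>h * u\<close> are small.\<close>

lemma card_structured_lattice_le:
  fixes \<nu> :: "nat \<Rightarrow> real measure" and V K q \<delta> D s \<beta> \<omega> \<Lambda> :: real
  defines "\<Gamma> \<equiv> 1 + 6 * sqrt K"
  assumes \<nu>: "\<And>k. k < n \<Longrightarrow> real_distribution (\<nu> k)"
    and sq: "\<And>k. k < n \<Longrightarrow> integrable (\<nu> k) (\<lambda>x. x\<^sup>2)"
    and var: "(\<Sum>k<n. \<integral>x. x\<^sup>2 \<partial>\<nu> k) \<le> V * (real n)\<^sup>2" "0 < V"
    and n: "0 < n" and K: "1 \<le> K" and q: "0 < q" and \<delta>: "0 < \<delta>"
    and D: "1 \<le> D" "D \<le> s" "s \<le> 2 * D"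
    and heavy: "\<delta> * n / 2 \<le> real (card (heavy \<nu> n q (sqrt (\<delta> * n) / 4) s))"
    and \<omega>: "0 < \<omega>" "\<omega> \<le> 1" and \<beta>: "0 \<le> \<beta>" and \<Lambda>: "0 \<le> \<Lambda>"
    and V1: "8 * V \<le> \<delta> * q * K"
    and small: "2 * (sqrt (8 * V / (\<delta> * q * K)) + 2 * \<omega> + exp (- \<beta> * (q / 2) * \<omega>\<^sup>2 / 40)) * (sqrt K * (8 / sqrt \<delta> + 6))
       \<le> \<Gamma> * exp (- 4 * \<Lambda> / \<delta>)"
  shows "real (card {z \<in> PiE {..<n} (\<lambda>_. {-int N..int N}).
      (\<Sum>k<n. \<bar>real_of_int (z k)\<bar>) \<le> 3 * D * sqrt K * n \<and>
      \<beta> * (\<Sum>k<n. defect (\<nu> k) (1 / sqrt (K * n) * real_of_int (z k))) \<le> n})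
    \<le> exp (2 * n) * (\<Gamma> * D) ^ n * exp (- \<Lambda> * n)"
proof -
  let ?E = "{-int N..int N}"
  define h where "h = 1 / sqrt (K * n)"
  \<comment> \<open>The l1 constraint then costs exactly \<open>n\<close> in the exponent, and 2 / a
    stays of order D.\<close>
  define a where "a = 1 / (3 * D * sqrt K)"
  define \<tau> where "\<tau> = sqrt (\<delta> * n) / 4"
  \<comment> \<open>Chebyshev level: a second moment of at most 4 V n / \<delta> leaves mass at most
    q / 2 beyond \<open>u\<close>.\<close>
  define u where "u = sqrt (8 * V * n / (\<delta> * q))"
  have K0: "0 < sqrt K" using K by simp
  have hpos: "0 < h" and apos: "0 < a" and \<tau>: "0 < \<tau>" and u: "0 < u"
    using K n D \<delta> q var by (auto simp: h_def a_def \<tau>_def u_def)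
  have u2: "u\<^sup>2 = 8 * V * n / (\<delta> * q)" unfolding u_def using var(2) \<delta> q by simp
  define g where "g = (\<lambda>k (z::int). a * \<bar>real_of_int z\<bar> + \<beta> * defect (\<nu> k) (h * real_of_int z))"
  define H where "H = heavy \<nu> n q \<tau> s"
  \<comment> \<open>By Markov's inequality for the sum of second moments, \<open>W\<close> has at
    most \<delta> n / 4 elements, half of the guaranteed number of heavy coordinates.\<close>
  define W where "W = {k. k < n \<and> 4 * V * n / \<delta> < (\<integral>x. x\<^sup>2 \<partial>\<nu> k)}"
  define G where "G = H - W"
  let ?Z = "{z \<in> PiE {..<n} (\<lambda>_. ?E). (\<Sum>k<n. \<bar>real_of_int (z k)\<bar>) \<le> 3 * D * sqrt K * n \<and>
      \<beta> * (\<Sum>k<n. defect (\<nu> k) (1 / sqrt (K * n) * real_of_int (z k))) \<le> n}"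
  have "?Z \<subseteq> {z \<in> PiE {..<n} (\<lambda>_. ?E). (\<Sum>k<n. g k (z k)) \<le> 2 * n}"
  proof safe
    fix z :: "nat \<Rightarrow> int"
    assume z: "(\<Sum>k<n. \<bar>real_of_int (z k)\<bar>) \<le> 3 * D * sqrt K * n"
      "\<beta> * (\<Sum>k<n. defect (\<nu> k) (1 / sqrt (K * n) * real_of_int (z k))) \<le> n"
    have "a * (\<Sum>k<n. \<bar>real_of_int (z k)\<bar>) \<le> a * (3 * D * sqrt K * n)"
      using z(1) apos by (intro mult_left_mono) auto
    also have "\<dots> = n" using D K0 by (simp add: a_def)
    finally have "a * (\<Sum>k<n. \<bar>real_of_int (z k)\<bar>) \<le> n" .
    then show "(\<Sum>k<n. g k (z k)) \<le> 2 * n"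
      using z(2) by (simp add: g_def sum.distrib sum_distrib_left h_def)
  qed
  then have "card ?Z \<le> card {z \<in> PiE {..<n} (\<lambda>_. ?E). (\<Sum>k<n. g k (z k)) \<le> 2 * n}"
    by (intro card_mono finite_subset[OF _ finite_PiE[of "{..<n}" "\<lambda>_. ?E"]]) auto
  then have 1: "real (card ?Z) \<le> exp (2 * n) * (\<Prod>k<n. \<Sum>z\<in>?E. exp (- g k z))"
    using card_weighted_le[of ?E n g "2 * n"] by (meson finite_atLeastAtMost_int of_nat_mono order_trans)
  have \<Gamma>: "0 < \<Gamma>" unfolding \<Gamma>_def using K0 by (intro add_pos_pos) auto
  define \<theta> where "\<theta> = exp (- 4 * \<Lambda> / \<delta>)"
  have all: "(\<Sum>z\<in>?E. exp (- g k z)) \<le> \<Gamma> * D" if k: "k < n" for k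
  proof -
    interpret real_distribution "\<nu> k" by (rule \<nu>[OF k])
    have "(\<Sum>z\<in>?E. exp (- g k z)) \<le> (\<Sum>z\<in>?E. exp (- a * \<bar>real_of_int z\<bar>))"
      using \<beta> defect_nonneg by (intro sum_mono) (auto simp: g_def)
    also have "\<dots> \<le> 1 + 2 / a" by (rule sum_exp_int_le[OF apos])
    also have "2 / a = 6 * sqrt K * D" by (simp add: a_def)
    also have "1 + 6 * sqrt K * D \<le> \<Gamma> * D" using D(1) by (simp add: \<Gamma>_def algebra_simps)
    finally show ?thesis .
  qed
  have good: "(\<Sum>z\<in>?E. exp (- g k z)) \<le> \<Gamma> * D * \<theta>" if k: "k \<in> G" for k
  proof -
    have kn: "k < n" using k by (auto simp: G_def H_def heavy_def)
    interpret real_distribution "\<nu> k" by (rule \<nu>[OF kn])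
    have m1: "q \<le> measure (\<nu> k) {x. \<tau> \<le> s * \<bar>x\<bar>}" using k by (auto simp: G_def H_def heavy_def)
    have "measure (\<nu> k) {x. u < \<bar>x\<bar>} * u\<^sup>2 = (\<integral>x. indicator {x. u < \<bar>x\<bar>} x * u\<^sup>2 \<partial>\<nu> k)" by simp
    also have "\<dots> \<le> (\<integral>x. x\<^sup>2 \<partial>\<nu> k)"
    proof (rule integral_mono[OF _ sq[OF kn]])
      show "integrable (\<nu> k) (\<lambda>x. indicator {x. u < \<bar>x\<bar>} x * u\<^sup>2)"
        by (intro integrable_mult_left integrable_real_indicator) (auto simp: emeasure_eq_measure)
      show "indicator {x. u < \<bar>x\<bar>} x * u\<^sup>2 \<le> x\<^sup>2" for x
        using u abs_le_square_iff[of u x] by (auto simp: indicator_def)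
    qed
    also have "\<dots> \<le> 4 * V * n / \<delta>" using k kn by (auto simp: G_def W_def)
    also have "\<dots> = q / 2 * u\<^sup>2" unfolding u2 using q \<delta> by (simp add: field_simps)
    finally have m2: "measure (\<nu> k) {x. u < \<bar>x\<bar>} \<le> q / 2" using u by simp
    have "{x. \<tau> \<le> s * \<bar>x\<bar>} \<subseteq> {x. \<tau> / s \<le> \<bar>x\<bar> \<and> \<bar>x\<bar> \<le> u} \<union> {x. u < \<bar>x\<bar>}"
      using D by (auto simp: pos_divide_le_eq mult.commute)
    then have "measure (\<nu> k) {x. \<tau> \<le> s * \<bar>x\<bar>} \<le> measure (\<nu> k) ({x. \<tau> / s \<le> \<bar>x\<bar> \<and> \<bar>x\<bar> \<le> u} \<union> {x. u < \<bar>x\<bar>})"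
      by (intro finite_measure_mono) auto
    also have "\<dots> \<le> measure (\<nu> k) {x. \<tau> / s \<le> \<bar>x\<bar> \<and> \<bar>x\<bar> \<le> u} + measure (\<nu> k) {x. u < \<bar>x\<bar>}"
      by (intro measure_Un_le) auto
    finally have m3: "q / 2 \<le> measure (\<nu> k) {x. \<tau> / s \<le> \<bar>x\<bar> \<and> \<bar>x\<bar> \<le> u}" using m1 m2 by linarith
    have hu: "h * u = sqrt (8 * V / (\<delta> * q * K))"
      unfolding h_def u_def using n K by (simp add: real_sqrt_divide[symmetric] real_sqrt_mult[symmetric] mult_ac)
    have hl: "1 / (h * (\<tau> / s)) = s * (4 * sqrt K / sqrt \<delta>)"
      unfolding h_def \<tau>_def using n by (simp add: real_sqrt_mult field_simps)
    have "(\<Sum>z\<in>?E. exp (- g k z)) = (\<Sum>z\<in>?E. exp (- a * \<bar>real_of_int z\<bar>) * exp (- \<beta> * defect (\<nu> k) (h * real_of_int z)))"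
      by (simp add: g_def exp_add[symmetric])
    also have "\<dots> \<le> 2 * (h * u + 2 * \<omega> + exp (- \<beta> * (q / 2) * \<omega>\<^sup>2 / 40)) * (1 / (h * (\<tau> / s)) + 2 / a)"
    proof (rule exp_defect_lattice_sum_le[OF _ m3 apos hpos _ _ \<omega> \<beta>])
      show "h * u \<le> 1" unfolding hu using V1 \<delta> q K by simp
    qed (use q \<tau> D in auto)
    also have "\<dots> \<le> 2 * (h * u + 2 * \<omega> + exp (- \<beta> * (q / 2) * \<omega>\<^sup>2 / 40)) * (D * (sqrt K * (8 / sqrt \<delta> + 6)))"
    proof (rule mult_left_mono)
      have "s * (4 * sqrt K / sqrt \<delta>) \<le> (2 * D) * (4 * sqrt K / sqrt \<delta>)"
        using D K0 \<delta> by (intro mult_right_mono) auto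
      then show "1 / (h * (\<tau> / s)) + 2 / a \<le> D * (sqrt K * (8 / sqrt \<delta> + 6))"
        unfolding hl a_def by (simp add: algebra_simps)
    qed (use hpos u \<omega> in \<open>auto intro!: add_nonneg_nonneg\<close>)
    also have "\<dots> = D * (2 * (sqrt (8 * V / (\<delta> * q * K)) + 2 * \<omega> + exp (- \<beta> * (q / 2) * \<omega>\<^sup>2 / 40)) * (sqrt K * (8 / sqrt \<delta> + 6)))"
      unfolding hu by (simp only: mult_ac)
    also have "\<dots> \<le> D * (\<Gamma> * \<theta>)" unfolding \<theta>_def using small D by (intro mult_left_mono) auto
    finally show ?thesis by (simp only: mult_ac)
  qed
  have cardG: "\<delta> * n / 4 \<le> real (card G)"
  proof -
    have "real (card W) * (4 * V * n / \<delta>) \<le> (\<Sum>k\<in>{..<n}. \<integral>x. x\<^sup>2 \<partial>\<nu> k)"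
      by (rule card_ge_mult_le_sum) (auto simp: W_def)
    also note var(1)
    finally have "real (card W) \<le> \<delta> * n / 4"
      using n var(2) \<delta> by (simp add: field_simps power2_eq_square)
    moreover have "card H \<le> card G + card W"
    proof -
      have "card H \<le> card (G \<union> W)" unfolding G_def by (intro card_mono) (auto simp: H_def W_def)
      also have "\<dots> \<le> card G + card W" by (rule card_Un_le)
      finally show ?thesis .
    qed
    ultimately show ?thesis using heavy unfolding H_def \<tau>_def by linarith
  qed
  have GD: "0 \<le> \<Gamma> * D" using \<Gamma> D by simp
  have "(\<Prod>k<n. \<Sum>z\<in>?E. exp (- g k z)) \<le> (\<Prod>k<n. \<Gamma> * D * (if k \<in> G then \<theta> else 1))"
    by (intro prod_mono conjI sum_nonneg) (use all good in auto)
  also have "\<dots> = (\<Gamma> * D) ^ n * (\<Prod>k<n. if k \<in> G then \<theta> else 1)" by (simp add: prod.distrib)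
  also have "(\<Prod>k<n. if k \<in> G then \<theta> else 1) = \<theta> ^ card G"
  proof -
    have "(\<Prod>k<n. if k \<in> G then \<theta> else 1) = (\<Prod>k\<in>G. \<theta>)"
      by (rule prod.mono_neutral_cong_right) (auto simp: G_def H_def heavy_def)
    then show ?thesis by simp
  qed
  also have "(\<Gamma> * D) ^ n * \<theta> ^ card G \<le> (\<Gamma> * D) ^ n * exp (- \<Lambda> * n)"
  proof (rule mult_left_mono)
    have "\<theta> ^ card G = exp (real (card G) * (- 4 * \<Lambda> / \<delta>))" unfolding \<theta>_def by (rule exp_of_nat_mult[symmetric])
    also have "\<dots> \<le> exp (- \<Lambda> * n)"
    proof -
      have "\<delta> * n / 4 * (4 * \<Lambda> / \<delta>) \<le> real (card G) * (4 * \<Lambda> / \<delta>)"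
        using cardG \<Lambda> \<delta> by (intro mult_right_mono) auto
      then show ?thesis using \<delta> by (simp add: mult.commute)
    qed
    finally show "\<theta> ^ card G \<le> exp (- \<Lambda> * n)" .
  qed (use GD in simp)
  finally have "(\<Prod>k<n. \<Sum>z\<in>?E. exp (- g k z)) \<le> (\<Gamma> * D) ^ n * exp (- \<Lambda> * n)" .
  then have "exp (2 * n) * (\<Prod>k<n. \<Sum>z\<in>?E. exp (- g k z)) \<le> exp (2 * n) * ((\<Gamma> * D) ^ n * exp (- \<Lambda> * n))"
    by (rule mult_left_mono) simp
  from order_trans[OF 1 this] show ?thesis by (simp only: mult.assoc of_nat_mult of_nat_numeral)
qed

text \<open>On the ball \<open>cos (t * x) \<ge> 1 - d / 2\<close>, elsewhere it is at least -1. Too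
  much mass in the ball would push the real part of the characteristic function above 1 - d.\<close>

lemma (in real_distribution) measure_ball_le_of_char:
  fixes d c t :: real
  assumes d: "0 < d" "d \<le> 1" and t: "\<bar>t\<bar> \<le> 1" and ch: "cmod (char M t) \<le> 1 - d" and c: "0 < c" "c\<^sup>2 \<le> d"
  shows "measure M {x. \<bar>x\<bar> < c} \<le> (2 - d) / (2 - d / 2)"
proof -
  define p where "p = measure M {x. \<bar>x\<bar> < c}"
  have "p * (2 - d / 2) - 1 = (\<integral>x. indicator {x. \<bar>x\<bar> < c} x * (2 - d / 2) - 1 \<partial>M)"
    using prob_space unfolding p_def
    by (subst Bochner_Integration.integral_diff)
      (auto intro!: integrable_mult_left integrable_real_indicator simp: emeasure_eq_measure)
  also have "\<dots> \<le> (\<integral>x. cos (t * x) \<partial>M)"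
  proof (rule integral_mono)
    show "integrable M (\<lambda>x. indicator {x. \<bar>x\<bar> < c} x * (2 - d / 2) - 1)"
      by (intro Bochner_Integration.integrable_diff integrable_mult_left integrable_real_indicator)
        (auto simp: emeasure_eq_measure)
    show "integrable M (\<lambda>x. cos (t * x))" using integrable_cos[of t 0] by simp
    fix x
    show "indicator {x. \<bar>x\<bar> < c} x * (2 - d / 2) - 1 \<le> cos (t * x)"
    proof (cases "\<bar>x\<bar> < c")
      case True
      have "\<bar>t * x\<bar> \<le> 1 * c" using t True unfolding abs_mult by (intro mult_mono) auto
      then have "(t * x)\<^sup>2 \<le> c\<^sup>2" using c(1) by (metis abs_le_square_iff abs_of_pos mult_1)
      then have "1 - cos (t * x) \<le> d / 2" using one_minus_cos_le[of "t * x"] c(2) by linarith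
      then show ?thesis using True by simp
    next
      case False
      then show ?thesis using cos_ge_minus_one[of "t * x"] by (simp del: cos_ge_minus_one)
    qed
  qed
  also have "\<dots> \<le> cmod (char M t)" using integral_cos_le_char[of t 0] by simp
  finally have "p * (2 - d / 2) \<le> 2 - d" using ch by linarith
  then show ?thesis using d unfolding p_def by (simp add: pos_le_divide_eq)
qed

section \<open>Random columns\<close>

text \<open>Trades the Gaussian for an exponential, whose primitive is elementary.\<close>

lemma exp_neg_square_le: "exp (- x\<^sup>2) \<le> 2 * exp (- x)" for x :: real
proof -
  have "- x\<^sup>2 = - (x - 1/2)\<^sup>2 + (1/4 - x)" by (simp add: power2_eq_square algebra_simps)
  then have "exp (- x\<^sup>2) \<le> exp (1/4 - x)" by simp
  also have "\<dots> = exp (1/4) * exp (- x)" by (simp add: exp_add[symmetric])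
  also have "exp (1/4 :: real) \<le> 2"
    using exp_bound[of "1/4"] by (simp add: power2_eq_square)
  then have "exp (1/4) * exp (- x) \<le> 2 * exp (- x)" by (intro mult_right_mono) auto
  finally show ?thesis .
qed

lemma (in prob_space) Markov_ratio_le:
  fixes u :: "'a \<Rightarrow> real"
  assumes "integrable M u" "\<And>\<omega>. \<omega> \<in> space M \<Longrightarrow> 0 \<le> u \<omega>" "0 < c"
  shows "prob {\<omega> \<in> space M. c \<le> u \<omega>} \<le> expectation u / c"
  by (rule integral_Markov_inequality_measure[where A = "{}"]) (use assms in auto)

text \<open>\<open>X i k\<close> is the \<open>k\<close>-th coordinate of the \<open>i\<close>-th column.\<close>

locale random_columns = prob_space M for M :: "'w measure" +
  fixes X :: "nat \<Rightarrow> nat \<Rightarrow> 'w \<Rightarrow> real" and n :: nat and K b :: real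
  assumes indep: "indep_vars (\<lambda>_. borel) (\<lambda>(i, k). X i k) ({..<n} \<times> {..<n})"
    and conc: "\<And>i k u. i < n \<Longrightarrow> k < n \<Longrightarrow> prob {\<omega> \<in> space M. \<bar>X i k \<omega> - u\<bar> < 1} \<le> b"
    and sq: "\<And>i k. i < n \<Longrightarrow> k < n \<Longrightarrow> integrable M (\<lambda>\<omega>. (X i k \<omega>)\<^sup>2)"
    and total: "(\<Sum>i<n. \<Sum>k<n. expectation (\<lambda>\<omega>. (X i k \<omega>)\<^sup>2)) \<le> K * (real n)\<^sup>2"
    and n: "0 < n" and K: "1 \<le> K" and b: "b < 1"
begin

section \<open>Characteristic functions and small balls for inner products with a column\<close>

definition law :: "nat \<Rightarrow> nat \<Rightarrow> real measure" where
  "law i k = distr M borel (X i k)"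

definition nu :: "nat \<Rightarrow> nat \<Rightarrow> real measure" where
  "nu i k = symm (law i k)"

definition Psi :: "nat \<Rightarrow> (nat \<Rightarrow> real) \<Rightarrow> real \<Rightarrow> real" where
  "Psi i y s = (\<Sum>k<n. defect (nu i k) (s * y k))"

definition Z :: "(nat \<Rightarrow> real) \<Rightarrow> nat \<Rightarrow> 'w \<Rightarrow> real" where
  "Z y i \<omega> = (\<Sum>k<n. y k * X i k \<omega>)"

definition mom :: "nat \<Rightarrow> real" where
  "mom i = (\<Sum>k<n. expectation (\<lambda>\<omega>. (X i k \<omega>)\<^sup>2))"

text \<open>The squared weights by which columns of large norm are rescaled.\<close>

definition w2 :: "nat \<Rightarrow> 'w \<Rightarrow> real" where
  "w2 i \<omega> = 1 + (\<Sum>k<n. (X i k \<omega>)\<^sup>2) / (K * real n)"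

lemma X_measurable [measurable]: "i < n \<Longrightarrow> k < n \<Longrightarrow> X i k \<in> borel_measurable M"
  using indep unfolding indep_vars_def by force

lemma real_distribution_law: "i < n \<Longrightarrow> k < n \<Longrightarrow> real_distribution (law i k)"
  unfolding law_def by (intro real_distribution_distr X_measurable)

lemma real_distribution_nu: "i < n \<Longrightarrow> k < n \<Longrightarrow> real_distribution (nu i k)"
  unfolding nu_def by (intro real_distribution.real_distribution_symm real_distribution_law)

lemma nu_ge: assumes "i < n" "k < n" shows "1 - b \<le> measure (nu i k) {x. 1 \<le> \<bar>x\<bar>}"
  unfolding nu_def
proof (rule real_distribution.measure_symm_ge[OF real_distribution_law[OF assms]])
  fix u
  have "measure (law i k) {x. \<bar>x - u\<bar> < 1} = prob {\<omega> \<in> space M. \<bar>X i k \<omega> - u\<bar> < 1}"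
    unfolding law_def using X_measurable[OF assms]
    by (subst measure_distr) (auto intro!: arg_cong[where f = prob])
  then show "measure (law i k) {x. \<bar>x - u\<bar> < 1} \<le> b" using conc[OF assms] by simp
qed

lemma nu_sq:
  assumes "i < n" "k < n"
  shows "integrable (nu i k) (\<lambda>x. x\<^sup>2)" "(\<integral>x. x\<^sup>2 \<partial>nu i k) \<le> 4 * expectation (\<lambda>\<omega>. (X i k \<omega>)\<^sup>2)"
proof -
  interpret L: real_distribution "law i k" by (rule real_distribution_law[OF assms])
  have i: "integrable (law i k) (\<lambda>x. x\<^sup>2)"
    unfolding law_def using sq[OF assms] X_measurable[OF assms] by (subst integrable_distr_eq) auto
  have e: "(\<integral>x. x\<^sup>2 \<partial>law i k) = expectation (\<lambda>\<omega>. (X i k \<omega>)\<^sup>2)"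
    unfolding law_def using X_measurable[OF assms] by (subst integral_distr) auto
  show "integrable (nu i k) (\<lambda>x. x\<^sup>2)" "(\<integral>x. x\<^sup>2 \<partial>nu i k) \<le> 4 * expectation (\<lambda>\<omega>. (X i k \<omega>)\<^sup>2)"
    using L.symm_second_moment[OF i] unfolding nu_def e by auto
qed

lemma mom_nonneg: "0 \<le> mom i"
  unfolding mom_def by (intro sum_nonneg Bochner_Integration.integral_nonneg) auto

lemma sum_nu_sq_le: "i < n \<Longrightarrow> (\<Sum>k<n. \<integral>x. x\<^sup>2 \<partial>nu i k) \<le> 4 * mom i"
  unfolding mom_def sum_distrib_left by (intro sum_mono nu_sq) auto

text \<open>\<open>defect_add\<close> costs the factor 2; the discrepancy, at most \<open>m\<close>
  per coordinate, is paid by second moments, which symmetrisation multiplies by at most 4.\<close>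

lemma Psi_perturb:
  assumes i: "i < n" and m: "\<And>k. k < n \<Longrightarrow> \<bar>s * y k - s' * v k\<bar> \<le> m"
  shows "Psi i y s \<le> 2 * Psi i v s' + 4 * m\<^sup>2 * mom i"
proof -
  have "Psi i y s \<le> (\<Sum>k<n. 2 * defect (nu i k) (s' * v k) + m\<^sup>2 * (\<integral>x. x\<^sup>2 \<partial>nu i k))"
    unfolding Psi_def
  proof (rule sum_mono)
    fix k assume "k \<in> {..<n}"
    then have k: "k < n" by simp
    interpret N: real_distribution "nu i k" by (rule real_distribution_nu[OF i k])
    define d where "d = s * y k - s' * v k"
    have "defect (nu i k) (s * y k) = defect (nu i k) (s' * v k + d)" by (simp add: d_def)
    also have "\<dots> \<le> 2 * defect (nu i k) (s' * v k) + 2 * defect (nu i k) d" by (rule N.defect_add)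
    also have "2 * defect (nu i k) d \<le> d\<^sup>2 * (\<integral>x. x\<^sup>2 \<partial>nu i k)"
      using N.defect_le_moment[OF nu_sq(1)[OF i k], of d] by simp
    also have "\<dots> \<le> m\<^sup>2 * (\<integral>x. x\<^sup>2 \<partial>nu i k)"
    proof (rule mult_right_mono)
      show "d\<^sup>2 \<le> m\<^sup>2" using m[OF k] unfolding d_def[symmetric] by (metis abs_ge_zero power2_abs power_mono)
    qed simp
    finally show "defect (nu i k) (s * y k) \<le> 2 * defect (nu i k) (s' * v k) + m\<^sup>2 * (\<integral>x. x\<^sup>2 \<partial>nu i k)" by simp
  qed
  also have "\<dots> = 2 * Psi i v s' + m\<^sup>2 * (\<Sum>k<n. \<integral>x. x\<^sup>2 \<partial>nu i k)"
    by (simp add: sum.distrib sum_distrib_left Psi_def)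
  also have "\<dots> \<le> 2 * Psi i v s' + m\<^sup>2 * (4 * mom i)"
    using sum_nu_sq_le[OF i] by (intro add_left_mono mult_left_mono) auto
  finally show ?thesis by simp
qed

lemma indep_columns:
  fixes F :: "nat \<Rightarrow> (nat \<Rightarrow> real) \<Rightarrow> real"
  assumes m: "\<And>i. i < n \<Longrightarrow> F i \<in> borel_measurable (PiM {..<n} (\<lambda>_. borel))"
  shows "indep_vars (\<lambda>_. borel) (\<lambda>i \<omega>. F i (\<lambda>k\<in>{..<n}. X i k \<omega>)) {..<n}"
proof -
  have 1: "indep_vars (\<lambda>i. PiM ({i} \<times> {..<n}) (\<lambda>_. borel))
      (\<lambda>i \<omega>. restrict (\<lambda>p. (case p of (i, k) \<Rightarrow> X i k) \<omega>) ({i} \<times> {..<n})) {..<n}"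
    by (rule indep_vars_restrict[OF indep]) (auto simp: disjoint_family_on_def)
  have "indep_vars (\<lambda>_. borel) (\<lambda>i \<omega>. (\<lambda>f. F i (\<lambda>k\<in>{..<n}. f (i, k)))
     (restrict (\<lambda>p. (case p of (i, k) \<Rightarrow> X i k) \<omega>) ({i} \<times> {..<n}))) {..<n}"
  proof (rule indep_vars_compose2[OF 1])
    fix i assume "i \<in> {..<n}"
    then have [measurable]: "F i \<in> borel_measurable (PiM {..<n} (\<lambda>_. borel))" using m by auto
    have "(\<lambda>f. \<lambda>k\<in>{..<n}. f (i, k)) \<in> measurable (PiM ({i} \<times> {..<n}) (\<lambda>_. borel)) (PiM {..<n} (\<lambda>_. borel :: real measure))"
      by (rule measurable_restrict) (auto intro: measurable_component_singleton)
    then show "(\<lambda>f. F i (\<lambda>k\<in>{..<n}. f (i, k))) \<in> borel_measurable (PiM ({i} \<times> {..<n}) (\<lambda>_. borel))"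
      by measurable
  qed
  moreover have "(\<lambda>k\<in>{..<n}. restrict (\<lambda>p. (case p of (i, k) \<Rightarrow> X i k) \<omega>) ({i} \<times> {..<n}) (i, k)) = (\<lambda>k\<in>{..<n}. X i k \<omega>)" for i \<omega>
    by (auto simp: restrict_def)
  ultimately show ?thesis by simp
qed

lemma indep_Z:
  assumes [measurable]: "\<And>i. g i \<in> borel_measurable borel"
  shows "indep_vars (\<lambda>_. borel) (\<lambda>i \<omega>. g i (Z y i \<omega>) :: real) {..<n}"
proof -
  have "(\<lambda>f. g i (\<Sum>k<n. y k * f k)) \<in> borel_measurable (PiM {..<n} (\<lambda>_. borel))" for i
    by measurable
  from indep_columns[of "\<lambda>i f. g i (\<Sum>k<n. y k * f k)", OF this]
  show ?thesis unfolding Z_def by simp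
qed

lemma Z_measurable [measurable]: "i < n \<Longrightarrow> Z y i \<in> borel_measurable M"
  unfolding Z_def by measurable

lemma real_distribution_Z: "i < n \<Longrightarrow> real_distribution (distr M borel (Z y i))"
  by (intro real_distribution_distr Z_measurable)

lemma char_Z_le:
  assumes i: "i < n"
  shows "cmod (char (distr M borel (Z y i)) s) \<le> exp (- Psi i y s / 2)"
proof -
  have 1: "indep_vars (\<lambda>k. PiM {(i, k)} (\<lambda>_. borel))
      (\<lambda>k \<omega>. restrict (\<lambda>p. (case p of (i, k) \<Rightarrow> X i k) \<omega>) {(i, k)}) {..<n}"
    using i by (intro indep_vars_restrict[OF indep]) (auto simp: disjoint_family_on_def)
  have "indep_vars (\<lambda>_. borel) (\<lambda>k \<omega>. (\<lambda>f. y k * f (i, k)) (restrict (\<lambda>p. (case p of (i, k) \<Rightarrow> X i k) \<omega>) {(i, k)})) {..<n}"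
    by (rule indep_vars_compose2[OF 1]) measurable
  then have 2: "indep_vars (\<lambda>_. borel) (\<lambda>k \<omega>. y k * X i k \<omega>) {..<n}" by simp
  have "char (distr M borel (Z y i)) s = (\<Prod>k<n. char (distr M borel (\<lambda>\<omega>. y k * X i k \<omega>)) s)"
    unfolding Z_def[abs_def] by (rule char_distr_sum[OF 2])
  also have "\<dots> = (\<Prod>k<n. char (law i k) (s * y k))"
  proof (rule prod.cong[OF refl])
    fix k assume "k \<in> {..<n}"
    then have [measurable]: "X i k \<in> borel_measurable M" using i X_measurable by auto
    show "char (distr M borel (\<lambda>\<omega>. y k * X i k \<omega>)) s = char (law i k) (s * y k)"
      unfolding char_def law_def by (simp add: integral_distr mult.assoc)
  qed
  finally have "cmod (char (distr M borel (Z y i)) s) = (\<Prod>k<n. cmod (char (law i k) (s * y k)))"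
    by (simp add: prod_norm)
  also have "\<dots> \<le> (\<Prod>k<n. exp (- defect (nu i k) (s * y k) / 2))"
    unfolding nu_def using i by (intro prod_mono conjI real_distribution.cmod_char_le_exp real_distribution_law) auto
  also have "\<dots> = exp (- Psi i y s / 2)"
    by (simp add: exp_sum[symmetric] Psi_def sum_negf[symmetric] sum_divide_distrib)
  finally show ?thesis .
qed

text \<open>If \<open>Psi\<close> dominates \<open>min (\<alpha> s\<^sup>2) (\<beta> n)\<close> up to the frequency \<open>D\<close>, then \<open>\<langle>y, X\<^sub>i\<rangle>\<close> has a
  bounded density at scale \<open>1 / D\<close>.\<close>

lemma expectation_cauchy_le:
  assumes i: "i < n" and pos: "0 < \<alpha>" "0 < D" and D: "D \<le> exp (\<beta> * real n / 2)"
    and Psi: "\<And>s. 0 \<le> s \<Longrightarrow> s \<le> D \<Longrightarrow> \<alpha> * s\<^sup>2 \<le> Psi i y s \<or> \<beta> * real n \<le> Psi i y s"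
  shows "expectation (\<lambda>\<omega>. 1 / (1 + (D * (Z y i \<omega> - u))\<^sup>2)) \<le> 20 * (2 / sqrt (\<alpha> / 2) + 1) / D"
proof -
  interpret U: prob_space unif01 by (rule prob_space_unif01)
  interpret L: real_distribution "distr M borel (Z y i)" by (rule real_distribution_Z[OF i])
  \<comment> \<open>With this choice exp(-\<alpha> (t D)^2 / 2) becomes exp(-(A t)^2).\<close>
  define A where "A = sqrt (\<alpha> / 2) * D"
  have A: "0 < A" using pos by (simp add: A_def)
  let ?c = "\<lambda>s. cmod (char (distr M borel (Z y i)) s)"
  have cm [measurable]: "char (distr M borel (Z y i)) \<in> borel_measurable borel" by (rule L.char_measurable)
  have "expectation (\<lambda>\<omega>. 1 / (1 + (D * (Z y i \<omega> - u))\<^sup>2)) = (\<integral>x. 1 / (1 + (D * (x - u))\<^sup>2) \<partial>distr M borel (Z y i))"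
    using Z_measurable[OF i] by (subst integral_distr) auto
  also have "\<dots> \<le> 20 * (\<integral>t. ?c (t * D) \<partial>unif01)" by (rule L.esseen[OF pos(2)])
  also have "(\<integral>t. ?c (t * D) \<partial>unif01) \<le> (\<integral>t. 2 * exp (- (A * t)) + 1 / D \<partial>unif01)"
  proof (rule integral_mono_AE)
    show "integrable unif01 (\<lambda>t. ?c (t * D))"
      using L.cmod_char_le_1 by (intro integrable_unif01[of _ 1]) auto
    show "integrable unif01 (\<lambda>t. 2 * exp (- (A * t)) + 1 / D)"
      using A pos by (intro integrable_unif01[of _ "2 + 1 / D"]) (auto simp: abs_of_nonneg add_nonneg_nonneg)
    show "AE t in unif01. ?c (t * D) \<le> 2 * exp (- (A * t)) + 1 / D"
      using AE_unif01
    proof eventually_elim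
      case (elim t)
      then have "0 \<le> t * D" "t * D \<le> D" using pos by (auto simp: mult_left_le_one_le)
      from Psi[OF this] show ?case
      proof
        assume "\<alpha> * (t * D)\<^sup>2 \<le> Psi i y (t * D)"
        then have "?c (t * D) \<le> exp (- (\<alpha> * (t * D)\<^sup>2) / 2)"
          by (intro order_trans[OF char_Z_le[OF i]]) simp
        also have "- (\<alpha> * (t * D)\<^sup>2) / 2 = - (A * t)\<^sup>2"
          using pos by (simp add: A_def power_mult_distrib)
        also have "exp (- (A * t)\<^sup>2) \<le> 2 * exp (- (A * t))" by (rule exp_neg_square_le)
        finally show ?thesis using pos by (simp add: add_increasing2)
      next
        \<comment> \<open>Here the upper limit on \<open>D\<close> enters: on the flat part the
          characteristic function is at most exp(-\<beta> n / 2) \<le> 1 / D, of the same order as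
          the rest.\<close>
        assume "\<beta> * real n \<le> Psi i y (t * D)"
        then have "?c (t * D) \<le> exp (- (\<beta> * real n / 2))"
          by (intro order_trans[OF char_Z_le[OF i]]) simp
        also have "\<dots> \<le> 1 / D" using D pos by (simp add: exp_minus field_simps)
        finally show ?thesis by (simp add: add_increasing)
      qed
    qed
  qed
  also have "\<dots> = (- 2 / A * exp (- (A * 1)) + 1 / D * 1) - (- 2 / A * exp (- (A * 0)) + 1 / D * 0)"
    by (rule integral_unif01_FTC) (use A pos in \<open>auto intro!: derivative_eq_intros continuous_intros\<close>)
  also have "\<dots> \<le> 2 / A + 1 / D" using A by simp
  also have "2 / A + 1 / D = (2 / sqrt (\<alpha> / 2) + 1) / D"
    using pos by (simp add: A_def field_simps)
  finally show ?thesis by simp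
qed

text \<open>Markov's inequality for the product, whose expectation factorises as the columns are
  independent. The product exceeds exp(-a) only if the values \<open>D * Z y i\<close> are moderate
  on average over the columns.\<close>

lemma prob_prod_cauchy_le:
  assumes I: "I \<subseteq> {..<n}"
  shows "prob {\<omega> \<in> space M. exp (- a) \<le> (\<Prod>i\<in>I. 1 / (1 + (D * Z y i \<omega>)\<^sup>2))}
    \<le> exp a * (\<Prod>i\<in>I. expectation (\<lambda>\<omega>. 1 / (1 + (D * Z y i \<omega>)\<^sup>2)))"
proof -
  have fin: "finite I" using I finite_subset by blast
  have ind: "indep_vars (\<lambda>_. borel) (\<lambda>i \<omega>. 1 / (1 + (D * Z y i \<omega>)\<^sup>2)) I"
    by (rule indep_vars_subset[OF indep_Z[of "\<lambda>_ x. 1 / (1 + (D * x)\<^sup>2)"] I]) measurable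
  have int: "integrable M (\<lambda>\<omega>. 1 / (1 + (D * Z y i \<omega>)\<^sup>2))" if "i \<in> I" for i
  proof -
    have [measurable]: "Z y i \<in> borel_measurable M" using that I Z_measurable by auto
    show ?thesis by (intro integrable_const_bound[of _ 1]) (auto simp: add_pos_nonneg abs_of_nonneg)
  qed
  have "prob {\<omega> \<in> space M. exp (- a) \<le> (\<Prod>i\<in>I. 1 / (1 + (D * Z y i \<omega>)\<^sup>2))}
    \<le> expectation (\<lambda>\<omega>. \<Prod>i\<in>I. 1 / (1 + (D * Z y i \<omega>)\<^sup>2)) / exp (- a)"
    by (intro Markov_ratio_le indep_vars_integrable[OF fin ind int] prod_nonneg) auto
  also have "expectation (\<lambda>\<omega>. \<Prod>i\<in>I. 1 / (1 + (D * Z y i \<omega>)\<^sup>2)) = (\<Prod>i\<in>I. expectation (\<lambda>\<omega>. 1 / (1 + (D * Z y i \<omega>)\<^sup>2)))"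
    by (rule indep_vars_lebesgue_integral[OF fin ind int])
  finally show ?thesis by (simp add: exp_minus field_simps)
qed

lemma expectation_cauchy_le_1:
  assumes "i < n"
  shows "expectation (\<lambda>\<omega>. 1 / (1 + (D * Z y i \<omega>)\<^sup>2)) \<le> 1" "0 \<le> expectation (\<lambda>\<omega>. 1 / (1 + (D * Z y i \<omega>)\<^sup>2))"
proof -
  have [measurable]: "Z y i \<in> borel_measurable M" using assms Z_measurable by auto
  have *: "1 / (1 + x\<^sup>2) \<le> 1" for x :: real by (subst divide_le_eq_1_pos) (auto intro: add_pos_nonneg)
  have "expectation (\<lambda>\<omega>. 1 / (1 + (D * Z y i \<omega>)\<^sup>2)) \<le> expectation (\<lambda>_. 1)"
    by (intro integral_mono integrable_const_bound[of _ 1]) (auto simp: * add_pos_nonneg abs_of_nonneg)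
  then show "expectation (\<lambda>\<omega>. 1 / (1 + (D * Z y i \<omega>)\<^sup>2)) \<le> 1" by (simp add: prob_space)
  show "0 \<le> expectation (\<lambda>\<omega>. 1 / (1 + (D * Z y i \<omega>)\<^sup>2))"
    by (rule Bochner_Integration.integral_nonneg) auto
qed

text \<open>By independence and 1 + x \<le> exp x, the expected product is at most exp of the total
  second moment divided by K n, hence at most exp n. This is the only control of individual column
  norms that the total second moment provides with exponentially small failure probability
  here.\<close>

lemma prob_prod_w2_le: "prob {\<omega> \<in> space M. exp (2 * real n) \<le> (\<Prod>i<n. w2 i \<omega>)} \<le> exp (- real n)"
proof -
  have Kn: "0 < K * real n" using K n by simp
  have ind: "indep_vars (\<lambda>_. borel) w2 {..<n}"
  proof -
    have "(\<lambda>f. 1 + (\<Sum>k<n. (f k)\<^sup>2) / (K * real n)) \<in> borel_measurable (PiM {..<n} (\<lambda>_. borel))"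
      by measurable
    from indep_columns[of "\<lambda>_ f. 1 + (\<Sum>k<n. (f k)\<^sup>2) / (K * real n)", OF this]
    show ?thesis unfolding w2_def[abs_def] by simp
  qed
  have int: "integrable M (w2 i)" if "i \<in> {..<n}" for i
    unfolding w2_def[abs_def] using that sq
    by (intro Bochner_Integration.integrable_add integrable_const integrable_divide Bochner_Integration.integrable_sum) auto
  have e: "expectation (w2 i) = 1 + mom i / (K * real n)" if "i < n" for i
  proof -
    have "integrable M (\<lambda>\<omega>. (\<Sum>k<n. (X i k \<omega>)\<^sup>2) / (K * real n))"
      using that sq by (intro integrable_divide Bochner_Integration.integrable_sum) auto
    moreover have "expectation (\<lambda>\<omega>. \<Sum>k<n. (X i k \<omega>)\<^sup>2) = mom i"
      unfolding mom_def using that sq by (intro Bochner_Integration.integral_sum) auto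
    ultimately show ?thesis unfolding w2_def[abs_def] by (simp add: prob_space)
  qed
  have w0: "0 \<le> w2 i \<omega>" for i \<omega> unfolding w2_def using Kn by (intro add_nonneg_nonneg divide_nonneg_nonneg sum_nonneg) auto
  have "prob {\<omega> \<in> space M. exp (2 * real n) \<le> (\<Prod>i<n. w2 i \<omega>)} \<le> expectation (\<lambda>\<omega>. \<Prod>i<n. w2 i \<omega>) / exp (2 * real n)"
    by (intro Markov_ratio_le indep_vars_integrable[OF _ ind int] prod_nonneg) (auto simp: w0)
  also have "expectation (\<lambda>\<omega>. \<Prod>i<n. w2 i \<omega>) = (\<Prod>i<n. expectation (w2 i))"
    by (rule indep_vars_lebesgue_integral[OF _ ind int]) auto
  also have "\<dots> \<le> (\<Prod>i<n. exp (mom i / (K * real n)))"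
    using mom_nonneg Kn by (intro prod_mono) (auto simp: e intro!: add_nonneg_nonneg divide_nonneg_pos)
  also have "\<dots> = exp ((\<Sum>i<n. mom i) / (K * real n))" by (simp add: exp_sum[symmetric] sum_divide_distrib)
  also have "\<dots> \<le> exp (real n)"
    using total[folded mom_def] Kn n by (simp add: pos_divide_le_eq power2_eq_square mult_ac)
  finally have "prob {\<omega> \<in> space M. exp (2 * real n) \<le> (\<Prod>i<n. w2 i \<omega>)} \<le> exp (real n) / exp (2 * real n)"
    by (simp add: divide_right_mono)
  then show ?thesis by (simp add: exp_diff[symmetric])
qed

text \<open>A gap of |\<phi>| below 1: the average of \<open>Psi\<close> over [0,1] is at least (1 -
  b) / 120 * 1/4, half of that is attained at some frequency, and |\<phi>| \<le> exp(-Psi / 2);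
  altogether 1920 = 120 * 4 * 2 * 2.\<close>

definition d0 :: real where "d0 = 1 - exp (- (1 - b) / 1920)"

lemma d0: "0 < d0" "d0 \<le> 1"
  using b by (auto simp: d0_def)

text \<open>Different coordinates may resonate at different frequencies, but averages over [0,1] add
  up. So one frequency makes the whole \<open>Psi\<close> bounded below, and
  \<open>measure_ball_le_of_char\<close> turns this into a bound below 1 that depends on
  \<open>b\<close> only.\<close>

lemma prob_Z_small:
  assumes i: "i < n" and y: "1 / 4 \<le> (\<Sum>k<n. (y k)\<^sup>2)" and c: "0 < c" "c\<^sup>2 \<le> d0"
  shows "prob {\<omega> \<in> space M. \<bar>Z y i \<omega>\<bar> < c} \<le> (2 - d0) / (2 - d0 / 2)"
proof -
  interpret U: prob_space unif01 by (rule prob_space_unif01)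
  interpret L: real_distribution "distr M borel (Z y i)" by (rule real_distribution_Z[OF i])
  have min1: "1 / 4 \<le> (\<Sum>k<n. min 1 ((y k)\<^sup>2))"
  proof (cases "\<exists>k<n. 1 \<le> (y k)\<^sup>2")
    case True
    then obtain k where k: "k < n" "1 \<le> (y k)\<^sup>2" by blast
    have "min 1 ((y k)\<^sup>2) \<le> (\<Sum>k<n. min 1 ((y k)\<^sup>2))"
      by (rule member_le_sum) (use k in auto)
    then show ?thesis using k by simp
  next
    case False
    then have "(\<Sum>k<n. min 1 ((y k)\<^sup>2)) = (\<Sum>k<n. (y k)\<^sup>2)" by (intro sum.cong) auto
    then show ?thesis using y by simp
  qed
  define \<gamma> where "\<gamma> = (1 - b) / 960"
  have \<gamma>: "0 < \<gamma>" using b by (simp add: \<gamma>_def)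
  have dm: "defect (nu i k) \<in> borel_measurable borel" if "k < n" for k
    by (rule real_distribution.defect_measurable[OF real_distribution_nu[OF i that]])
  have dint: "integrable unif01 (\<lambda>t. defect (nu i k) (t * y k))" if "k < n" for k
    using real_distribution.defect_nonneg[OF real_distribution_nu[OF i that]]
      real_distribution.defect_le_2[OF real_distribution_nu[OF i that]] dm[OF that]
    by (intro integrable_unif01[of _ 2]) (auto intro: measurable_compose[rotated])
  have "2 * \<gamma> \<le> (1 - b) / 120 * (\<Sum>k<n. min 1 ((y k)\<^sup>2))"
    using mult_left_mono[OF min1, of "(1 - b) / 120"] b by (simp add: \<gamma>_def)
  also have "\<dots> = (\<Sum>k<n. (1 - b) * min 1 ((y k)\<^sup>2) / 120)" by (simp add: sum_distrib_left)
  also have "\<dots> \<le> (\<Sum>k<n. \<integral>t. defect (nu i k) (t * y k) \<partial>unif01)"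
    by (intro sum_mono real_distribution.integral_defect_ge real_distribution_nu nu_ge i) auto
  also have "\<dots> = (\<integral>t. Psi i y t \<partial>unif01)"
    unfolding Psi_def using dint by (subst Bochner_Integration.integral_sum) auto
  finally have int: "2 * \<gamma> \<le> (\<integral>t. Psi i y t \<partial>unif01)" .
  \<comment> \<open>If \<open>Psi\<close> stayed below \<gamma> on [0,1], its average could not
    reach 2 \<gamma>.\<close>
  have "\<exists>t\<in>{0..1}. \<gamma> \<le> Psi i y t"
  proof (rule ccontr)
    assume neg: "\<not> ?thesis"
    have "(\<integral>t. Psi i y t \<partial>unif01) \<le> (\<integral>t. \<gamma> \<partial>unif01)"
    proof (rule integral_mono_AE)
      show "integrable unif01 (Psi i y)"
        unfolding Psi_def[abs_def] using dint by auto
      show "AE t in unif01. Psi i y t \<le> \<gamma>"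
        using AE_unif01 by eventually_elim (use neg in force)
    qed auto
    then show False using int \<gamma> U.prob_space by simp
  qed
  then obtain t where t: "t \<in> {0..1}" "\<gamma> \<le> Psi i y t" by blast
  have "cmod (char (distr M borel (Z y i)) t) \<le> exp (- Psi i y t / 2)" by (rule char_Z_le[OF i])
  also have "\<dots> \<le> exp (- \<gamma> / 2)" using t by simp
  also have "\<dots> = 1 - d0" unfolding d0_def \<gamma>_def by (simp add: field_simps)
  finally have "measure (distr M borel (Z y i)) {x. \<bar>x\<bar> < c} \<le> (2 - d0) / (2 - d0 / 2)"
    using t by (intro L.measure_ball_le_of_char[OF d0 _ _ c]) auto
  moreover have "measure (distr M borel (Z y i)) {x. \<bar>x\<bar> < c} = prob {\<omega> \<in> space M. \<bar>Z y i \<omega>\<bar> < c}"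
    using Z_measurable[OF i] by (subst measure_distr) (auto intro!: arg_cong[where f = prob])
  ultimately show ?thesis by simp
qed

text \<open>Tensorisation: each column gets the weight \<xi> if its inner product is large and 1
  otherwise, so the expected product is at most (prob. of small + \<xi>)^|I|. At most
  \<open>m\<close> large values keep the product above \<xi>^m, and Markov's inequality
  applies.\<close>

lemma prob_few_large_le:
  assumes I: "I \<subseteq> {..<n}" and y: "1 / 4 \<le> (\<Sum>k<n. (y k)\<^sup>2)" and c: "0 < c" "c\<^sup>2 \<le> d0"
    and \<xi>: "0 < \<xi>" "\<xi> \<le> 1"
  shows "prob {\<omega> \<in> space M. card {i \<in> I. c \<le> \<bar>Z y i \<omega>\<bar>} \<le> m}
     \<le> ((2 - d0) / (2 - d0 / 2) + \<xi>) ^ card I / \<xi> ^ m"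
proof -
  have fin: "finite I" using I finite_subset by blast
  let ?g = "\<lambda>x::real. if \<bar>x\<bar> < c then 1 else \<xi>"
  have ind: "indep_vars (\<lambda>_. borel) (\<lambda>i \<omega>. ?g (Z y i \<omega>)) I"
    by (rule indep_vars_subset[OF indep_Z[of "\<lambda>_. ?g"] I]) measurable
  have int: "integrable M (\<lambda>\<omega>. ?g (Z y i \<omega>))" if "i \<in> I" for i
  proof -
    have [measurable]: "Z y i \<in> borel_measurable M" using that I Z_measurable by auto
    show ?thesis using \<xi> by (intro integrable_const_bound[of _ 1]) auto
  qed
  have eq: "(\<Prod>i\<in>I. ?g (Z y i \<omega>)) = \<xi> ^ card {i \<in> I. c \<le> \<bar>Z y i \<omega>\<bar>}" for \<omega>
  proof -
    have "(\<Prod>i\<in>I. ?g (Z y i \<omega>)) = (\<Prod>i\<in>{i \<in> I. c \<le> \<bar>Z y i \<omega>\<bar>}. \<xi>)"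
      by (rule prod.mono_neutral_cong_right) (auto simp: fin)
    then show ?thesis by simp
  qed
  have intP: "integrable M (\<lambda>\<omega>. \<xi> ^ card {i \<in> I. c \<le> \<bar>Z y i \<omega>\<bar>})"
    using indep_vars_integrable[OF fin ind int] unfolding eq .
  have "prob {\<omega> \<in> space M. card {i \<in> I. c \<le> \<bar>Z y i \<omega>\<bar>} \<le> m}
     \<le> prob {\<omega> \<in> space M. \<xi> ^ m \<le> \<xi> ^ card {i \<in> I. c \<le> \<bar>Z y i \<omega>\<bar>}}"
  proof (rule finite_measure_mono)
    show "{\<omega> \<in> space M. \<xi> ^ m \<le> \<xi> ^ card {i \<in> I. c \<le> \<bar>Z y i \<omega>\<bar>}} \<in> events"
      using borel_measurable_integrable[OF intP] by measurable
  qed (use \<xi> in \<open>auto intro: power_decreasing\<close>)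
  also have "\<dots> \<le> expectation (\<lambda>\<omega>. \<xi> ^ card {i \<in> I. c \<le> \<bar>Z y i \<omega>\<bar>}) / \<xi> ^ m"
    using \<xi> by (intro Markov_ratio_le intP) auto
  also have "expectation (\<lambda>\<omega>. \<xi> ^ card {i \<in> I. c \<le> \<bar>Z y i \<omega>\<bar>}) = (\<Prod>i\<in>I. expectation (\<lambda>\<omega>. ?g (Z y i \<omega>)))"
    using indep_vars_lebesgue_integral[OF fin ind int] unfolding eq .
  also have "\<dots> \<le> (\<Prod>i\<in>I. (2 - d0) / (2 - d0 / 2) + \<xi>)"
  proof (intro prod_mono conjI)
    fix i assume i: "i \<in> I"
    then have [measurable]: "Z y i \<in> borel_measurable M" using I Z_measurable by auto
    show "0 \<le> expectation (\<lambda>\<omega>. ?g (Z y i \<omega>))"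
      using \<xi> by (intro Bochner_Integration.integral_nonneg) auto
    have "expectation (\<lambda>\<omega>. ?g (Z y i \<omega>)) \<le> expectation (\<lambda>\<omega>. indicator {\<omega> \<in> space M. \<bar>Z y i \<omega>\<bar> < c} \<omega> + \<xi>)"
      using int[OF i] \<xi> by (intro integral_mono Bochner_Integration.integrable_add integrable_real_indicator)
        (auto simp: emeasure_eq_measure)
    also have "\<dots> = prob {\<omega> \<in> space M. \<bar>Z y i \<omega>\<bar> < c} + \<xi>"
      by (subst Bochner_Integration.integral_add) (auto intro!: integrable_real_indicator simp: emeasure_eq_measure prob_space)
    also have "\<dots> \<le> (2 - d0) / (2 - d0 / 2) + \<xi>"
      using prob_Z_small[OF _ y c, of i] i I by auto
    finally show "expectation (\<lambda>\<omega>. ?g (Z y i \<omega>)) \<le> (2 - d0) / (2 - d0 / 2) + \<xi>" .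
  qed
  also have "\<dots> = ((2 - d0) / (2 - d0 / 2) + \<xi>) ^ card I" by simp
  finally show ?thesis using \<xi> by (simp add: divide_right_mono)
qed

end

section \<open>Compressible normal vectors\<close>

lemma lattice_point_bounds:
  fixes v y :: "nat \<Rightarrow> real" and m :: real
  assumes n: "0 < n" and unit: "(\<Sum>k<n. (v k)\<^sup>2) = 1" and m: "0 \<le> m" "m\<^sup>2 * real n \<le> 1"
    and near: "\<And>k. k < n \<Longrightarrow> \<bar>y k - v k\<bar> \<le> m"
  shows "(\<Sum>k<n. (y k)\<^sup>2) \<le> 4" "1 / 2 - m\<^sup>2 * real n \<le> (\<Sum>k<n. (y k)\<^sup>2)"
    "(\<Sum>k<n. \<bar>y k\<bar>) \<le> 3 * sqrt (real n)"
proof -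
  have d: "(\<Sum>k<n. (y k - v k)\<^sup>2) \<le> m\<^sup>2 * real n"
  proof -
    have "(\<Sum>k<n. (y k - v k)\<^sup>2) \<le> (\<Sum>k<n. m\<^sup>2)"
    proof (rule sum_mono)
      fix k assume "k \<in> {..<n}"
      then have "\<bar>y k - v k\<bar> \<le> m" using near by simp
      from power_mono[OF this, of 2] show "(y k - v k)\<^sup>2 \<le> m\<^sup>2" by simp
    qed
    then show ?thesis by (simp add: mult.commute)
  qed
  have "(\<Sum>k<n. (y k)\<^sup>2) \<le> (\<Sum>k<n. 2 * (v k)\<^sup>2 + 2 * (y k - v k)\<^sup>2)"
  proof (rule sum_mono)
    fix k
    show "(y k)\<^sup>2 \<le> 2 * (v k)\<^sup>2 + 2 * (y k - v k)\<^sup>2"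
      using zero_le_power2[of "2 * v k - y k"] by (simp add: power2_eq_square algebra_simps)
  qed
  also have "\<dots> = 2 * (\<Sum>k<n. (v k)\<^sup>2) + 2 * (\<Sum>k<n. (y k - v k)\<^sup>2)" by (simp add: sum.distrib sum_distrib_left)
  also have "\<dots> \<le> 2 * 1 + 2 * 1" using d m unit by linarith
  finally show y4: "(\<Sum>k<n. (y k)\<^sup>2) \<le> 4" by simp
  have "1 / 2 = (\<Sum>k<n. (v k)\<^sup>2 / 2)" using unit by (simp add: sum_divide_distrib[symmetric])
  also have "\<dots> \<le> (\<Sum>k<n. (y k)\<^sup>2 + (y k - v k)\<^sup>2)"
  proof (rule sum_mono)
    fix k
    show "(v k)\<^sup>2 / 2 \<le> (y k)\<^sup>2 + (y k - v k)\<^sup>2"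
      using zero_le_power2[of "2 * y k - v k"] by (simp add: power2_eq_square algebra_simps)
  qed
  also have "\<dots> = (\<Sum>k<n. (y k)\<^sup>2) + (\<Sum>k<n. (y k - v k)\<^sup>2)" by (simp add: sum.distrib)
  finally show "1 / 2 - m\<^sup>2 * real n \<le> (\<Sum>k<n. (y k)\<^sup>2)" using d by linarith
  \<comment> \<open>The l1 bound is Cauchy-Schwarz in pointwise form:
    \<open>2 * r * |y k| \<le> r\<^sup>2 * (y k)\<^sup>2 + 1\<close> with r = \<surd>n.\<close>
  define r where "r = sqrt (real n)"
  have r: "0 < r" "r * r = real n" using n by (auto simp: r_def)
  have "(\<Sum>k<n. \<bar>y k\<bar>) \<le> (\<Sum>k<n. r / 2 * (y k)\<^sup>2 + 1 / (2 * r))"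
  proof (rule sum_mono)
    fix k
    have "0 \<le> (r * \<bar>y k\<bar> - 1)\<^sup>2" by simp
    then have "2 * r * \<bar>y k\<bar> \<le> r * r * (y k)\<^sup>2 + 1" by (simp add: power2_eq_square algebra_simps)
    then have "2 * r * \<bar>y k\<bar> / (2 * r) \<le> (r * r * (y k)\<^sup>2 + 1) / (2 * r)" using r by (intro divide_right_mono) auto
    then show "\<bar>y k\<bar> \<le> r / 2 * (y k)\<^sup>2 + 1 / (2 * r)" using r(1) by (simp add: add_divide_distrib)
  qed
  also have "\<dots> = r / 2 * (\<Sum>k<n. (y k)\<^sup>2) + real n / (2 * r)" by (simp add: sum.distrib sum_distrib_left)
  also have "real n / (2 * r) = r / 2" using r by (simp add: r(2)[symmetric])
  also have "r / 2 * (\<Sum>k<n. (y k)\<^sup>2) + r / 2 \<le> r / 2 * 4 + r / 2"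
    using y4 r by (intro add_right_mono mult_left_mono) auto
  also have "\<dots> \<le> 3 * r" using r by simp
  finally show "(\<Sum>k<n. \<bar>y k\<bar>) \<le> 3 * sqrt (real n)" by (simp add: r_def)
qed

text \<open>Supplies the finite box over which the union bounds run; \<open>restrict\<close> is
  needed because \<open>PiE\<close> fixes the values outside the index set.\<close>

lemma member_PiE_int_box:
  fixes z :: "nat \<Rightarrow> int"
  assumes "(\<Sum>k<n. \<bar>real_of_int (z k)\<bar>) \<le> B"
  shows "restrict z {..<n} \<in> PiE {..<n} (\<lambda>_. {- int (nat \<lceil>B\<rceil>)..int (nat \<lceil>B\<rceil>)})"
proof (rule restrict_PiE_iff[THEN iffD2], rule ballI)
  fix k assume k: "k \<in> {..<n}"
  then have "\<bar>real_of_int (z k)\<bar> \<le> (\<Sum>k<n. \<bar>real_of_int (z k)\<bar>)" by (intro member_le_sum) auto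
  then have "\<bar>real_of_int (z k)\<bar> \<le> B" using assms by linarith
  then have "\<bar>z k\<bar> \<le> \<lceil>B\<rceil>" by linarith
  moreover from this have "0 \<le> \<lceil>B\<rceil>" by linarith
  ultimately show "z k \<in> {- int (nat \<lceil>B\<rceil>)..int (nat \<lceil>B\<rceil>)}" by auto
qed

context random_columns
begin

lemma w2_ge_1: "1 \<le> w2 i \<omega>"
  unfolding w2_def using K n by (auto intro!: divide_nonneg_nonneg sum_nonneg)

text \<open>The purpose of \<open>w2\<close>: as the squared norm equals (w2 - 1) K n, the rescaled
  column has squared norm at most K n for every outcome.\<close>

lemma sum_sq_div_w2_le: "(\<Sum>k<n. (X i k \<omega> / sqrt (w2 i \<omega>))\<^sup>2) \<le> K * real n"
proof -
  have Kn: "0 < K * real n" using K n by simp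
  have w: "0 < w2 i \<omega>" using w2_ge_1[of i \<omega>] by linarith
  have "(\<Sum>k<n. (X i k \<omega> / sqrt (w2 i \<omega>))\<^sup>2) = (\<Sum>k<n. (X i k \<omega>)\<^sup>2) / w2 i \<omega>"
    using w by (simp add: power_divide sum_divide_distrib)
  also have "(\<Sum>k<n. (X i k \<omega>)\<^sup>2) = (w2 i \<omega> - 1) * (K * real n)" using K n by (simp add: w2_def)
  also have "\<dots> / w2 i \<omega> \<le> w2 i \<omega> * (K * real n) / w2 i \<omega>"
    using w Kn by (intro divide_right_mono mult_right_mono) auto
  also have "\<dots> = K * real n" using w by simp
  finally show ?thesis .
qed

lemma Z_scaled_diff:
  assumes "Z v i \<omega> = 0"
  shows "(\<Sum>k<n. X i k \<omega> / c * (y k - v k)) = Z y i \<omega> / c"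
proof -
  have "(\<Sum>k<n. X i k \<omega> / c * (y k - v k)) = (Z y i \<omega> - Z v i \<omega>) / c"
    unfolding Z_def by (simp add: sum_subtractf[symmetric] sum_divide_distrib algebra_simps diff_divide_distrib)
  then show ?thesis using assms by simp
qed

text \<open>The rounding is measured by the rescaled columns. Since \<open>v\<close> is orthogonal
  to them, the image of the rounding error is the image of the lattice point itself.\<close>

lemma ex_kernel_rounding:
  fixes m \<mu> :: real and v :: "nat \<Rightarrow> real"
  assumes v: "(\<Sum>k<n. (v k)\<^sup>2) = 1" and I: "I \<subseteq> {..<n}" and ker: "\<And>i. i \<in> I \<Longrightarrow> Z v i \<omega> = 0"
    and m: "0 < m" and \<mu>: "0 \<le> \<mu>"
  shows "\<exists>z::nat \<Rightarrow> int. (\<forall>k<n. \<bar>m * real_of_int (z k) - v k\<bar> \<le> m) \<and>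
    (\<Sum>i\<in>I. (Z (\<lambda>k. m * real_of_int (z k)) i \<omega>)\<^sup>2 / w2 i \<omega>) + \<mu> * real (card {k. k < n \<and> z k \<noteq> 0})
      \<le> m\<^sup>2 * (real n * (K * real n)) + \<mu> * (\<Sum>k<n. min 1 (\<bar>v k\<bar> / m))"
proof -
  have fin: "finite I" using I finite_subset by blast
  obtain z :: "nat \<Rightarrow> int" where z: "\<forall>k. k < n \<longrightarrow> \<bar>m * real_of_int (z k) - v k\<bar> \<le> m"
    "(\<Sum>i\<in>I. (\<Sum>k<n. X i k \<omega> / sqrt (w2 i \<omega>) * (m * real_of_int (z k) - v k))\<^sup>2) + \<mu> * real (card {k. k < n \<and> z k \<noteq> 0})
      \<le> m\<^sup>2 * (\<Sum>i\<in>I. \<Sum>k<n. (X i k \<omega> / sqrt (w2 i \<omega>))\<^sup>2) + \<mu> * (\<Sum>k<n. min 1 (\<bar>v k\<bar> / m))"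
    using ex_lattice_rounding[OF m \<mu> fin, of n v "\<lambda>i k. X i k \<omega> / sqrt (w2 i \<omega>)"] by (elim exE conjE) (rule that)
  have "(\<Sum>k<n. X i k \<omega> / sqrt (w2 i \<omega>) * (m * real_of_int (z k) - v k))\<^sup>2
      = (Z (\<lambda>k. m * real_of_int (z k)) i \<omega>)\<^sup>2 / w2 i \<omega>" if "i \<in> I" for i
    using w2_ge_1[of i \<omega>] unfolding Z_scaled_diff[OF ker[OF that], of _ "\<lambda>k. m * real_of_int (z k)"] by (simp add: power_divide)
  then have eq: "(\<Sum>i\<in>I. (\<Sum>k<n. X i k \<omega> / sqrt (w2 i \<omega>) * (m * real_of_int (z k) - v k))\<^sup>2)
      = (\<Sum>i\<in>I. (Z (\<lambda>k. m * real_of_int (z k)) i \<omega>)\<^sup>2 / w2 i \<omega>)" by (intro sum.cong) auto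
  have "(\<Sum>i\<in>I. \<Sum>k<n. (X i k \<omega> / sqrt (w2 i \<omega>))\<^sup>2) \<le> (\<Sum>i\<in>I. K * real n)"
    by (intro sum_mono sum_sq_div_w2_le)
  also have "\<dots> = real (card I) * (K * real n)" by simp
  also have "\<dots> \<le> real n * (K * real n)"
    using card_mono[OF _ I] K n by (intro mult_right_mono) auto
  finally have "m\<^sup>2 * (\<Sum>i\<in>I. \<Sum>k<n. (X i k \<omega> / sqrt (w2 i \<omega>))\<^sup>2) \<le> m\<^sup>2 * (real n * (K * real n))"
    by (intro mult_left_mono) auto
  with z(2) have "(\<Sum>i\<in>I. (Z (\<lambda>k. m * real_of_int (z k)) i \<omega>)\<^sup>2 / w2 i \<omega>) + \<mu> * real (card {k. k < n \<and> z k \<noteq> 0})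
      \<le> m\<^sup>2 * (real n * (K * real n)) + \<mu> * (\<Sum>k<n. min 1 (\<bar>v k\<bar> / m))" unfolding eq by linarith
  with z(1) show ?thesis by blast
qed

lemma card_large_measurable:
  assumes I: "I \<subseteq> {..<n}"
  shows "{\<omega> \<in> space M. card {i \<in> I. c \<le> \<bar>Z y i \<omega>\<bar>} \<le> m} \<in> events"
proof -
  have fin: "finite I" using I finite_subset by blast
  have [measurable]: "Z y i \<in> borel_measurable M" if "i \<in> I" for i using that I Z_measurable by auto
  have eq: "real (card {i \<in> I. c \<le> \<bar>Z y i \<omega>\<bar>}) = (\<Sum>i\<in>I. if c \<le> \<bar>Z y i \<omega>\<bar> then 1 else 0)" for \<omega>
  proof -
    have "(\<Sum>i\<in>I. if c \<le> \<bar>Z y i \<omega>\<bar> then 1 else 0 :: real) = (\<Sum>i\<in>{i \<in> I. c \<le> \<bar>Z y i \<omega>\<bar>}. 1)"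
      by (rule sum.mono_neutral_cong_right) (auto simp: fin)
    then show ?thesis by simp
  qed
  have "{\<omega> \<in> space M. (\<Sum>i\<in>I. if c \<le> \<bar>Z y i \<omega>\<bar> then 1 else 0) \<le> real m} \<in> events" by measurable
  then show ?thesis unfolding eq[symmetric] by simp
qed

text \<open>All weights are at least 1, so each weight above exp(2 / \<eta>) uses up 2 / \<eta> of
  the exponent 2 n.\<close>

lemma card_w2_gt_le:
  assumes "(\<Prod>i<n. w2 i \<omega>) < exp (2 * real n)" and T: "T = exp (2 / \<eta>)" "0 < \<eta>" and I: "I \<subseteq> {..<n}"
  shows "real (card {i \<in> I. T < w2 i \<omega>}) \<le> \<eta> * real n"
proof -
  let ?H = "{i \<in> I. T < w2 i \<omega>}"
  have sub: "?H \<subseteq> {..<n}" using I by auto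
  have fin: "finite ?H" using sub finite_subset by blast
  have "exp (real (card ?H) * (2 / \<eta>)) = T ^ card ?H" unfolding T by (rule exp_of_nat_mult)
  also have "\<dots> = (\<Prod>i\<in>?H. T)" by simp
  also have "\<dots> \<le> (\<Prod>i\<in>?H. w2 i \<omega>)" by (rule prod_mono) (use T in auto)
  also have "\<dots> \<le> (\<Prod>i<n. w2 i \<omega>)"
  proof (rule prod_mono2[OF _ sub])
    show "1 \<le> w2 i \<omega>" for i by (rule w2_ge_1)
    show "0 \<le> w2 i \<omega>" for i using w2_ge_1[of i \<omega>] by linarith
  qed auto
  finally have "exp (real (card ?H) * (2 / \<eta>)) < exp (2 * real n)" using assms(1) by linarith
  then have "real (card ?H) * 2 / \<eta> < 2 * real n" by simp
  then show ?thesis using T(2) by (simp add: pos_divide_less_eq mult.commute)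
qed

text \<open>A compressible \<open>v\<close> would round, at mesh a / \<surd>n, to a lattice point
  with at most 4 \<delta> n nonzero coordinates that has inner product of size at least
  \<open>c\<close> with at most 2 \<eta> n columns. For one point this has probability about exp(-3
  \<iota> n / 4) by \<open>prob_few_large_le\<close>. The three conditions with \<iota> / 16 bound
  the number of such points by exp(3 \<iota> n / 16).\<close>

lemma ex_compressible_event:
  fixes a c \<eta> \<xi> \<rho> \<iota> \<theta> L \<delta> :: real
  assumes j: "j < n"
    and c: "0 < c" "c\<^sup>2 \<le> d0"
    and \<xi>: "0 < \<xi>" "\<xi> \<le> 1" and \<rho>: "(2 - d0) / (2 - d0 / 2) + \<xi> \<le> \<rho>" and \<iota>: "\<rho> = exp (- \<iota>)" "0 < \<iota>"
    and \<eta>: "0 < \<eta>" "2 * \<eta> * ln (1 / \<xi>) \<le> \<iota> / 4"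
    and a: "0 < a" "a \<le> 1 / 2" "2 * a\<^sup>2 * K * exp (2 / \<eta>) \<le> \<eta> * c\<^sup>2"
    and \<theta>: "0 < \<theta>" "\<theta> * (3 / a) \<le> \<iota> / 16"
    and L: "0 \<le> L" "2 * exp (- L) / \<theta> \<le> \<iota> / 16"
    and \<delta>: "0 < \<delta>" "L * (4 * \<delta>) \<le> \<iota> / 16"
  shows "\<exists>E\<in>events. prob E \<le> exp (\<iota> - \<iota> * real n / 2) \<and>
    (\<forall>\<omega>\<in>space M - E. (\<Prod>i<n. w2 i \<omega>) < exp (2 * real n) \<longrightarrow>
      (\<forall>v. (\<Sum>k<n. (v k)\<^sup>2) = 1 \<longrightarrow> (\<forall>i<n. i \<noteq> j \<longrightarrow> Z v i \<omega> = 0) \<longrightarrow>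
        \<delta> * real n \<le> card {k. k < n \<and> a * \<delta> / sqrt (real n) \<le> \<bar>v k\<bar>}))"
proof -
  define m where "m = a / sqrt (real n)"
  define I where "I = {..<n} - {j}"
  define N where "N = nat \<lceil>3 / a * real n\<rceil>"
  define m0 where "m0 = nat \<lfloor>2 * \<eta> * real n\<rfloor>"
  define N2 where "N2 = {z \<in> PiE {..<n} (\<lambda>_. {-int N..int N}).
      (\<Sum>k<n. \<bar>real_of_int (z k)\<bar>) \<le> 3 / a * real n \<and> real (card {k. k < n \<and> z k \<noteq> 0}) \<le> 4 * \<delta> * real n}"
  define N3 where "N3 = {z \<in> N2. 1 / 4 \<le> (\<Sum>k<n. (m * real_of_int (z k))\<^sup>2)}"
  define Ev where "Ev = (\<lambda>z. {\<omega> \<in> space M. card {i \<in> I. c \<le> \<bar>Z (\<lambda>k. m * real_of_int (z k)) i \<omega>\<bar>} \<le> m0})"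
  have I: "I \<subseteq> {..<n}" by (auto simp: I_def)
  have cardI: "card I = n - 1" using j by (simp add: I_def)
  have sn: "0 < sqrt (real n)" using n by simp
  have m: "0 < m" "m\<^sup>2 * real n = a\<^sup>2" using a n by (auto simp: m_def power_divide)
  have a2: "a\<^sup>2 \<le> 1 / 4" using power_mono[of a "1/2" 2] a by (simp add: power2_eq_square)
  have fin2: "finite N2"
    unfolding N2_def by (rule finite_subset[OF _ finite_PiE[of "{..<n}" "\<lambda>_. {-int N..int N}"]]) auto
  have fin3: "finite N3" using fin2 by (simp add: N3_def)
  have cardN: "real (card N3) \<le> exp (real n * (3 * \<iota> / 16))"
  proof -
    have "real (card N3) \<le> real (card N2)" unfolding N3_def using fin2 by (intro of_nat_mono card_mono) auto
    also have "\<dots> \<le> exp (real n * (\<theta> * (3 / a) + L * (4 * \<delta>) + 2 * exp (- L) / \<theta>))"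
      unfolding N2_def by (rule card_sparse_lattice_le[OF \<theta>(1) L(1)])
    also have "\<dots> \<le> exp (real n * (3 * \<iota> / 16))"
      using \<theta>(2) L(2) \<delta>(2) by (subst exp_le_cancel_iff, intro mult_left_mono) auto
    finally show ?thesis .
  qed
  have Evm: "Ev z \<in> events" for z unfolding Ev_def by (rule card_large_measurable[OF I])
  have \<rho>0: "0 < \<rho>" "\<rho> < 1" using \<iota> by auto
  have b0: "0 \<le> (2 - d0) / (2 - d0 / 2)" using d0 by simp
  have pEv: "prob (Ev z) \<le> exp (\<iota> - \<iota> * real n) * exp (\<iota> / 4 * real n)" if "z \<in> N3" for z
  proof -
    have "prob (Ev z) \<le> ((2 - d0) / (2 - d0 / 2) + \<xi>) ^ card I / \<xi> ^ m0"
      unfolding Ev_def by (rule prob_few_large_le[OF I _ c \<xi>]) (use that in \<open>auto simp: N3_def\<close>)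
    also have "\<dots> \<le> \<rho> ^ card I / \<xi> ^ m0"
      using \<rho> \<xi> b0 by (intro divide_right_mono power_mono) auto
    also have "\<rho> ^ card I = exp (\<iota> - \<iota> * real n)"
    proof -
      have "\<rho> ^ card I = exp (real (n - 1) * (- \<iota>))" unfolding cardI \<iota> by (rule exp_of_nat_mult[symmetric])
      also have "real (n - 1) = real n - 1" using n by simp
      finally show ?thesis by (simp add: algebra_simps)
    qed
    also have "exp (\<iota> - \<iota> * real n) / \<xi> ^ m0 \<le> exp (\<iota> - \<iota> * real n) * exp (\<iota> / 4 * real n)"
    proof -
      have l: "0 \<le> ln (1 / \<xi>)" using \<xi> by (simp add: ln_div)
      have "1 / \<xi> ^ m0 = exp (real m0 * ln (1 / \<xi>))" using \<xi> by (subst exp_of_nat_mult) (simp add: power_one_over)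
      also have "\<dots> \<le> exp (2 * \<eta> * real n * ln (1 / \<xi>))"
        using l \<eta> unfolding m0_def by (subst exp_le_cancel_iff, intro mult_right_mono) (auto simp: of_nat_floor)
      also have "\<dots> \<le> exp (\<iota> / 4 * real n)"
        using mult_right_mono[OF \<eta>(2), of "real n"] by (simp add: mult_ac)
      finally have "exp (\<iota> - \<iota> * real n) * (1 / \<xi> ^ m0) \<le> exp (\<iota> - \<iota> * real n) * exp (\<iota> / 4 * real n)"
        by (rule mult_left_mono) simp
      then show ?thesis by simp
    qed
    finally show ?thesis .
  qed
  show ?thesis
  proof (intro bexI conjI ballI impI allI)
    show "(\<Union>z\<in>N3. Ev z) \<in> events" using fin3 Evm by auto
    have "prob (\<Union>z\<in>N3. Ev z) \<le> (\<Sum>z\<in>N3. prob (Ev z))"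
      using fin3 Evm by (intro finite_measure_subadditive_finite) auto
    also have "\<dots> \<le> (\<Sum>z\<in>N3. exp (\<iota> - \<iota> * real n) * exp (\<iota> / 4 * real n))" by (intro sum_mono pEv)
    also have "\<dots> = real (card N3) * exp (\<iota> - \<iota> * real n + \<iota> / 4 * real n)" by (simp add: exp_add[symmetric])
    also have "\<dots> \<le> exp (real n * (3 * \<iota> / 16)) * exp (\<iota> - \<iota> * real n + \<iota> / 4 * real n)"
      by (intro mult_right_mono cardN) auto
    also have "\<dots> = exp (\<iota> - 9 / 16 * (\<iota> * real n))" by (simp add: exp_add[symmetric] algebra_simps)
    also have "\<dots> \<le> exp (\<iota> - \<iota> * real n / 2)" using \<iota> n by simp
    finally show "prob (\<Union>z\<in>N3. Ev z) \<le> exp (\<iota> - \<iota> * real n / 2)" .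
  next
    fix \<omega> v
    assume \<omega>: "\<omega> \<in> space M - (\<Union>z\<in>N3. Ev z)" and E1: "(\<Prod>i<n. w2 i \<omega>) < exp (2 * real n)"
      and v: "(\<Sum>k<n. (v k)\<^sup>2) = 1" and ker: "\<forall>i<n. i \<noteq> j \<longrightarrow> Z v i \<omega> = 0"
    show "\<delta> * real n \<le> card {k. k < n \<and> a * \<delta> / sqrt (real n) \<le> \<bar>v k\<bar>}"
    proof (rule ccontr)
      let ?S = "{k. k < n \<and> a * \<delta> / sqrt (real n) \<le> \<bar>v k\<bar>}"
      assume "\<not> ?thesis"
      then have S: "real (card ?S) < \<delta> * real n" by simp
      define Q where "Q = a\<^sup>2 * K * real n"
      \<comment> \<open>This \<mu> balances the two costs: the expected penalty is at most
        \<open>\<mu> * (2 * \<delta> * n) = Q\<close>, equal to the variance term. So the total is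
        at most 2 Q, which bounds the images by 2 Q and the support by 4 \<delta> n at the same
        time.\<close>
      define \<mu> where "\<mu> = Q / (2 * \<delta> * real n)"
      have Q: "0 < Q" using a K n by (simp add: Q_def)
      have \<mu>: "0 < \<mu>" using Q \<delta> n by (simp add: \<mu>_def)
      have "\<exists>z::nat \<Rightarrow> int. (\<forall>k<n. \<bar>m * real_of_int (z k) - v k\<bar> \<le> m) \<and>
        (\<Sum>i\<in>I. (Z (\<lambda>k. m * real_of_int (z k)) i \<omega>)\<^sup>2 / w2 i \<omega>) + \<mu> * real (card {k. k < n \<and> z k \<noteq> 0})
          \<le> m\<^sup>2 * (real n * (K * real n)) + \<mu> * (\<Sum>k<n. min 1 (\<bar>v k\<bar> / m))"
        by (rule ex_kernel_rounding[OF v I _ m(1)]) (use ker \<mu> in \<open>auto simp: I_def\<close>)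
      then obtain z :: "nat \<Rightarrow> int" where z: "\<forall>k<n. \<bar>m * real_of_int (z k) - v k\<bar> \<le> m"
        and zQ: "(\<Sum>i\<in>I. (Z (\<lambda>k. m * real_of_int (z k)) i \<omega>)\<^sup>2 / w2 i \<omega>) + \<mu> * real (card {k. k < n \<and> z k \<noteq> 0})
          \<le> m\<^sup>2 * (real n * (K * real n)) + \<mu> * (\<Sum>k<n. min 1 (\<bar>v k\<bar> / m))" by (elim exE conjE) (rule that)
      let ?y = "\<lambda>k. m * real_of_int (z k)"
      have "(\<Sum>k<n. min 1 (\<bar>v k\<bar> / m)) \<le> (\<Sum>k<n. (if k \<in> ?S then 1 else 0) + \<delta>)"
      proof (rule sum_mono)
        fix k assume k: "k \<in> {..<n}"
        show "min 1 (\<bar>v k\<bar> / m) \<le> (if k \<in> ?S then 1 else 0) + \<delta>"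
        proof (cases "k \<in> ?S")
          case True
          then show ?thesis using \<delta> by (simp add: min_def)
        next
          case False
          then have "\<bar>v k\<bar> < \<delta> * m" using k by (simp add: m_def mult.commute)
          then have "\<bar>v k\<bar> / m \<le> \<delta>" using m(1) by (simp add: pos_divide_le_eq)
          then show ?thesis using False by (simp add: min_def)
        qed
      qed
      also have "\<dots> = real (card ?S) + real n * \<delta>"
      proof -
        have "(\<Sum>k<n. if k \<in> ?S then 1 else 0 :: real) = (\<Sum>k\<in>?S. 1)"
          by (rule sum.mono_neutral_cong_right) auto
        then show ?thesis by (simp add: sum.distrib)
      qed
      also have "\<dots> \<le> 2 * \<delta> * real n" using S by (simp add: mult.commute)
      finally have "\<mu> * (\<Sum>k<n. min 1 (\<bar>v k\<bar> / m)) \<le> \<mu> * (2 * \<delta> * real n)" using \<mu> by (intro mult_left_mono) auto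
      also have "\<dots> = Q" using \<delta> n by (simp add: \<mu>_def)
      finally have pen: "\<mu> * (\<Sum>k<n. min 1 (\<bar>v k\<bar> / m)) \<le> Q" .
      have mQ: "m\<^sup>2 * (real n * (K * real n)) = Q" unfolding Q_def m(2)[symmetric] by simp
      have tot: "(\<Sum>i\<in>I. (Z ?y i \<omega>)\<^sup>2 / w2 i \<omega>) + \<mu> * real (card {k. k < n \<and> z k \<noteq> 0}) \<le> 2 * Q"
        using zQ pen unfolding mQ by linarith
      have nn: "0 \<le> (\<Sum>i\<in>I. (Z ?y i \<omega>)\<^sup>2 / w2 i \<omega>)"
      proof (intro sum_nonneg divide_nonneg_nonneg)
        show "0 \<le> w2 i \<omega>" for i using w2_ge_1[of i \<omega>] by linarith
      qed auto
      have nn2: "0 \<le> \<mu> * real (card {k. k < n \<and> z k \<noteq> 0})" using \<mu> by simp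
      have supp: "real (card {k. k < n \<and> z k \<noteq> 0}) \<le> 4 * \<delta> * real n"
      proof -
        have "\<mu> * real (card {k. k < n \<and> z k \<noteq> 0}) \<le> 2 * Q" using tot nn by linarith
        also have "2 * Q = \<mu> * (4 * \<delta> * real n)" using \<delta> n by (simp add: \<mu>_def)
        finally show ?thesis using \<mu> by simp
      qed
      have ZQ: "(\<Sum>i\<in>I. (Z ?y i \<omega>)\<^sup>2 / w2 i \<omega>) \<le> 2 * Q" using tot nn2 by linarith
      have m0: "0 \<le> m" and mn1: "m\<^sup>2 * real n \<le> 1" using m a2 by auto
      have near: "\<bar>?y k - v k\<bar> \<le> m" if "k < n" for k using z that by blast
      note bnd = lattice_point_bounds[OF n v m0 mn1 near]
      have y14: "1 / 4 \<le> (\<Sum>k<n. (?y k)\<^sup>2)" using bnd(2) a2 unfolding m(2) by linarith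
      have l1: "(\<Sum>k<n. \<bar>real_of_int (z k)\<bar>) \<le> 3 / a * real n"
      proof -
        have "m * (\<Sum>k<n. \<bar>real_of_int (z k)\<bar>) = (\<Sum>k<n. \<bar>?y k\<bar>)" using m(1) by (simp add: abs_mult sum_distrib_left)
        also have "\<dots> \<le> 3 * sqrt (real n)" by (rule bnd(3))
        finally have "(\<Sum>k<n. \<bar>real_of_int (z k)\<bar>) \<le> 3 * sqrt (real n) / m" using m(1) by (simp add: pos_le_divide_eq mult.commute)
        also have "\<dots> = 3 / a * (sqrt (real n) * sqrt (real n))" by (simp add: m_def)
        finally show ?thesis by simp
      qed
      define z' where "z' = restrict z {..<n}"
      have zz: "z' k = z k" if "k < n" for k using that by (simp add: z'_def)
      have z'N: "z' \<in> N3"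
      proof -
        have "z' \<in> PiE {..<n} (\<lambda>_. {-int N..int N})" unfolding z'_def N_def by (rule member_PiE_int_box[OF l1])
        moreover have "(\<Sum>k<n. \<bar>real_of_int (z' k)\<bar>) = (\<Sum>k<n. \<bar>real_of_int (z k)\<bar>)" by (intro sum.cong) (auto simp: zz)
        moreover have "{k. k < n \<and> z' k \<noteq> 0} = {k. k < n \<and> z k \<noteq> 0}" using zz by auto
        moreover have "(\<Sum>k<n. (m * real_of_int (z' k))\<^sup>2) = (\<Sum>k<n. (?y k)\<^sup>2)" by (intro sum.cong) (auto simp: zz)
        ultimately show ?thesis unfolding N3_def N2_def using l1 supp y14 by simp
      qed
      have Zeq: "Z (\<lambda>k. m * real_of_int (z' k)) i \<omega> = Z ?y i \<omega>" for i
        unfolding Z_def by (intro sum.cong) (auto simp: zz)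
      \<comment> \<open>Columns with a large inner product are split by weight. Those of weight
        above exp(2 / \<eta>) are few by the product bound, the others by \<open>2 * a\<^sup>2 * K *
        exp (2 / \<eta>) \<le> \<eta> * c\<^sup>2\<close>; each kind has at most \<eta> n
        members.\<close>
      let ?H = "{i \<in> I. exp (2 / \<eta>) < w2 i \<omega>}"
      let ?B = "{i \<in> I. c \<le> \<bar>Z ?y i \<omega>\<bar> \<and> w2 i \<omega> \<le> exp (2 / \<eta>)}"
      have finI: "finite I" by (simp add: I_def)
      have "real (card ?B) * (c\<^sup>2 / exp (2 / \<eta>)) \<le> (\<Sum>i\<in>I. (Z ?y i \<omega>)\<^sup>2 / w2 i \<omega>)"
      proof (rule card_ge_mult_le_sum[OF finI])
        show "0 \<le> (Z ?y i \<omega>)\<^sup>2 / w2 i \<omega>" for i using w2_ge_1[of i \<omega>] by simp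
        fix i assume i: "i \<in> ?B"
        have "c\<^sup>2 \<le> (Z ?y i \<omega>)\<^sup>2" using i c(1) power_mono[of c "\<bar>Z ?y i \<omega>\<bar>" 2] by simp
        then show "c\<^sup>2 / exp (2 / \<eta>) \<le> (Z ?y i \<omega>)\<^sup>2 / w2 i \<omega>"
          using i w2_ge_1[of i \<omega>] by (intro frac_le) auto
      qed auto
      also note ZQ
      finally have "real (card ?B) * (c\<^sup>2 / exp (2 / \<eta>)) \<le> 2 * Q" .
      then have "real (card ?B) * c\<^sup>2 \<le> 2 * a\<^sup>2 * K * exp (2 / \<eta>) * real n"
        unfolding Q_def by (simp add: pos_divide_le_eq mult_ac)
      also have "\<dots> \<le> \<eta> * c\<^sup>2 * real n" using a(3) by (intro mult_right_mono) auto
      finally have B: "real (card ?B) \<le> \<eta> * real n" using c(1) by (simp add: mult_ac)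
      have H: "real (card ?H) \<le> \<eta> * real n" by (rule card_w2_gt_le[OF E1 refl \<eta>(1) I])
      have "card {i \<in> I. c \<le> \<bar>Z ?y i \<omega>\<bar>} \<le> card (?B \<union> ?H)" using finI by (intro card_mono) auto
      also have "\<dots> \<le> card ?B + card ?H" by (rule card_Un_le)
      finally have "real (card {i \<in> I. c \<le> \<bar>Z ?y i \<omega>\<bar>}) \<le> 2 * \<eta> * real n" using B H by linarith
      then have "card {i \<in> I. c \<le> \<bar>Z ?y i \<omega>\<bar>} \<le> m0" unfolding m0_def by (simp add: le_nat_floor)
      then have "\<omega> \<in> Ev z'" using \<omega> by (simp add: Ev_def Zeq)
      then show False using z'N \<omega> by blast
    qed
  qed
qed

end

section \<open>Structured normal vectors\<close>

context random_columns
begin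

text \<open>The moment assumption on the distinguished column. All but boundedly many of the other
  columns satisfy it too, so they can be treated together with it.\<close>

definition flat :: "real \<Rightarrow> nat \<Rightarrow> bool" where
  "flat r i \<longleftrightarrow> i < n \<and> mom i \<le> r * (real n)\<^sup>2"

text \<open>The coordinates whose entry exceeds \<open>\<surd>(\<delta> n) / (4 s)\<close> with substantial probability. If
  there are few of them, \<open>Psi\<close> is large at all incompressible vectors; if there are many, the
  second moment bound forces \<open>s\<close> to be large.\<close>

definition hv :: "real \<Rightarrow> nat \<Rightarrow> real \<Rightarrow> nat set" where
  "hv \<delta> i s = heavy (nu i) n ((1 - b) / 2) (sqrt (\<delta> * real n) / 4) s"

text \<open>Fixes the resolution of the argument: shifts of order 1 / \<surd>n per coordinate cost
  O(r n), negligible against \<gamma> n for small \<open>r\<close>.\<close>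

lemma Psi_perturb_flat:
  assumes i: "flat r i" and n0: "\<And>k. k < n \<Longrightarrow> \<bar>s * y k - s' * v k\<bar> \<le> t / sqrt (real n)"
  shows "Psi i y s \<le> 2 * Psi i v s' + 4 * t\<^sup>2 * r * real n"
proof -
  have "Psi i y s \<le> 2 * Psi i v s' + 4 * (t / sqrt (real n))\<^sup>2 * mom i"
    by (rule Psi_perturb) (use i n0 in \<open>auto simp: flat_def\<close>)
  also have "4 * (t / sqrt (real n))\<^sup>2 * mom i \<le> 4 * (t / sqrt (real n))\<^sup>2 * (r * (real n)\<^sup>2)"
    using i by (intro mult_left_mono) (auto simp: flat_def)
  also have "\<dots> = 4 * t\<^sup>2 * r * real n"
    using n by (simp add: power_divide power2_eq_square)
  finally show ?thesis by simp
qed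

lemma Psi_ge_of_not_heavy:
  assumes i: "i < n" and \<delta>: "0 < \<delta>" and s: "0 \<le> s" and \<kappa>: "0 \<le> \<kappa>"
    and light: "real (card (hv \<delta> i s)) \<le> \<delta> * real n / 2"
    and spread: "\<delta> * real n \<le> real (card {k. k < n \<and> \<kappa> / sqrt (real n) \<le> \<bar>y k\<bar>})"
    and norm: "(\<Sum>k<n. (y k)\<^sup>2) \<le> 4"
  shows "\<delta> * ((1 - b) / 2) * \<kappa>\<^sup>2 / 16 * s\<^sup>2 \<le> Psi i y s"
proof -
  have "\<delta> * real n / 4 * ((1 - b) / 2 * (s * (\<kappa> / sqrt (real n)))\<^sup>2 / 4) \<le> (\<Sum>k<n. defect (nu i k) (s * y k))"
  proof (rule sum_defect_ge_of_not_heavy)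
    show "2 * ((1 - b) / 2) \<le> measure (nu i k) {x. 1 \<le> \<bar>x\<bar>}" if "k < n" for k
      using nu_ge[OF i that] by simp
  qed (use real_distribution_nu[OF i] b n \<delta> s light spread norm \<kappa> in \<open>auto simp: hv_def\<close>)
  also have "\<delta> * real n / 4 * ((1 - b) / 2 * (s * (\<kappa> / sqrt (real n)))\<^sup>2 / 4) = \<delta> * ((1 - b) / 2) * \<kappa>\<^sup>2 / 16 * s\<^sup>2"
    using n by (simp add: power_mult_distrib power_divide)
  finally show ?thesis by (simp add: Psi_def)
qed

lemma hv_mono: "i < n \<Longrightarrow> s \<le> s' \<Longrightarrow> hv \<delta> i s \<subseteq> hv \<delta> i s'"
  unfolding hv_def by (rule heavy_mono) (auto intro: real_distribution_nu)

lemma finite_hv [simp]: "finite (hv \<delta> i s)"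
  by (simp add: hv_def)

text \<open>Each heavy coordinate contributes at least \<open>q * (\<tau> / s)\<^sup>2\<close> to
  the second moments, where \<open>\<tau>\<^sup>2 = \<delta> * n / 16\<close>, and \<delta> n / 2
  such contributions must fit into 4 r n^2.\<close>

lemma hv_frequency_ge:
  assumes i: "flat r i" and \<delta>: "0 < \<delta>" and s: "0 < s" and hv: "\<delta> * real n / 2 < real (card (hv \<delta> i s))"
  shows "\<delta>\<^sup>2 * ((1 - b) / 2) \<le> 128 * r * s\<^sup>2"
proof -
  define q where "q = (1 - b) / 2"
  define \<tau> where "\<tau> = sqrt (\<delta> * real n) / 4"
  have q: "0 < q" using b by (simp add: q_def)
  have \<tau>: "0 < \<tau>" "\<tau>\<^sup>2 = \<delta> * real n / 16" using n \<delta> by (auto simp: \<tau>_def power_divide)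
  have ii: "i < n" using i by (simp add: flat_def)
  have "\<delta> * real n / 2 * (q * (\<tau> / s)\<^sup>2) \<le> real (card (hv \<delta> i s)) * (q * (\<tau> / s)\<^sup>2)"
    using hv q by (intro mult_right_mono) auto
  also have "\<dots> \<le> (\<Sum>k\<in>{..<n}. \<integral>x. x\<^sup>2 \<partial>nu i k)"
  proof (rule card_ge_mult_le_sum)
    show "hv \<delta> i s \<subseteq> {..<n}" by (auto simp: hv_def heavy_def)
    fix k assume k: "k \<in> hv \<delta> i s"
    then have kn: "k < n" and m: "q \<le> measure (nu i k) {x. \<tau> \<le> s * \<bar>x\<bar>}"
      by (auto simp: hv_def heavy_def q_def \<tau>_def)
    interpret N: real_distribution "nu i k" by (rule real_distribution_nu[OF ii kn])
    have "q * (\<tau> / s)\<^sup>2 \<le> measure (nu i k) {x. \<tau> \<le> s * \<bar>x\<bar>} * (\<tau> / s)\<^sup>2" using m by (intro mult_right_mono) auto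
    also have "\<dots> = (\<integral>x. indicator {x. \<tau> \<le> s * \<bar>x\<bar>} x * (\<tau> / s)\<^sup>2 \<partial>nu i k)" by simp
    also have "\<dots> \<le> (\<integral>x. x\<^sup>2 \<partial>nu i k)"
    proof (rule integral_mono[OF _ nu_sq(1)[OF ii kn]])
      show "integrable (nu i k) (\<lambda>x. indicator {x. \<tau> \<le> s * \<bar>x\<bar>} x * (\<tau> / s)\<^sup>2)"
        by (intro integrable_mult_left integrable_real_indicator) (auto simp: N.emeasure_eq_measure)
      show "indicator {x. \<tau> \<le> s * \<bar>x\<bar>} x * (\<tau> / s)\<^sup>2 \<le> x\<^sup>2" for x
      proof (cases "\<tau> \<le> s * \<bar>x\<bar>")
        case True
        then have "\<tau> / s \<le> \<bar>x\<bar>" using s by (simp add: pos_divide_le_eq mult.commute)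
        then have "(\<tau> / s)\<^sup>2 \<le> \<bar>x\<bar>\<^sup>2" using s \<tau> by (intro power_mono) auto
        then show ?thesis using True by simp
      qed auto
    qed
    finally show "q * (\<tau> / s)\<^sup>2 \<le> (\<integral>x. x\<^sup>2 \<partial>nu i k)" .
  qed auto
  also have "\<dots> \<le> 4 * mom i" by (rule sum_nu_sq_le[OF ii])
  also have "\<dots> \<le> 4 * (r * (real n)\<^sup>2)" using i by (simp add: flat_def)
  finally have "\<delta> * real n / 2 * (q * (\<tau> / s)\<^sup>2) * s\<^sup>2 \<le> 4 * (r * (real n)\<^sup>2) * s\<^sup>2"
    by (intro mult_right_mono) auto
  moreover have "\<delta> * real n / 2 * (q * (\<tau> / s)\<^sup>2) * s\<^sup>2 = (\<delta>\<^sup>2 * q) * (real n)\<^sup>2 / 32"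
  proof -
    have e: "(\<tau> / s)\<^sup>2 * s\<^sup>2 = \<delta> * real n / 16" using s \<tau>(2) by (simp add: power_divide)
    have "\<delta> * real n / 2 * (q * (\<tau> / s)\<^sup>2) * s\<^sup>2 = \<delta> * real n / 2 * q * ((\<tau> / s)\<^sup>2 * s\<^sup>2)"
      by (simp only: mult_ac)
    then show ?thesis unfolding e by (simp add: power2_eq_square)
  qed
  ultimately have "(\<delta>\<^sup>2 * q) * (real n)\<^sup>2 / 32 \<le> 4 * (r * (real n)\<^sup>2) * s\<^sup>2" by linarith
  then have "(\<delta>\<^sup>2 * q) * (real n)\<^sup>2 \<le> (128 * r * s\<^sup>2) * (real n)\<^sup>2" by (simp add: mult_ac)
  then show ?thesis using n unfolding q_def by simp
qed

text \<open>Markov's inequality over the columns. The bound is free of \<open>n\<close>, so giving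
  up these columns loses only boundedly many factors D.\<close>

lemma card_not_flat_le:
  assumes "0 < r"
  shows "real (card {i. i < n \<and> \<not> flat r i}) \<le> K / r"
proof -
  have "real (card {i. i < n \<and> \<not> flat r i}) * (r * (real n)\<^sup>2) \<le> (\<Sum>i\<in>{..<n}. mom i)"
    by (rule card_ge_mult_le_sum) (auto simp: flat_def mom_nonneg)
  also have "\<dots> \<le> K * (real n)\<^sup>2" using total by (simp add: mom_def)
  finally have "real (card {i. i < n \<and> \<not> flat r i}) * r \<le> K" using n by simp
  then show ?thesis using assms by (simp add: pos_le_divide_eq)
qed

text \<open>The powers of D cancel: at most exp(2 n) (\<Gamma> D)^n exp(-\<Lambda> n) candidates,
  each of probability at most exp(4 n) (C0 / D)^n. With \<Lambda> = 10 + ln (\<Gamma> C0) this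
  leaves exp(-4 n) for each of at most exp(2 n) pairs of a grid frequency and a column. The
  threshold \<gamma> n drops to \<gamma> n / 4 between grid points and to \<gamma> n / 16 at lattice
  points.\<close>

lemma ex_structured_event:
  fixes \<delta> \<kappa> r \<beta> \<omega> \<gamma> :: real and Lmax g :: nat
  defines "q \<equiv> (1 - b) / 2" and "\<Gamma> \<equiv> 1 + 6 * sqrt K"
  defines "\<alpha> \<equiv> \<delta> * q * (\<kappa> / 2)\<^sup>2 / 16"
  defines "C0 \<equiv> 20 * (2 / sqrt (\<alpha> / 2) + 1)"
  defines "\<Lambda> \<equiv> 10 + ln (\<Gamma> * C0)"
  assumes j: "j < n" and \<delta>: "0 < \<delta>" and \<kappa>: "0 < \<kappa>"
    and \<omega>: "0 < \<omega>" "\<omega> \<le> 1" and \<beta>: "0 \<le> \<beta>" "0 < \<gamma>" "3 * \<gamma> * \<beta> \<le> 1"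
    and r: "0 < r" "32 * r \<le> \<gamma>" "32 * r \<le> \<delta> * q * K"
    and small: "2 * (sqrt (32 * r / (\<delta> * q * K)) + 2 * \<omega> + exp (- \<beta> * (q / 2) * \<omega>\<^sup>2 / 40)) * (sqrt K * (8 / sqrt \<delta> + 6))
       \<le> \<Gamma> * exp (- 4 * \<Lambda> / \<delta>)"
    and r2: "128 * r * (2 / \<kappa> + 2)\<^sup>2 \<le> \<delta>\<^sup>2 * q"
    and g: "1 + K / r \<le> real g"
    and Lmax: "real Lmax / sqrt (real n) \<le> exp (\<gamma> / 16 * real n / 2)" "real g * ln (real Lmax / sqrt (real n) + 1) \<le> real n"
      "real Lmax \<le> exp (real n)"
  shows "\<exists>E\<in>events. prob E \<le> exp (- real n) \<and>
    (\<forall>\<omega>\<in>space M - E. (\<Prod>i<n. w2 i \<omega>) < exp (2 * real n) \<longrightarrow>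
      (\<forall>v. (\<Sum>k<n. (v k)\<^sup>2) = 1 \<longrightarrow> (\<forall>i<n. i \<noteq> j \<longrightarrow> Z v i \<omega> = 0) \<longrightarrow>
        \<delta> * real n \<le> card {k. k < n \<and> \<kappa> / sqrt (real n) \<le> \<bar>v k\<bar>} \<longrightarrow>
        (\<forall>i. flat r i \<longrightarrow> (\<forall>s. 0 \<le> s \<longrightarrow> s \<le> real Lmax / sqrt (real n) \<longrightarrow>
          \<alpha> * s\<^sup>2 \<le> Psi i v s \<or> \<gamma> / 16 * real n \<le> Psi i v s))))"
proof -
  have q: "0 < q" using b by (simp add: q_def)
  have \<alpha>: "0 < \<alpha>" unfolding \<alpha>_def using \<delta> q \<kappa> by simp
  have \<Gamma>: "1 \<le> \<Gamma>" using K by (simp add: \<Gamma>_def)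
  have C0: "20 \<le> C0" using \<alpha> by (simp add: C0_def)
  have \<Lambda>: "0 \<le> \<Lambda>"
  proof -
    have "1 * 1 \<le> \<Gamma> * C0" using \<Gamma> C0 by (intro mult_mono) auto
    then show ?thesis by (simp add: \<Lambda>_def)
  qed
  define D where "D = (\<lambda>l::nat. real l / sqrt (real n))"
  have sn: "1 \<le> sqrt (real n)" using n by simp
  define I where "I = {..<n} - {j}"
  have I: "I \<subseteq> {..<n}" and finI: "finite I" by (auto simp: I_def)
  \<comment> \<open>At this mesh \<open>D l * m l = 1 / sqrt (K * n)\<close>, the frequency step of
    the lattice count, and the rounding cost times D^2 is exactly \<open>n\<close>.\<close>
  define m where "m = (\<lambda>l. 1 / (D l * sqrt (K * real n)))"
  define y where "y = (\<lambda>l (z::nat \<Rightarrow> int) k. m l * real_of_int (z k))"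
  define N where "N = (\<lambda>l. nat \<lceil>3 * D l * sqrt K * real n\<rceil>)"
  define S0 where "S0 = (\<lambda>l i0. {z \<in> PiE {..<n} (\<lambda>_. {-int (N l)..int (N l)}).
      (\<Sum>k<n. \<bar>real_of_int (z k)\<bar>) \<le> 3 * D l * sqrt K * real n \<and>
      \<beta> * (\<Sum>k<n. defect (nu i0 k) (1 / sqrt (K * real n) * real_of_int (z k))) \<le> real n})"
  define good where "good = (\<lambda>l z. \<forall>i. flat r i \<longrightarrow> (\<forall>s. 0 \<le> s \<longrightarrow> s \<le> D l \<longrightarrow>
      \<alpha> * s\<^sup>2 \<le> Psi i (y l z) s \<or> \<gamma> / 16 * real n \<le> Psi i (y l z) s))"
  \<comment> \<open>Here \<open>l\<close> stands for the last grid index before the earliest bad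
    one, and \<open>i0\<close> for a column that is bad at the next index.\<close>
  define P where "P = {(l, i0). l < Lmax \<and> flat r i0 \<and> 1 \<le> D l \<and> D (Suc l) \<le> 2 * D l \<and>
      \<delta> * real n / 2 < real (card (hv \<delta> i0 (D (Suc l))))}"
  define N3 where "N3 = (\<lambda>(l, i0). {z \<in> S0 l i0. good l z})"
  define Ev where "Ev = (\<lambda>l z. {\<omega> \<in> space M. exp (- (3 * real n)) \<le> (\<Prod>i\<in>I. 1 / (1 + (D l * Z (y l z) i \<omega>)\<^sup>2))})"
  define E where "E = (\<Union>p\<in>P. \<Union>z\<in>N3 p. Ev (fst p) z)"
  have finP: "finite P" by (rule finite_subset[of _ "{..<Lmax} \<times> {..<n}"]) (auto simp: P_def flat_def)
  have cardP: "real (card P) \<le> exp (real n) * exp (real n)"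
  proof -
    have "card P \<le> card ({..<Lmax} \<times> {..<n})" by (rule card_mono) (auto simp: P_def flat_def)
    then have "real (card P) \<le> real Lmax * real n" by (simp add: card_cartesian_product flip: of_nat_mult)
    also have "\<dots> \<le> exp (real n) * exp (real n)"
    proof (rule mult_mono)
      show "real n \<le> exp (real n)" using exp_ge_add_one_self[of "real n"] by linarith
    qed (use Lmax(3) in auto)
    finally show ?thesis .
  qed
  have finS: "finite (S0 l i0)" for l i0
    unfolding S0_def by (rule finite_subset[OF _ finite_PiE[of "{..<n}" "\<lambda>_. {-int (N l)..int (N l)}"]]) auto
  have finN: "finite (N3 p)" for p using finS by (auto simp: N3_def split: prod.splits)
  have Evm: "Ev l z \<in> events" for l z
  proof -
    have [measurable]: "Z (y l z) i \<in> borel_measurable M" if "i \<in> I" for i using that I Z_measurable by auto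
    show ?thesis unfolding Ev_def using finI by measurable
  qed
  have UEm: "(\<Union>z\<in>N3 p. Ev (fst p) z) \<in> events" for p by (rule sets.finite_UN[OF finN Evm])
  have Em: "E \<in> events" unfolding E_def by (rule sets.finite_UN[OF finP UEm])
  have cardS: "real (card (S0 l i0)) \<le> exp (2 * real n) * (\<Gamma> * D l) ^ n * exp (- \<Lambda> * real n)" if "(l, i0) \<in> P" for l i0
    unfolding S0_def \<Gamma>_def
  proof (rule card_structured_lattice_le[where V = "4 * r" and q = q and s = "D (Suc l)" and \<omega> = \<omega> and \<delta> = \<delta>])
    have i0: "i0 < n" "flat r i0" using that by (auto simp: P_def flat_def)
    show "real_distribution (nu i0 k)" if "k < n" for k by (rule real_distribution_nu[OF i0(1) that])
    show "integrable (nu i0 k) (\<lambda>x. x\<^sup>2)" if "k < n" for k by (rule nu_sq(1)[OF i0(1) that])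
    show "(\<Sum>k<n. \<integral>x. x\<^sup>2 \<partial>nu i0 k) \<le> 4 * r * (real n)\<^sup>2"
      using sum_nu_sq_le[OF i0(1)] i0(2) by (simp add: flat_def)
    show "D l \<le> D (Suc l)" unfolding D_def by (intro divide_right_mono) auto
    show "\<delta> * real n / 2 \<le> real (card (heavy (nu i0) n q (sqrt (\<delta> * real n) / 4) (D (Suc l))))"
      using that by (simp add: P_def hv_def q_def)
    show "2 * (sqrt (8 * (4 * r) / (\<delta> * q * K)) + 2 * \<omega> + exp (- \<beta> * (q / 2) * \<omega>\<^sup>2 / 40)) * (sqrt K * (8 / sqrt \<delta> + 6))
       \<le> (1 + 6 * sqrt K) * exp (- 4 * \<Lambda> / \<delta>)"
      using small unfolding \<Gamma>_def by simp
  qed (use that n K q \<delta> \<omega> \<beta> \<Lambda> r in \<open>auto simp: P_def\<close>)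
  \<comment> \<open>At most \<open>g\<close> columns give no factor C0 / D: the column
    \<open>j\<close> itself and the non-flat ones.\<close>
  have cardflat: "real (n - card {i \<in> I. flat r i}) \<le> real g"
  proof -
    have "{..<n} \<subseteq> {i \<in> I. flat r i} \<union> ({j} \<union> {i. i < n \<and> \<not> flat r i})" by (auto simp: I_def)
    then have "card {..<n} \<le> card ({i \<in> I. flat r i} \<union> ({j} \<union> {i. i < n \<and> \<not> flat r i}))"
      using finI by (intro card_mono) auto
    also have "\<dots> \<le> card {i \<in> I. flat r i} + (card {j} + card {i. i < n \<and> \<not> flat r i})"
      by (intro order_trans[OF card_Un_le] add_left_mono card_Un_le)
    finally have "real (n - card {i \<in> I. flat r i}) \<le> 1 + real (card {i. i < n \<and> \<not> flat r i})" by simp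
    also have "\<dots> \<le> 1 + K / r" using card_not_flat_le[OF r(1)] by simp
    finally show ?thesis using g by linarith
  qed
  have Dle: "D l \<le> real Lmax / sqrt (real n)" if "l < Lmax" for l
    unfolding D_def using that by (intro divide_right_mono) auto
  have pEv: "prob (Ev l z) \<le> exp (4 * real n) * (C0 / D l) ^ n" if p: "(l, i0) \<in> P" and z: "z \<in> N3 (l, i0)" for l i0 z
  proof -
    have D1: "1 \<le> D l" and lL: "l < Lmax" using p by (auto simp: P_def)
    let ?F = "{i \<in> I. flat r i}"
    have cF: "card ?F \<le> n" using card_mono[of "{..<n}" ?F] I by auto
    have De: "D l \<le> exp (\<gamma> / 16 * real n / 2)" using Dle[OF lL] Lmax(1) by linarith
    have "prob (Ev l z) \<le> exp (3 * real n) * (\<Prod>i\<in>I. expectation (\<lambda>\<omega>. 1 / (1 + (D l * Z (y l z) i \<omega>)\<^sup>2)))"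
      unfolding Ev_def by (rule prob_prod_cauchy_le[OF I])
    also have "(\<Prod>i\<in>I. expectation (\<lambda>\<omega>. 1 / (1 + (D l * Z (y l z) i \<omega>)\<^sup>2))) \<le> (\<Prod>i\<in>I. if i \<in> ?F then C0 / D l else 1)"
    proof (rule prod_mono, rule conjI)
      fix i assume i: "i \<in> I"
      then have ii: "i < n" using I by auto
      show "0 \<le> expectation (\<lambda>\<omega>. 1 / (1 + (D l * Z (y l z) i \<omega>)\<^sup>2))" by (rule expectation_cauchy_le_1[OF ii])
      show "expectation (\<lambda>\<omega>. 1 / (1 + (D l * Z (y l z) i \<omega>)\<^sup>2)) \<le> (if i \<in> ?F then C0 / D l else 1)"
      proof (cases "i \<in> ?F")
        case True
        have "expectation (\<lambda>\<omega>. 1 / (1 + (D l * (Z (y l z) i \<omega> - 0))\<^sup>2)) \<le> 20 * (2 / sqrt (\<alpha> / 2) + 1) / D l"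
        proof (rule expectation_cauchy_le[OF ii \<alpha> _ De])
          fix s assume "0 \<le> s" "s \<le> D l"
          then show "\<alpha> * s\<^sup>2 \<le> Psi i (y l z) s \<or> \<gamma> / 16 * real n \<le> Psi i (y l z) s"
            using z True unfolding N3_def good_def by blast
        qed (use D1 in simp)
        then show ?thesis using True by (simp add: C0_def)
      next
        case False
        then show ?thesis using expectation_cauchy_le_1(1)[OF ii] by (simp only: if_False)
      qed
    qed
    also have "(\<Prod>i\<in>I. if i \<in> ?F then C0 / D l else 1) = (C0 / D l) ^ card ?F"
    proof -
      have "(\<Prod>i\<in>I. if i \<in> ?F then C0 / D l else 1) = (\<Prod>i\<in>?F. C0 / D l)"
        by (rule prod.mono_neutral_cong_right) (auto simp: finI)
      then show ?thesis by simp
    qed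
    \<comment> \<open>Raising the exponent to \<open>n\<close> loses at most D^g, which the limit on
      \<open>Lmax\<close> keeps below exp n.\<close>
    also have "(C0 / D l) ^ card ?F \<le> (C0 / D l) ^ n * exp (real n)"
    proof -
      have "(C0 / D l) ^ n = (C0 / D l) ^ card ?F * (C0 / D l) ^ (n - card ?F)"
        using cF by (simp add: power_add[symmetric])
      moreover have "1 \<le> (C0 / D l) ^ (n - card ?F) * exp (real n)"
      proof -
        have "(D l) ^ (n - card ?F) \<le> exp (real n)"
        proof -
          have "0 \<le> ln (D l)" using D1 by simp
          have "(D l) ^ (n - card ?F) = exp (real (n - card ?F) * ln (D l))" using D1 by (simp add: exp_of_nat_mult)
          also have "\<dots> \<le> exp (real g * ln (real Lmax / sqrt (real n) + 1))"
            using cardflat Dle[OF lL] D1 by (subst exp_le_cancel_iff, intro mult_mono) auto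
          also have "\<dots> \<le> exp (real n)" using Lmax(2) by simp
          finally show ?thesis .
        qed
        moreover have "1 \<le> C0 ^ (n - card ?F)" using C0 by (intro one_le_power) simp
        ultimately have "1 * (D l) ^ (n - card ?F) \<le> C0 ^ (n - card ?F) * exp (real n)"
          using D1 by (intro mult_mono) auto
        then show ?thesis using D1 by (simp add: power_divide pos_le_divide_eq)
      qed
      then have "(C0 / D l) ^ card ?F * 1 \<le> (C0 / D l) ^ card ?F * ((C0 / D l) ^ (n - card ?F) * exp (real n))"
        using C0 D1 by (intro mult_left_mono) auto
      ultimately show ?thesis by simp
    qed
    finally have "prob (Ev l z) \<le> exp (3 * real n) * ((C0 / D l) ^ n * exp (real n))" by simp
    also have "\<dots> = exp (4 * real n) * (C0 / D l) ^ n" by (simp add: exp_add[symmetric])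
    finally show ?thesis .
  qed
  have pP: "prob (\<Union>z\<in>N3 p. Ev (fst p) z) \<le> exp (- (4 * real n))" if p: "p \<in> P" for p
  proof -
    obtain l i0 where pe: "p = (l, i0)" by (cases p)
    have D1: "1 \<le> D l" using p by (auto simp: P_def pe)
    have "prob (\<Union>z\<in>N3 p. Ev (fst p) z) \<le> (\<Sum>z\<in>N3 p. prob (Ev (fst p) z))"
      using finN Evm by (intro finite_measure_subadditive_finite) auto
    also have "\<dots> \<le> (\<Sum>z\<in>N3 p. exp (4 * real n) * (C0 / D l) ^ n)"
      using pEv[of l i0] p unfolding pe by (intro sum_mono) auto
    also have "\<dots> = real (card (N3 p)) * (exp (4 * real n) * (C0 / D l) ^ n)" by simp
    also have "\<dots> \<le> real (card (S0 l i0)) * (exp (4 * real n) * (C0 / D l) ^ n)"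
      using finS C0 D1 unfolding pe N3_def by (intro mult_right_mono of_nat_mono card_mono) auto
    also have "\<dots> \<le> (exp (2 * real n) * (\<Gamma> * D l) ^ n * exp (- \<Lambda> * real n)) * (exp (4 * real n) * (C0 / D l) ^ n)"
      using cardS[of l i0] p C0 D1 unfolding pe by (intro mult_right_mono) auto
    also have "\<dots> = exp (2 * real n) * exp (4 * real n) * exp (- \<Lambda> * real n) * ((\<Gamma> * D l) * (C0 / D l)) ^ n"
      by (simp only: power_mult_distrib mult_ac)
    also have "(\<Gamma> * D l) * (C0 / D l) = exp (ln (\<Gamma> * C0))" using D1 \<Gamma> C0 by simp
    also have "exp (ln (\<Gamma> * C0)) ^ n = exp (real n * ln (\<Gamma> * C0))" by (rule exp_of_nat_mult[symmetric])
    also have "exp (2 * real n) * exp (4 * real n) * exp (- \<Lambda> * real n) * exp (real n * ln (\<Gamma> * C0)) = exp (- (4 * real n))"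
      unfolding exp_add[symmetric] by (simp add: \<Lambda>_def algebra_simps)
    finally show ?thesis .
  qed
  have pE: "prob E \<le> exp (- real n)"
  proof -
    have "prob E \<le> (\<Sum>p\<in>P. prob (\<Union>z\<in>N3 p. Ev (fst p) z))"
      unfolding E_def using finP UEm by (intro finite_measure_subadditive_finite) auto
    also have "\<dots> \<le> (\<Sum>p\<in>P. exp (- (4 * real n)))" by (intro sum_mono pP)
    also have "\<dots> = real (card P) * exp (- (4 * real n))" by simp
    also have "\<dots> \<le> (exp (real n) * exp (real n)) * exp (- (4 * real n))" by (intro mult_right_mono cardP) auto
    also have "\<dots> = exp (- (2 * real n))" by (simp add: exp_add[symmetric])
    also have "\<dots> \<le> exp (- real n)" by simp
    finally show ?thesis .
  qed
  show ?thesis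
  proof (intro bexI[OF _ Em] conjI pE ballI impI allI)
    fix \<omega>' v i s
    assume \<omega>': "\<omega>' \<in> space M - E" and E1: "(\<Prod>i<n. w2 i \<omega>') < exp (2 * real n)"
      and v: "(\<Sum>k<n. (v k)\<^sup>2) = 1" and ker: "\<forall>i<n. i \<noteq> j \<longrightarrow> Z v i \<omega>' = 0"
      and spread: "\<delta> * real n \<le> card {k. k < n \<and> \<kappa> / sqrt (real n) \<le> \<bar>v k\<bar>}"
      and i: "flat r i" and s: "0 \<le> s" "s \<le> real Lmax / sqrt (real n)"
    have v1: "\<bar>v k\<bar> \<le> 1" if "k < n" for k
    proof -
      have "(v k)\<^sup>2 \<le> (\<Sum>k<n. (v k)\<^sup>2)" using that by (intro member_le_sum) auto
      then have "(v k)\<^sup>2 \<le> 1" using v by simp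
      then show ?thesis by (simp add: abs_square_le_1)
    qed
    \<comment> \<open>Heaviness is part of badness: at a frequency with few heavy coordinates the
      quadratic lower bound for \<open>Psi\<close> holds anyway.\<close>
    define bad where "bad = (\<lambda>i l. flat r i \<and> \<delta> * real n / 2 < real (card (hv \<delta> i (D l))) \<and> Psi i v (D l) < \<gamma> * real n)"
    have v4: "(\<Sum>k<n. (v k)\<^sup>2) \<le> 4" using v by simp
    have heavy_Psi: "\<gamma> / 4 * real n \<le> Psi i v s"
      if i: "flat r i" and l: "\<And>l'. l' \<le> l \<Longrightarrow> \<not> bad i l'" and s: "0 \<le> s" "s \<le> D l"
        and False: "\<not> real (card (hv \<delta> i s)) \<le> \<delta> * real n / 2" for i l s
    proof -
      have ii: "i < n" using i by (simp add: flat_def)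
      \<comment> \<open>Rounded up, not down: heaviness increases with the frequency, so the grid
        point inherits it from \<open>s\<close>; and since it is not bad, \<open>Psi\<close> is at
        least \<gamma> n there.\<close>
      define l' where "l' = nat \<lceil>s * sqrt (real n)\<rceil>"
      have ss: "0 \<le> s * sqrt (real n)" using s by simp
      have l'1: "s * sqrt (real n) \<le> real l'" "real l' \<le> s * sqrt (real n) + 1"
        unfolding l'_def using ss by linarith+
      have sn0: "0 < sqrt (real n)" using sn by linarith
      have a1: "s \<le> D l'" unfolding D_def using l'1(1) sn0 by (simp add: pos_le_divide_eq)
      have "real l' / sqrt (real n) \<le> (s * sqrt (real n) + 1) / sqrt (real n)" using l'1(2) sn0 by (intro divide_right_mono) auto
      then have a2: "D l' - s \<le> 1 / sqrt (real n)" using sn0 by (simp add: D_def add_divide_distrib)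
      have "l' \<le> l"
      proof -
        have "s * sqrt (real n) \<le> real l" using s(2) sn0 unfolding D_def by (simp add: pos_le_divide_eq)
        then have "\<lceil>s * sqrt (real n)\<rceil> \<le> int l" by (simp add: ceiling_le_iff)
        then show ?thesis unfolding l'_def by linarith
      qed
      then have nb: "\<not> bad i l'" by (rule l)
      have "card (hv \<delta> i s) \<le> card (hv \<delta> i (D l'))" by (intro card_mono hv_mono ii a1) auto
      then have "\<delta> * real n / 2 < real (card (hv \<delta> i (D l')))" using False by linarith
      then have P1: "\<gamma> * real n \<le> Psi i v (D l')" using nb i unfolding bad_def by auto
      have "Psi i v (D l') \<le> 2 * Psi i v s + 4 * 1\<^sup>2 * r * real n"
      proof (rule Psi_perturb_flat[OF i])
        fix k assume k: "k < n"
        have "\<bar>D l' * v k - s * v k\<bar> = \<bar>D l' - s\<bar> * \<bar>v k\<bar>"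
          unfolding left_diff_distrib[symmetric] by (rule abs_mult)
        also have "\<dots> \<le> 1 / sqrt (real n) * 1" using a1 a2 v1[OF k] by (intro mult_mono) auto
        finally show "\<bar>D l' * v k - s * v k\<bar> \<le> 1 / sqrt (real n)" by simp
      qed
      moreover have "4 * r * real n \<le> \<gamma> / 2 * real n" using r by (intro mult_right_mono) auto
      ultimately show ?thesis using P1 by (simp add: field_simps)
    qed
    have not_bad: "\<alpha> * s\<^sup>2 \<le> Psi i v s \<or> \<gamma> / 4 * real n \<le> Psi i v s"
      if i: "flat r i" and l: "\<And>l'. l' \<le> l \<Longrightarrow> \<not> bad i l'" and s: "0 \<le> s" "s \<le> D l" for i l s
    proof (cases "real (card (hv \<delta> i s)) \<le> \<delta> * real n / 2")
      case True
      have ii: "i < n" using i by (simp add: flat_def)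
      have "\<delta> * ((1 - b) / 2) * \<kappa>\<^sup>2 / 16 * s\<^sup>2 \<le> Psi i v s"
        by (rule Psi_ge_of_not_heavy[OF ii \<delta> s(1) _ True spread v4]) (use \<kappa> in auto)
      moreover have "\<alpha> * s\<^sup>2 \<le> \<delta> * ((1 - b) / 2) * \<kappa>\<^sup>2 / 16 * s\<^sup>2"
        unfolding \<alpha>_def q_def[symmetric] using \<delta> q by (intro mult_right_mono divide_right_mono mult_left_mono) (auto simp: power_divide)
      ultimately show ?thesis by linarith
    next
      case False
      then show ?thesis using heavy_Psi[OF i l s] by blast
    qed
    have nobad: "\<not> bad i0 l" if "l \<le> Lmax" for i0 l
    proof (rule ccontr)
      assume nb: "\<not> \<not> bad i0 l"
      then have ex: "\<exists>l. \<exists>i0. bad i0 l" by blast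
      \<comment> \<open>The minimum is over all columns at once: one bad column supplies the
        structure of the candidates, while the density bound just below this frequency is wanted for
        every flat column.\<close>
      define l0 where "l0 = (LEAST l. \<exists>i0. bad i0 l)"
      have "\<exists>i0. bad i0 l0" unfolding l0_def using ex by (rule LeastI_ex)
      then obtain i0 where b0: "bad i0 l0" by blast
      have min: "\<not> bad i l" if "l < l0" for i l
        using not_less_Least[of l "\<lambda>l. \<exists>i0. bad i0 l"] that unfolding l0_def by blast
      have "l0 \<le> l" unfolding l0_def by (rule Least_le) (use nb in blast)
      then have l0L: "l0 \<le> Lmax" using that by linarith
      have i0: "flat r i0" "i0 < n" using b0 by (auto simp: bad_def flat_def)
      \<comment> \<open>At frequency 0 no coordinate is heavy because the threshold \<tau> is
        positive; so a preceding grid point exists.\<close>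
      have l0pos: "l0 \<noteq> 0"
      proof
        assume "l0 = 0"
        define \<tau> where "\<tau> = sqrt (\<delta> * real n) / 4"
        have "0 < \<tau>" using \<delta> n by (simp add: \<tau>_def)
        then have "{x::real. \<tau> \<le> 0 * \<bar>x\<bar>} = {}" by auto
        then have "hv \<delta> i0 (D l0) = {}"
          using \<open>l0 = 0\<close> b unfolding hv_def heavy_def \<tau>_def[symmetric] by (simp add: D_def)
        then have "\<delta> * real n < 0" using b0 by (simp add: bad_def)
        moreover have "0 < \<delta> * real n" using \<delta> n by (intro mult_pos_pos) auto
        ultimately show False by (rule less_asym)
      qed
      then obtain l1 where l1: "l0 = Suc l1" by (cases l0) auto
      have sn0: "0 < sqrt (real n)" using sn by linarith
      have Dl0: "0 < D l0" unfolding D_def using l0pos sn0 by simp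
      have "\<delta>\<^sup>2 * q \<le> 128 * r * (D l0)\<^sup>2"
        unfolding q_def by (rule hv_frequency_ge[OF i0(1) \<delta> Dl0]) (use b0 in \<open>auto simp: bad_def\<close>)
      then have "128 * r * (2 / \<kappa> + 2)\<^sup>2 \<le> 128 * r * (D l0)\<^sup>2" using r2 by linarith
      then have "(2 / \<kappa> + 2)\<^sup>2 \<le> (D l0)\<^sup>2" using r(1) by simp
      then have Dl0b: "2 / \<kappa> + 2 \<le> D l0" by (rule power2_le_imp_le[OF _ less_imp_le[OF Dl0]])
      have Deq: "D l0 = D l1 + 1 / sqrt (real n)" unfolding l1 D_def by (simp add: add_divide_distrib)
      have is1: "1 / sqrt (real n) \<le> 1" using sn by simp
      have \<kappa>2: "0 < 2 / \<kappa>" using \<kappa> by simp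
      \<comment> \<open>The slack 2 in 2 / \<kappa> + 2 pays for the grid step, which is at most 1.
        The part 2 / \<kappa> makes the mesh at most \<kappa> / (2 \<surd>n), so that rounding keeps
        \<open>v\<close> spread out.\<close>
      have D1: "1 \<le> D l1" and D\<kappa>: "2 / \<kappa> \<le> D l1" and Dd: "D l0 \<le> 2 * D l1"
        using Dl0b Deq is1 \<kappa>2 by linarith+
      define mm where "mm = m l1"
      have sK: "1 \<le> sqrt K" using K by simp
      have mm: "0 < mm" "mm\<^sup>2 * real n \<le> 1" and mm\<kappa>: "mm \<le> \<kappa> / 2 / sqrt (real n)"
        and Dmm: "D l1 * mm = 1 / sqrt (K * real n)" and mmn: "D l1 * mm \<le> 1 / sqrt (real n)"
        and mmQ: "(D l1)\<^sup>2 * (mm\<^sup>2 * (real n * (K * real n))) = real n"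
      proof -
        have Kn: "0 < sqrt (K * real n)" using K n by simp
        show "0 < mm" unfolding mm_def m_def using D1 Kn by simp
        show Dm: "D l1 * mm = 1 / sqrt (K * real n)" unfolding mm_def m_def using D1 by simp
        have nK: "sqrt (real n) \<le> sqrt (K * real n)" using K n by simp
        show Dm2: "D l1 * mm \<le> 1 / sqrt (real n)" unfolding Dm using nK sn0 by (intro divide_left_mono) auto
        then have "mm \<le> 1 / sqrt (real n) / D l1"
          using D1 by (subst pos_le_divide_eq) (simp_all add: mult.commute)
        also have "\<dots> \<le> 1 / sqrt (real n) / (2 / \<kappa>)" using D\<kappa> D1 \<kappa> sn0 by (intro divide_left_mono mult_pos_pos) auto
        finally show "mm \<le> \<kappa> / 2 / sqrt (real n)" by (simp add: mult.commute)
        have "(D l1 * mm)\<^sup>2 * (real n * (K * real n)) = real n"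
          unfolding Dm using K n by (simp add: power_divide)
        then show "(D l1)\<^sup>2 * (mm\<^sup>2 * (real n * (K * real n))) = real n" by (simp add: power_mult_distrib mult.assoc)
        have "mm * 1 \<le> mm * D l1" using D1 \<open>0 < mm\<close> by (intro mult_left_mono) auto
        then have "mm \<le> 1 / sqrt (real n)" using Dm2 by (simp add: mult.commute)
        then have "mm\<^sup>2 \<le> (1 / sqrt (real n))\<^sup>2" using \<open>0 < mm\<close> by (intro power_mono) auto
        then show "mm\<^sup>2 * real n \<le> 1" using n by (simp add: power_divide pos_le_divide_eq)
      qed
      \<comment> \<open>No sparsity is asked of this rounding, so the penalty is 0.\<close>
      have "\<exists>z::nat \<Rightarrow> int. (\<forall>k<n. \<bar>mm * real_of_int (z k) - v k\<bar> \<le> mm) \<and>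
        (\<Sum>i\<in>I. (Z (\<lambda>k. mm * real_of_int (z k)) i \<omega>')\<^sup>2 / w2 i \<omega>') + 0 * real (card {k. k < n \<and> z k \<noteq> 0})
          \<le> mm\<^sup>2 * (real n * (K * real n)) + 0 * (\<Sum>k<n. min 1 (\<bar>v k\<bar> / mm))"
        by (rule ex_kernel_rounding[OF v I _ mm(1)]) (use ker in \<open>auto simp: I_def\<close>)
      then obtain z0 :: "nat \<Rightarrow> int" where z0: "\<forall>k<n. \<bar>mm * real_of_int (z0 k) - v k\<bar> \<le> mm"
        and z0Q: "(\<Sum>i\<in>I. (Z (\<lambda>k. mm * real_of_int (z0 k)) i \<omega>')\<^sup>2 / w2 i \<omega>') \<le> mm\<^sup>2 * (real n * (K * real n))" by auto
      define z where "z = restrict z0 {..<n}"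
      let ?y = "y l1 z"
      have yz: "?y k = mm * real_of_int (z0 k)" if "k < n" for k using that by (simp add: y_def z_def mm_def)
      have near: "\<bar>?y k - v k\<bar> \<le> mm" if "k < n" for k using z0 that by (simp add: yz)
      have Zeq: "Z ?y i \<omega>' = Z (\<lambda>k. mm * real_of_int (z0 k)) i \<omega>'" for i
        unfolding Z_def by (intro sum.cong) (auto simp: yz)
      have zQ: "(\<Sum>i\<in>I. (Z ?y i \<omega>')\<^sup>2 / w2 i \<omega>') \<le> mm\<^sup>2 * (real n * (K * real n))" using z0Q by (simp add: Zeq)
      note bnd = lattice_point_bounds[OF n v less_imp_le[OF mm(1)] mm(2) near]
      have l1': "(\<Sum>k<n. \<bar>real_of_int (z k)\<bar>) \<le> 3 * D l1 * sqrt K * real n"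
      proof -
        have "mm * (\<Sum>k<n. \<bar>real_of_int (z k)\<bar>) = (\<Sum>k<n. \<bar>?y k\<bar>)"
          using mm(1) by (simp add: abs_mult sum_distrib_left y_def mm_def)
        also have "\<dots> \<le> 3 * sqrt (real n)" by (rule bnd(3))
        finally have "D l1 * mm * (\<Sum>k<n. \<bar>real_of_int (z k)\<bar>) \<le> D l1 * (3 * sqrt (real n))"
          using D1 by (simp add: mult.assoc mult_left_mono)
        then have "(\<Sum>k<n. \<bar>real_of_int (z k)\<bar>) / sqrt (K * real n) \<le> D l1 * (3 * sqrt (real n))" unfolding Dmm by simp
        then have "(\<Sum>k<n. \<bar>real_of_int (z k)\<bar>) \<le> D l1 * (3 * sqrt (real n)) * sqrt (K * real n)"
          using K n by (simp add: pos_divide_le_eq)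
        also have "\<dots> = 3 * D l1 * sqrt K * (sqrt (real n) * sqrt (real n))" by (simp add: real_sqrt_mult)
        finally show ?thesis by simp
      qed
      have zP: "z \<in> PiE {..<n} (\<lambda>_. {-int (N l1)..int (N l1)})"
        unfolding z_def N_def
      proof (rule member_PiE_int_box)
        have "(\<Sum>k<n. \<bar>real_of_int (z0 k)\<bar>) = (\<Sum>k<n. \<bar>real_of_int (z k)\<bar>)" by (intro sum.cong) (auto simp: z_def)
        then show "(\<Sum>k<n. \<bar>real_of_int (z0 k)\<bar>) \<le> 3 * D l1 * sqrt K * real n" using l1' by simp
      qed
      \<comment> \<open>\<open>D l1 * y\<close> and \<open>D l0 * v\<close> differ by at most 2 /
        \<surd>n per coordinate, half from rounding and half from the grid step. So
        \<open>Psi\<close> at the lattice point is at most 2 \<gamma> n + 16 r n \<le> 3 \<gamma> n,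
        which \<open>3 * \<gamma> * \<beta> \<le> 1\<close> converts into the count's
        constraint.\<close>
      have zstruct: "\<beta> * (\<Sum>k<n. defect (nu i0 k) (1 / sqrt (K * real n) * real_of_int (z k))) \<le> real n"
      proof -
        have "(\<Sum>k<n. defect (nu i0 k) (1 / sqrt (K * real n) * real_of_int (z k))) = Psi i0 ?y (D l1)"
          unfolding Psi_def y_def Dmm[symmetric] mm_def by (simp add: mult.assoc)
        also have "\<dots> \<le> 2 * Psi i0 v (D l0) + 4 * 2\<^sup>2 * r * real n"
        proof (rule Psi_perturb_flat[OF i0(1)])
          fix k assume k: "k < n"
          have "D l1 * ?y k - D l0 * v k = D l1 * (?y k - v k) - v k / sqrt (real n)"
            unfolding Deq by (simp add: algebra_simps)
          then have "\<bar>D l1 * ?y k - D l0 * v k\<bar> \<le> \<bar>D l1 * (?y k - v k)\<bar> + \<bar>v k / sqrt (real n)\<bar>" by linarith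
          also have "\<bar>D l1 * (?y k - v k)\<bar> \<le> D l1 * mm" using near[OF k] D1 by (simp add: abs_mult mult_left_mono)
          also have "\<dots> \<le> 1 / sqrt (real n)" by (rule mmn)
          also have "\<bar>v k / sqrt (real n)\<bar> \<le> 1 / sqrt (real n)" using v1[OF k] sn0 by (simp add: divide_right_mono)
          finally show "\<bar>D l1 * ?y k - D l0 * v k\<bar> \<le> 2 / sqrt (real n)" by simp
        qed
        also have "\<dots> \<le> 2 * (\<gamma> * real n) + \<gamma> * real n"
        proof -
          have "Psi i0 v (D l0) \<le> \<gamma> * real n" using b0 by (simp add: bad_def)
          moreover have "16 * r * real n \<le> \<gamma> * real n" using r by (intro mult_right_mono) auto
          ultimately show ?thesis by simp
        qed
        finally have "\<beta> * (\<Sum>k<n. defect (nu i0 k) (1 / sqrt (K * real n) * real_of_int (z k))) \<le> \<beta> * (3 * \<gamma> * real n)"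
          using \<beta> by (intro mult_left_mono) auto
        also have "\<dots> = 3 * \<gamma> * \<beta> * real n" by simp
        also have "\<dots> \<le> 1 * real n" using \<beta> by (intro mult_right_mono) auto
        finally show ?thesis by simp
      qed
      \<comment> \<open>By minimality of \<open>l0\<close> no column is bad up to \<open>l1\<close>.
        In the light case the lattice point is spread out itself; in the heavy case the bound
        \<gamma> n / 4 is carried over from \<open>v\<close>.\<close>
      have zgood: "good l1 z"
        unfolding good_def
      proof (intro allI impI)
        fix i s assume i: "flat r i" and s: "0 \<le> s" "s \<le> D l1"
        have ii: "i < n" using i by (simp add: flat_def)
        show "\<alpha> * s\<^sup>2 \<le> Psi i ?y s \<or> \<gamma> / 16 * real n \<le> Psi i ?y s"
        proof (cases "real (card (hv \<delta> i s)) \<le> \<delta> * real n / 2")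
          case True
          have sp: "\<delta> * real n \<le> real (card {k. k < n \<and> \<kappa> / 2 / sqrt (real n) \<le> \<bar>?y k\<bar>})"
          proof -
            have "{k. k < n \<and> \<kappa> / sqrt (real n) \<le> \<bar>v k\<bar>} \<subseteq> {k. k < n \<and> \<kappa> / 2 / sqrt (real n) \<le> \<bar>?y k\<bar>}"
            proof safe
              fix k assume k: "k < n" "\<kappa> / sqrt (real n) \<le> \<bar>v k\<bar>"
              have "\<kappa> / sqrt (real n) = \<kappa> / 2 / sqrt (real n) + \<kappa> / 2 / sqrt (real n)" by simp
              then show "\<kappa> / 2 / sqrt (real n) \<le> \<bar>?y k\<bar>" using k near[OF k(1)] mm\<kappa> by linarith
            qed
            then have "card {k. k < n \<and> \<kappa> / sqrt (real n) \<le> \<bar>v k\<bar>} \<le> card {k. k < n \<and> \<kappa> / 2 / sqrt (real n) \<le> \<bar>?y k\<bar>}"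
              by (intro card_mono) auto
            then show ?thesis using spread by linarith
          qed
          have "\<delta> * ((1 - b) / 2) * (\<kappa> / 2)\<^sup>2 / 16 * s\<^sup>2 \<le> Psi i ?y s"
            by (rule Psi_ge_of_not_heavy[OF ii \<delta> s(1) _ True sp bnd(1)]) (use \<kappa> in auto)
          then show ?thesis by (simp add: \<alpha>_def q_def)
        next
          case False
          have "\<gamma> / 4 * real n \<le> Psi i v s"
            by (rule heavy_Psi[OF i _ s False]) (use min l1 in auto)
          moreover have "Psi i v s \<le> 2 * Psi i ?y s + 4 * 1\<^sup>2 * r * real n"
          proof (rule Psi_perturb_flat[OF i])
            fix k assume k: "k < n"
            have "\<bar>s * v k - s * ?y k\<bar> = s * \<bar>?y k - v k\<bar>"
              using s by (simp add: right_diff_distrib[symmetric] abs_mult abs_minus_commute)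
            also have "\<dots> \<le> D l1 * mm" using s near[OF k] D1 by (intro mult_mono) auto
            finally show "\<bar>s * v k - s * ?y k\<bar> \<le> 1 / sqrt (real n)" using mmn by linarith
          qed
          moreover have "4 * r * real n \<le> \<gamma> / 8 * real n" using r by (intro mult_right_mono) auto
          ultimately show ?thesis by (simp add: field_simps)
        qed
      qed
      have inP: "(l1, i0) \<in> P"
        unfolding P_def using l0L l1 i0 D1 Dd b0 by (auto simp: bad_def)
      have inN: "z \<in> N3 (l1, i0)" unfolding N3_def S0_def using zP l1' zstruct zgood by simp
      \<comment> \<open>Of the exponent 3 n, 2 n is the product of the weights and n is D^2 times
        the rounding cost.\<close>
      have "exp (- (3 * real n)) \<le> (\<Prod>i\<in>I. 1 / (1 + (D l1 * Z ?y i \<omega>')\<^sup>2))"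
      proof -
        have w0: "0 < w2 i \<omega>'" for i using w2_ge_1[of i \<omega>'] by linarith
        have "(\<Prod>i\<in>I. 1 + (D l1 * Z ?y i \<omega>')\<^sup>2) \<le> (\<Prod>i\<in>I. w2 i \<omega>' * exp ((D l1)\<^sup>2 * ((Z ?y i \<omega>')\<^sup>2 / w2 i \<omega>')))"
        proof (rule prod_mono, rule conjI)
          fix i
          define x where "x = (D l1)\<^sup>2 * (Z ?y i \<omega>')\<^sup>2"
          have "1 + x \<le> w2 i \<omega>' * (1 + x / w2 i \<omega>')" using w0[of i] w2_ge_1[of i \<omega>'] by (simp add: distrib_left)
          also have "\<dots> \<le> w2 i \<omega>' * exp (x / w2 i \<omega>')" using w0[of i] by (intro mult_left_mono exp_ge_add_one_self) auto
          finally show "1 + (D l1 * Z ?y i \<omega>')\<^sup>2 \<le> w2 i \<omega>' * exp ((D l1)\<^sup>2 * ((Z ?y i \<omega>')\<^sup>2 / w2 i \<omega>'))"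
            by (simp add: x_def power_mult_distrib)
        qed (auto intro: add_nonneg_nonneg)
        also have "\<dots> = (\<Prod>i\<in>I. w2 i \<omega>') * exp ((D l1)\<^sup>2 * (\<Sum>i\<in>I. (Z ?y i \<omega>')\<^sup>2 / w2 i \<omega>'))"
          by (simp add: prod.distrib exp_sum[OF finI] sum_distrib_left)
        also have "\<dots> \<le> exp (2 * real n) * exp (real n)"
        proof (rule mult_mono)
          have "(\<Prod>i\<in>I. w2 i \<omega>') \<le> (\<Prod>i<n. w2 i \<omega>')"
            by (rule prod_mono2[OF _ I]) (use w2_ge_1 w0 in \<open>auto intro: less_imp_le\<close>)
          then show "(\<Prod>i\<in>I. w2 i \<omega>') \<le> exp (2 * real n)" using E1 by linarith
          have "(D l1)\<^sup>2 * (\<Sum>i\<in>I. (Z ?y i \<omega>')\<^sup>2 / w2 i \<omega>') \<le> (D l1)\<^sup>2 * (mm\<^sup>2 * (real n * (K * real n)))"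
            by (intro mult_left_mono zQ) auto
          then show "exp ((D l1)\<^sup>2 * (\<Sum>i\<in>I. (Z ?y i \<omega>')\<^sup>2 / w2 i \<omega>')) \<le> exp (real n)" unfolding mmQ by simp
        qed auto
        also have "\<dots> = exp (3 * real n)" by (simp add: exp_add[symmetric])
        finally have le: "(\<Prod>i\<in>I. 1 + (D l1 * Z ?y i \<omega>')\<^sup>2) \<le> exp (3 * real n)" .
        have pos: "0 < (\<Prod>i\<in>I. 1 + (D l1 * Z ?y i \<omega>')\<^sup>2)" by (intro prod_pos) (auto intro: add_pos_nonneg)
        have "exp (- (3 * real n)) = 1 / exp (3 * real n)" by (simp add: exp_minus divide_inverse)
        also have "\<dots> \<le> 1 / (\<Prod>i\<in>I. 1 + (D l1 * Z ?y i \<omega>')\<^sup>2)" using le pos by (intro divide_left_mono) auto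
        also have "\<dots> = (\<Prod>i\<in>I. 1 / (1 + (D l1 * Z ?y i \<omega>')\<^sup>2))" by (simp add: prod_dividef)
        finally show ?thesis .
      qed
      then have "\<omega>' \<in> Ev l1 z" using \<omega>' by (simp add: Ev_def)
      then have "\<omega>' \<in> E" unfolding E_def using inP inN by force
      then show False using \<omega>' by blast
    qed
    have "\<alpha> * s\<^sup>2 \<le> Psi i v s \<or> \<gamma> / 4 * real n \<le> Psi i v s"
      by (rule not_bad[OF i _ s(1), of Lmax]) (use nobad s in \<open>auto simp: D_def\<close>)
    moreover have "\<gamma> / 16 * real n \<le> \<gamma> / 4 * real n" using \<beta> by (intro mult_right_mono) auto
    ultimately show "\<alpha> * s\<^sup>2 \<le> Psi i v s \<or> \<gamma> / 16 * real n \<le> Psi i v s" by linarith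
  qed
qed

end

section \<open>Small ball probabilities for normal vectors\<close>

text \<open>The kernel at scale D = min (1 / \<epsilon>) Dm is at least 1/2 on the ball, so Markov's
  inequality applies; finally 1 / D \<le> \<epsilon> + 1 / Dm.\<close>

lemma (in random_columns) prob_ball_le_cauchy:
  assumes i: "i < n" and \<alpha>: "0 < \<alpha>" and Dm: "0 < Dm" "Dm \<le> exp (\<beta> * real n / 2)" and \<epsilon>: "0 \<le> \<epsilon>"
    and Psi: "\<And>s. 0 \<le> s \<Longrightarrow> s \<le> Dm \<Longrightarrow> \<alpha> * s\<^sup>2 \<le> Psi i v s \<or> \<beta> * real n \<le> Psi i v s"
  shows "prob {\<omega> \<in> space M. \<bar>Z v i \<omega> - u\<bar> < \<epsilon>} \<le> 2 * (20 * (2 / sqrt (\<alpha> / 2) + 1)) * (\<epsilon> + 1 / Dm)"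
proof (cases "\<epsilon> = 0")
  case True
  then show ?thesis using \<alpha> Dm by (auto intro!: mult_nonneg_nonneg add_nonneg_nonneg)
next
  case False
  define C0 where "C0 = 20 * (2 / sqrt (\<alpha> / 2) + 1)"
  have C0: "0 \<le> C0" using \<alpha> by (simp add: C0_def)
  define D where "D = min (1 / \<epsilon>) Dm"
  have \<epsilon>0: "0 < \<epsilon>" using False \<epsilon> by simp
  have D: "0 < D" "D \<le> Dm" "D * \<epsilon> \<le> 1"
    using \<epsilon>0 Dm by (auto simp: D_def min_def field_simps)
  have [measurable]: "Z v i \<in> borel_measurable M" using i by (rule Z_measurable)
  let ?f = "\<lambda>\<omega>. 1 / (1 + (D * (Z v i \<omega> - u))\<^sup>2)"
  have int: "integrable M ?f" by (intro integrable_const_bound[of _ 1]) (auto simp: add_pos_nonneg abs_of_nonneg)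
  have "prob {\<omega> \<in> space M. \<bar>Z v i \<omega> - u\<bar> < \<epsilon>} \<le> prob {\<omega> \<in> space M. 1 / 2 \<le> ?f \<omega>}"
  proof (rule finite_measure_mono)
    show "{\<omega> \<in> space M. \<bar>Z v i \<omega> - u\<bar> < \<epsilon>} \<subseteq> {\<omega> \<in> space M. 1 / 2 \<le> ?f \<omega>}"
    proof safe
      fix \<omega> assume *: "\<bar>Z v i \<omega> - u\<bar> < \<epsilon>"
      have "\<bar>D * (Z v i \<omega> - u)\<bar> \<le> D * \<epsilon>" using * D by (simp add: abs_mult mult_left_mono)
      then have "\<bar>D * (Z v i \<omega> - u)\<bar> \<le> 1" using D by linarith
      then have "(D * (Z v i \<omega> - u))\<^sup>2 \<le> 1" by (simp add: abs_square_le_1)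
      then have "1 / 2 \<le> 1 / (1 + (D * (Z v i \<omega> - u))\<^sup>2)"
        by (intro divide_left_mono) (auto intro: add_pos_nonneg)
      then show "1 / 2 \<le> ?f \<omega>" .
    qed
  qed measurable
  also have "\<dots> \<le> expectation ?f / (1 / 2)"
    by (rule Markov_ratio_le[OF int]) auto
  also have "\<dots> \<le> 20 * (2 / sqrt (\<alpha> / 2) + 1) / D / (1 / 2)"
    using D Dm Psi by (intro divide_right_mono expectation_cauchy_le[OF i \<alpha>, where \<beta> = \<beta>]) auto
  also have "\<dots> = 2 * C0 * (1 / D)" by (simp add: C0_def)
  also have "\<dots> \<le> 2 * C0 * (\<epsilon> + 1 / Dm)"
  proof (rule mult_left_mono)
    show "1 / D \<le> \<epsilon> + 1 / Dm"
    proof (cases "1 / \<epsilon> \<le> Dm")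
      case True
      then show ?thesis using Dm \<epsilon>0 by (simp add: D_def min_def)
    next
      case False
      then show ?thesis using \<epsilon>0 by (simp add: D_def min_def)
    qed
  qed (use C0 in simp)
  finally show ?thesis unfolding C0_def .
qed

text \<open>The conditions are not circular: \<xi>, \<iota> and \<open>c\<close> depend on
  \<open>d0\<close>, \<eta> on \<iota> and \<xi>, \<open>a\<close> on \<eta>, \<theta> on
  \<open>a\<close>, \<open>L\<close> on \<theta>, and \<delta> on \<open>L\<close>.\<close>

lemma ex_compressible_constants:
  fixes d0 K :: real
  assumes d0: "0 < d0" "d0 \<le> 1" and K: "1 \<le> K"
  shows "\<exists>a c \<eta> \<xi> \<rho> \<iota> \<theta> L \<delta>. (0 < c \<and> c\<^sup>2 \<le> d0) \<and> (0 < \<xi> \<and> \<xi> \<le> 1) \<and> (2 - d0) / (2 - d0 / 2) + \<xi> \<le> \<rho> \<and>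
    (\<rho> = exp (- \<iota>) \<and> 0 < \<iota>) \<and> (0 < \<eta> \<and> 2 * \<eta> * ln (1 / \<xi>) \<le> \<iota> / 4) \<and>
    (0 < a \<and> a \<le> 1 / 2 \<and> 2 * a\<^sup>2 * K * exp (2 / \<eta>) \<le> \<eta> * c\<^sup>2) \<and>
    (0 < \<theta> \<and> \<theta> * (3 / a) \<le> \<iota> / 16) \<and> (0 \<le> L \<and> 2 * exp (- L) / \<theta> \<le> \<iota> / 16) \<and>
    (0 < \<delta> \<and> L * (4 * \<delta>) \<le> \<iota> / (16 :: real))"
proof -
  define b1 where "b1 = (2 - d0) / (2 - d0 / 2)"
  have b1: "0 < b1" "b1 < 1" using d0 by (auto simp: b1_def divide_simps)
  define \<xi> where "\<xi> = (1 - b1) / 2"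
  have \<xi>: "0 < \<xi>" "\<xi> < 1" using b1 by (auto simp: \<xi>_def)
  define \<rho> where "\<rho> = (1 + b1) / 2"
  define \<iota> where "\<iota> = - ln \<rho>"
  have \<rho>: "0 < \<rho>" "\<rho> < 1" "b1 + \<xi> \<le> \<rho>" using b1 by (auto simp: \<rho>_def \<xi>_def field_simps)
  have \<iota>: "\<rho> = exp (- \<iota>)" "0 < \<iota>" using \<rho> by (auto simp: \<iota>_def)
  have l: "0 < ln (1 / \<xi>)" using \<xi> by (simp add: ln_div)
  define \<eta> where "\<eta> = \<iota> / (8 * ln (1 / \<xi>))"
  have \<eta>: "0 < \<eta>" "2 * \<eta> * ln (1 / \<xi>) \<le> \<iota> / 4" using l \<iota> by (auto simp: \<eta>_def)
  define c where "c = sqrt d0"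
  have c: "0 < c" "c\<^sup>2 \<le> d0" "c\<^sup>2 = d0" using d0 by (auto simp: c_def)
  define a where "a = min (1 / 2) (sqrt (\<eta> * d0 / (2 * K * exp (2 / \<eta>))))"
  have a: "0 < a" "a \<le> 1 / 2" using \<eta> d0 K by (auto simp: a_def)
  have "a\<^sup>2 \<le> (sqrt (\<eta> * d0 / (2 * K * exp (2 / \<eta>))))\<^sup>2" using a by (intro power_mono) (auto simp: a_def)
  also have "\<dots> = \<eta> * d0 / (2 * K * exp (2 / \<eta>))" using \<eta> d0 K by simp
  finally have "a\<^sup>2 * (2 * K * exp (2 / \<eta>)) \<le> \<eta> * d0" using K by (simp add: pos_le_divide_eq)
  then have a3: "2 * a\<^sup>2 * K * exp (2 / \<eta>) \<le> \<eta> * c\<^sup>2" using c by (simp add: mult_ac)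
  define \<theta> where "\<theta> = \<iota> * a / 48"
  have \<theta>: "0 < \<theta>" "\<theta> * (3 / a) \<le> \<iota> / 16" using \<iota> a by (auto simp: \<theta>_def)
  define L where "L = max 0 (- ln (\<theta> * \<iota> / 32))"
  have L0: "0 \<le> L" by (simp add: L_def)
  have "exp (- L) \<le> exp (ln (\<theta> * \<iota> / 32))" by (simp add: L_def)
  also have "\<dots> = \<theta> * \<iota> / 32" using \<theta> \<iota> by simp
  finally have L: "2 * exp (- L) / \<theta> \<le> \<iota> / 16" using \<theta> by (simp add: pos_divide_le_eq mult.commute)
  define P where "P = L + 1"
  have P: "0 < P" "L \<le> P" using L0 by (auto simp: P_def)
  define \<delta> where "\<delta> = \<iota> / (64 * P)"
  have \<delta>: "0 < \<delta>" using \<iota> P by (simp add: \<delta>_def)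
  have "L * (4 * \<delta>) \<le> P * (4 * \<delta>)" using \<delta> P by (intro mult_right_mono) auto
  also have "\<dots> = \<iota> / 16" using P by (simp add: \<delta>_def)
  finally have \<delta>2: "L * (4 * \<delta>) \<le> \<iota> / 16" .
  show ?thesis
    by (rule exI[of _ a], rule exI[of _ c], rule exI[of _ \<eta>], rule exI[of _ \<xi>], rule exI[of _ \<rho>],
        rule exI[of _ \<iota>], rule exI[of _ \<theta>], rule exI[of _ L], rule exI[of _ \<delta>],
        intro conjI c(1,2) \<xi>(1) less_imp_le[OF \<xi>(2)] \<rho>(3)[unfolded b1_def] \<iota> \<eta> a a3 \<theta> L0 L \<delta> \<delta>2)
qed

text \<open>The three summands in front of \<open>Y\<close> get the same share
  \<open>h = R / (6 * Y)\<close>. This determines \<omega>, which determines \<beta>, and that fixes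
  \<gamma>; \<open>r\<close> comes last, since every condition on it is an upper bound.\<close>

lemma ex_structured_constants:
  fixes q K \<delta> \<kappa> R Y :: real
  assumes q: "0 < q" and K: "1 \<le> K" and \<delta>: "0 < \<delta>" and \<kappa>: "0 < \<kappa>" and R: "0 < R" and Y: "0 < Y"
  shows "\<exists>\<omega> \<beta> \<gamma> r :: real. (0 < \<omega> \<and> \<omega> \<le> 1) \<and> (0 \<le> \<beta> \<and> 0 < \<gamma> \<and> 3 * \<gamma> * \<beta> \<le> 1) \<and>
    (0 < r \<and> 32 * r \<le> \<gamma> \<and> 32 * r \<le> \<delta> * q * K) \<and>
    2 * (sqrt (32 * r / (\<delta> * q * K)) + 2 * \<omega> + exp (- \<beta> * (q / 2) * \<omega>\<^sup>2 / 40)) * Y \<le> R \<and>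
    128 * r * (2 / \<kappa> + 2)\<^sup>2 \<le> \<delta>\<^sup>2 * q"
proof -
  define h where "h = R / (6 * Y)"
  have h: "0 < h" using R Y by (simp add: h_def)
  define \<omega> where "\<omega> = min 1 (h / 2)"
  have \<omega>: "0 < \<omega>" "\<omega> \<le> 1" "2 * \<omega> \<le> h" using h by (auto simp: \<omega>_def)
  define \<beta> where "\<beta> = max 0 (- ln h * 80 / (q * \<omega>\<^sup>2))"
  have \<beta>: "0 \<le> \<beta>" by (simp add: \<beta>_def)
  have e: "exp (- \<beta> * (q / 2) * \<omega>\<^sup>2 / 40) \<le> h"
  proof -
    have w: "0 < q * \<omega>\<^sup>2" using q \<omega> by simp
    have "- ln h * 80 / (q * \<omega>\<^sup>2) \<le> \<beta>" by (simp add: \<beta>_def)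
    then have "- ln h * 80 \<le> \<beta> * (q * \<omega>\<^sup>2)" using w by (simp only: pos_divide_le_eq)
    then have "- \<beta> * (q / 2) * \<omega>\<^sup>2 / 40 \<le> ln h" by (simp add: mult_ac)
    then have "exp (- \<beta> * (q / 2) * \<omega>\<^sup>2 / 40) \<le> exp (ln h)" by (simp only: exp_le_cancel_iff)
    then show ?thesis using h by simp
  qed
  define \<gamma> where "\<gamma> = 1 / (3 * (\<beta> + 1))"
  have \<gamma>: "0 < \<gamma>" "3 * \<gamma> * \<beta> \<le> 1" using \<beta> by (auto simp: \<gamma>_def)
  have S: "0 < \<delta> * q * K" using \<delta> q K by simp
  define r where "r = Min {\<gamma> / 32, \<delta> * q * K / 32, \<delta> * q * K / 32 * h\<^sup>2, \<delta>\<^sup>2 * q / (128 * (2 / \<kappa> + 2)\<^sup>2)}"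
  have k2: "0 < (2 / \<kappa> + 2)\<^sup>2" using \<kappa> by (intro zero_less_power) (simp add: add_pos_pos)
  have r0: "0 < r" unfolding r_def using \<gamma> S h \<delta> q k2 by (subst Min_gr_iff) auto
  have r: "r \<le> \<gamma> / 32" "r \<le> \<delta> * q * K / 32" "r \<le> \<delta> * q * K / 32 * h\<^sup>2" "r \<le> \<delta>\<^sup>2 * q / (128 * (2 / \<kappa> + 2)\<^sup>2)"
    unfolding r_def by (rule Min_le; simp)+
  have s: "sqrt (32 * r / (\<delta> * q * K)) \<le> h"
  proof (rule real_le_lsqrt)
    show "32 * r / (\<delta> * q * K) \<le> h\<^sup>2" using r(3) S by (simp add: pos_divide_le_eq mult_ac)
  qed (use h in auto)
  have "2 * (sqrt (32 * r / (\<delta> * q * K)) + 2 * \<omega> + exp (- \<beta> * (q / 2) * \<omega>\<^sup>2 / 40)) * Y \<le> 2 * (h + h + h) * Y"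
    using s \<omega> e Y by (intro mult_right_mono mult_left_mono add_mono) auto
  also have "\<dots> = R" using Y by (simp add: h_def)
  finally have 1: "2 * (sqrt (32 * r / (\<delta> * q * K)) + 2 * \<omega> + exp (- \<beta> * (q / 2) * \<omega>\<^sup>2 / 40)) * Y \<le> R" .
  have "r * (128 * (2 / \<kappa> + 2)\<^sup>2) \<le> \<delta>\<^sup>2 * q" using r(4) k2 by (subst (asm) pos_le_divide_eq) auto
  then have 2: "128 * r * (2 / \<kappa> + 2)\<^sup>2 \<le> \<delta>\<^sup>2 * q" by (simp add: mult_ac)
  show ?thesis
    using \<omega> \<beta> \<gamma> r0 r 1 2
    by (intro exI[of _ \<omega>] exI[of _ \<beta>] exI[of _ \<gamma>] exI[of _ r]) auto
qed

text \<open>Two outcomes are separated on purpose: \<omega> fixes the normal vectors of the other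
  columns, \<omega>' resamples column \<open>j\<close>. Since \<open>v\<close> is quantified after
  \<open>E\<close>, the estimate holds for all normal vectors at once, however chosen; Fubini later
  merges the two outcomes.\<close>

theorem ex_small_ball_constants:
  fixes K b :: real
  assumes K: "1 \<le> K" and b: "b < 1"
  shows "\<exists>r>0. \<exists>C>0. \<exists>c>0. \<exists>n0. \<forall>(M :: 'w measure) X n j. random_columns M X n K b \<longrightarrow> n0 \<le> real n \<longrightarrow>
    j < n \<longrightarrow> (\<Sum>k<n. \<integral>\<omega>. (X j k \<omega>)\<^sup>2 \<partial>M) \<le> r * (real n)\<^sup>2 \<longrightarrow>
    (\<exists>E\<in>sets M. measure M E \<le> exp (- c * real n) \<and> (\<forall>\<omega>\<in>space M - E. \<forall>v.
      (\<Sum>k<n. (v k)\<^sup>2) = 1 \<longrightarrow> (\<forall>i<n. i \<noteq> j \<longrightarrow> (\<Sum>k<n. v k * X i k \<omega>) = 0) \<longrightarrow>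
      (\<forall>u. \<forall>\<epsilon>\<ge>0. measure M {\<omega>' \<in> space M. \<bar>(\<Sum>k<n. v k * X j k \<omega>') - u\<bar> < \<epsilon>} \<le> C * \<epsilon> + exp (- c * real n))))"
proof -
  define q where "q = (1 - b) / 2"
  have q: "0 < q" using b by (simp add: q_def)
  define dd where "dd = 1 - exp (- (1 - b) / 1920)"
  have dd: "0 < dd" "dd \<le> 1" using b by (auto simp: dd_def)
  obtain a c \<eta> \<xi> \<rho> \<iota> \<theta> L \<delta> :: real where
    c: "0 < c" "c\<^sup>2 \<le> dd" and \<xi>: "0 < \<xi>" "\<xi> \<le> 1" and \<rho>: "(2 - dd) / (2 - dd / 2) + \<xi> \<le> \<rho>"
    and \<iota>: "\<rho> = exp (- \<iota>)" "0 < \<iota>" and \<eta>: "0 < \<eta>" "2 * \<eta> * ln (1 / \<xi>) \<le> \<iota> / 4"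
    and a: "0 < a" "a \<le> 1 / 2" "2 * a\<^sup>2 * K * exp (2 / \<eta>) \<le> \<eta> * c\<^sup>2"
    and \<theta>: "0 < \<theta>" "\<theta> * (3 / a) \<le> \<iota> / 16" and L: "0 \<le> L" "2 * exp (- L) / \<theta> \<le> \<iota> / 16"
    and \<delta>: "0 < \<delta>" "L * (4 * \<delta>) \<le> \<iota> / 16"
    using ex_compressible_constants[OF dd K] by (elim exE conjE) (rule that)
  define \<kappa> where "\<kappa> = a * \<delta>"
  have \<kappa>: "0 < \<kappa>" using a \<delta> by (simp add: \<kappa>_def)
  define \<Gamma> where "\<Gamma> = 1 + 6 * sqrt K"
  define \<alpha> where "\<alpha> = \<delta> * q * (\<kappa> / 2)\<^sup>2 / 16"
  define C0 where "C0 = 20 * (2 / sqrt (\<alpha> / 2) + 1)"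
  define \<Lambda> where "\<Lambda> = 10 + ln (\<Gamma> * C0)"
  have \<alpha>: "0 < \<alpha>" unfolding \<alpha>_def using \<delta> q \<kappa> by simp
  have \<Gamma>: "1 \<le> \<Gamma>" using K by (simp add: \<Gamma>_def)
  have C0: "20 \<le> C0" using \<alpha> by (simp add: C0_def)
  have sK: "0 < sqrt K" using K by simp
  have R: "0 < \<Gamma> * exp (- 4 * \<Lambda> / \<delta>)" using \<Gamma> by simp
  have Y: "0 < sqrt K * (8 / sqrt \<delta> + 6)" using sK \<delta> by (intro mult_pos_pos add_pos_pos) auto
  obtain \<omega> \<beta> \<gamma> r :: real where \<omega>: "0 < \<omega>" "\<omega> \<le> 1" and \<beta>: "0 \<le> \<beta>" "0 < \<gamma>" "3 * \<gamma> * \<beta> \<le> 1"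
    and r: "0 < r" "32 * r \<le> \<gamma>" "32 * r \<le> \<delta> * q * K"
    and small: "2 * (sqrt (32 * r / (\<delta> * q * K)) + 2 * \<omega> + exp (- \<beta> * (q / 2) * \<omega>\<^sup>2 / 40)) * (sqrt K * (8 / sqrt \<delta> + 6))
      \<le> \<Gamma> * exp (- 4 * \<Lambda> / \<delta>)"
    and r2: "128 * r * (2 / \<kappa> + 2)\<^sup>2 \<le> \<delta>\<^sup>2 * q"
    using ex_structured_constants[OF q K \<delta>(1) \<kappa> R Y] by (elim exE conjE) (rule that)
  define g where "g = nat \<lceil>1 + K / r\<rceil>"
  have Kr: "0 \<le> K / r" using K r by simp
  have g: "1 + K / r \<le> real g" unfolding g_def using Kr by linarith
  have g1: "1 \<le> real g" using g Kr by linarith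
  \<comment> \<open>The rate of the largest frequency exp(c3 n): \<gamma> / 32 keeps it below
    exp(\<gamma> n / 32), and 1 / (2 g) keeps its g-th power below exp n.\<close>
  define c3 where "c3 = min (\<gamma> / 32) (1 / (2 * real g))"
  have c3: "0 < c3" "c3 \<le> \<gamma> / 32" "c3 \<le> 1 / (2 * real g)" "c3 \<le> 1 / 2"
  proof -
    show "0 < c3" "c3 \<le> \<gamma> / 32" "c3 \<le> 1 / (2 * real g)" using \<beta> g1 by (auto simp: c3_def)
    moreover have "1 / (2 * real g) \<le> 1 / 2" using g1 by simp
    ultimately show "c3 \<le> 1 / 2" by linarith
  qed
  \<comment> \<open>Half of \<open>c3\<close> absorbs the prefactor 4 C0, and \<iota> / 4 leaves
    room under the rate \<iota> / 2 of the compressible event; \<open>n0\<close> makes each of the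
    three exceptional events at most a third of exp(-c4 n).\<close>
  define c4 where "c4 = min (c3 / 2) (\<iota> / 4)"
  have c4: "0 < c4" "c4 \<le> c3 / 2" "c4 \<le> \<iota> / 4" "c4 \<le> 1 / 2" using c3 \<iota> by (auto simp: c4_def)
  define n0 where "n0 = Max {4, 4 + 8 / \<iota>, 2 * real g, 1 / c3, 2 * ln (4 * C0) / c3}"
  have n0: "4 \<le> n0" "4 + 8 / \<iota> \<le> n0" "2 * real g \<le> n0" "1 / c3 \<le> n0" "2 * ln (4 * C0) / c3 \<le> n0"
    unfolding n0_def by (rule Max_ge; simp)+
  have C1: "0 < 2 * C0" using C0 by simp
  show ?thesis
  proof (rule exI[of _ r], rule conjI[OF r(1)], rule exI[of _ "2 * C0"], rule conjI[OF C1],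
      rule exI[of _ c4], rule conjI[OF c4(1)], rule exI[of _ n0], intro allI impI)
    fix M :: "'w measure" and X n j
    assume rc: "random_columns M X n K b" and nn: "n0 \<le> real n" and j: "j < n"
      and mom: "(\<Sum>k<n. \<integral>\<omega>. (X j k \<omega>)\<^sup>2 \<partial>M) \<le> r * (real n)\<^sup>2"
    interpret random_columns M X n K b by (rule rc)
    have d0eq: "d0 = dd" unfolding d0_def dd_def ..
    have flat_j: "flat r j" using mom j by (simp add: flat_def mom_def)
    \<comment> \<open>Chosen so that the last frequency \<open>Dm\<close> lies between exp(c3 n) / 2
      and exp(c3 n).\<close>
    define Lmax where "Lmax = nat \<lfloor>sqrt (real n) * exp (c3 * real n)\<rfloor>"
    define Dm where "Dm = real Lmax / sqrt (real n)"
    have sn: "1 \<le> sqrt (real n)" using n by simp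
    have c3n: "1 \<le> c3 * real n"
    proof -
      have "1 / c3 \<le> real n" using n0(4) nn by linarith
      then show ?thesis using c3(1) by (simp add: pos_divide_le_eq mult.commute)
    qed
    have e2: "2 \<le> exp (c3 * real n)" using exp_ge_add_one_self[of "c3 * real n"] c3n by linarith
    have p0: "0 \<le> sqrt (real n) * exp (c3 * real n)" by simp
    have Lub: "real Lmax \<le> sqrt (real n) * exp (c3 * real n)" unfolding Lmax_def using p0 by (simp add: of_nat_floor)
    have Llb: "sqrt (real n) * exp (c3 * real n) - 1 \<le> real Lmax" unfolding Lmax_def using p0 by linarith
    have Dub: "Dm \<le> exp (c3 * real n)" unfolding Dm_def using Lub sn by (simp add: pos_divide_le_eq mult.commute)
    have Dlb: "exp (c3 * real n) / 2 \<le> Dm"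
    proof -
      have "1 * 1 \<le> sqrt (real n) * (exp (c3 * real n) / 2)" using sn e2 by (intro mult_mono) auto
      then have "sqrt (real n) * (exp (c3 * real n) / 2) \<le> real Lmax" using Llb by simp
      then show ?thesis unfolding Dm_def using sn by (simp add: pos_le_divide_eq mult.commute)
    qed
    have Dm0: "0 < Dm" using Dlb e2 by linarith
    have Dexp: "Dm \<le> exp (\<gamma> / 16 * real n / 2)"
    proof -
      have "c3 * real n \<le> \<gamma> / 32 * real n" using c3 by (intro mult_right_mono) auto
      then have "exp (c3 * real n) \<le> exp (\<gamma> / 16 * real n / 2)" by simp
      then show ?thesis using Dub by linarith
    qed
    have Dln: "real g * ln (Dm + 1) \<le> real n"
    proof -
      have "Dm + 1 \<le> exp (c3 * real n) * exp 1"
      proof -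
        have "Dm + 1 \<le> exp (c3 * real n) * 2" using Dub e2 by linarith
        also have "\<dots> \<le> exp (c3 * real n) * exp 1"
          using exp_ge_add_one_self[of 1] by (intro mult_left_mono) auto
        finally show ?thesis .
      qed
      then have "ln (Dm + 1) \<le> ln (exp (c3 * real n + 1))"
        using Dm0 unfolding exp_add by (subst ln_le_cancel_iff) (auto intro: mult_pos_pos)
      then have "ln (Dm + 1) \<le> c3 * real n + 1" by simp
      then have "real g * ln (Dm + 1) \<le> real g * (c3 * real n + 1)" by (intro mult_left_mono) auto
      also have "\<dots> = (real g * c3) * real n + real g" by (simp add: algebra_simps)
      also have "\<dots> \<le> 1 / 2 * real n + 1 / 2 * real n"
      proof (rule add_mono)
        have "real g * c3 \<le> real g * (1 / (2 * real g))" using c3 by (intro mult_left_mono) auto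
        also have "\<dots> = 1 / 2" using g1 by simp
        finally show "real g * c3 * real n \<le> 1 / 2 * real n" by (intro mult_right_mono) auto
        show "real g \<le> 1 / 2 * real n" using n0(3) nn by linarith
      qed
      finally show ?thesis by simp
    qed
    have Lexp: "real Lmax \<le> exp (real n)"
    proof -
      have "sqrt (real n) \<le> exp (real n / 2)"
      proof -
        have "real n \<le> exp (real n)" using exp_ge_add_one_self[of "real n"] by linarith
        then have "sqrt (real n) \<le> sqrt (exp (real n))" by simp
        also have "sqrt (exp (real n)) = exp (real n / 2)"
          by (rule real_sqrt_unique) (auto simp: power2_eq_square exp_add[symmetric])
        finally show ?thesis .
      qed
      moreover have "exp (c3 * real n) \<le> exp (real n / 2)"
        using mult_right_mono[OF c3(4), of "real n"] by simp
      ultimately have "sqrt (real n) * exp (c3 * real n) \<le> exp (real n / 2) * exp (real n / 2)"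
        by (intro mult_mono) auto
      also have "\<dots> = exp (real n)" by (simp add: exp_add[symmetric])
      finally show ?thesis using Lub by linarith
    qed
    define E1 where "E1 = {\<omega> \<in> space M. exp (2 * real n) \<le> (\<Prod>i<n. w2 i \<omega>)}"
    have E1m: "E1 \<in> events"
    proof -
      have [measurable]: "w2 i \<in> borel_measurable M" if "i \<in> {..<n}" for i
        unfolding w2_def[abs_def] using that
        by (intro borel_measurable_add borel_measurable_const borel_measurable_divide borel_measurable_sum
            borel_measurable_power X_measurable) auto
      show ?thesis unfolding E1_def by measurable
    qed
    have E1p: "prob E1 \<le> exp (- real n)" unfolding E1_def by (rule prob_prod_w2_le)
    obtain E2 where E2: "E2 \<in> events" "prob E2 \<le> exp (\<iota> - \<iota> * real n / 2)"
      "\<And>\<omega> v. \<omega> \<in> space M - E2 \<Longrightarrow> (\<Prod>i<n. w2 i \<omega>) < exp (2 * real n) \<Longrightarrow> (\<Sum>k<n. (v k)\<^sup>2) = 1 \<Longrightarrow>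
        (\<forall>i<n. i \<noteq> j \<longrightarrow> Z v i \<omega> = 0) \<Longrightarrow> \<delta> * real n \<le> card {k. k < n \<and> \<kappa> / sqrt (real n) \<le> \<bar>v k\<bar>}"
      using ex_compressible_event[OF j c[folded d0eq] \<xi> \<rho>[folded d0eq] \<iota> \<eta> a \<theta> L \<delta>] unfolding \<kappa>_def by blast
    obtain E3 where E3: "E3 \<in> events" "prob E3 \<le> exp (- real n)"
      "\<And>\<omega> v s i. \<omega> \<in> space M - E3 \<Longrightarrow> (\<Prod>i<n. w2 i \<omega>) < exp (2 * real n) \<Longrightarrow> (\<Sum>k<n. (v k)\<^sup>2) = 1 \<Longrightarrow>
        (\<forall>i<n. i \<noteq> j \<longrightarrow> Z v i \<omega> = 0) \<Longrightarrow> \<delta> * real n \<le> card {k. k < n \<and> \<kappa> / sqrt (real n) \<le> \<bar>v k\<bar>} \<Longrightarrow>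
        flat r i \<Longrightarrow> 0 \<le> s \<Longrightarrow> s \<le> Dm \<Longrightarrow> \<alpha> * s\<^sup>2 \<le> Psi i v s \<or> \<gamma> / 16 * real n \<le> Psi i v s"
      using ex_structured_event[OF j \<delta>(1) \<kappa> \<omega> \<beta> r(1,2) r(3)[unfolded q_def] small[unfolded \<Lambda>_def C0_def \<alpha>_def \<Gamma>_def q_def]
        r2[unfolded q_def] g Dexp[unfolded Dm_def] Dln[unfolded Dm_def] Lexp]
      unfolding \<alpha>_def q_def Dm_def by blast
    show "\<exists>E\<in>events. prob E \<le> exp (- c4 * real n) \<and> (\<forall>\<omega>\<in>space M - E. \<forall>v.
      (\<Sum>k<n. (v k)\<^sup>2) = 1 \<longrightarrow> (\<forall>i<n. i \<noteq> j \<longrightarrow> (\<Sum>k<n. v k * X i k \<omega>) = 0) \<longrightarrow>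
      (\<forall>u. \<forall>\<epsilon>\<ge>0. prob {\<omega>' \<in> space M. \<bar>(\<Sum>k<n. v k * X j k \<omega>') - u\<bar> < \<epsilon>} \<le> 2 * C0 * \<epsilon> + exp (- c4 * real n)))"
    proof (intro bexI[of _ "E1 \<union> (E2 \<union> E3)"] conjI ballI allI impI)
      show "E1 \<union> (E2 \<union> E3) \<in> events" using E1m E2 E3 by auto
      have "prob (E1 \<union> (E2 \<union> E3)) \<le> prob E1 + (prob E2 + prob E3)"
        using E1m E2 E3 by (intro order_trans[OF measure_Un_le] add_left_mono measure_Un_le) auto
      also have "\<dots> \<le> exp (- c4 * real n) / 3 + (exp (- c4 * real n) / 3 + exp (- c4 * real n) / 3)"
      proof -
        have e3: "3 \<le> exp (2 :: real)" using exp_ge_add_one_self[of 2] by simp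
        have "exp (- real n) \<le> exp (- c4 * real n - 2)"
        proof -
          have "c4 * real n \<le> 1 / 2 * real n" using c4 by (intro mult_right_mono) auto
          then have "- real n \<le> - c4 * real n - 2" using n0(1) nn by linarith
          then show ?thesis by (simp only: exp_le_cancel_iff)
        qed
        moreover have "exp (\<iota> - \<iota> * real n / 2) \<le> exp (- c4 * real n - 2)"
        proof -
          have "c4 * real n \<le> \<iota> / 4 * real n" using c4 by (intro mult_right_mono) auto
          moreover have "\<iota> * (4 + 8 / \<iota>) \<le> \<iota> * real n" using n0(2) nn \<iota> by (intro mult_left_mono) auto
          then have "4 * \<iota> + 8 \<le> \<iota> * real n" using \<iota> by (simp add: distrib_left)
          ultimately have "\<iota> - \<iota> * real n / 2 \<le> - c4 * real n - 2" by linarith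
          then show ?thesis by (simp only: exp_le_cancel_iff)
        qed
        moreover have "exp (- c4 * real n - 2) \<le> exp (- c4 * real n) / 3"
          unfolding exp_diff using e3 by (intro divide_left_mono) auto
        ultimately show ?thesis using E1p E2(2) E3(2) by linarith
      qed
      finally show "prob (E1 \<union> (E2 \<union> E3)) \<le> exp (- c4 * real n)" by simp
    next
      fix \<omega>' v u \<epsilon>
      assume w: "\<omega>' \<in> space M - (E1 \<union> (E2 \<union> E3))" and v: "(\<Sum>k<n. (v k)\<^sup>2) = 1"
        and ker: "\<forall>i<n. i \<noteq> j \<longrightarrow> (\<Sum>k<n. v k * X i k \<omega>') = 0" and \<epsilon>: "0 \<le> (\<epsilon>::real)"
      have w1: "(\<Prod>i<n. w2 i \<omega>') < exp (2 * real n)" using w by (auto simp: E1_def)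
      have kerZ: "\<forall>i<n. i \<noteq> j \<longrightarrow> Z v i \<omega>' = 0" using ker by (simp add: Z_def)
      have sp: "\<delta> * real n \<le> card {k. k < n \<and> \<kappa> / sqrt (real n) \<le> \<bar>v k\<bar>}"
        by (rule E2(3)[OF _ w1 v kerZ]) (use w in auto)
      have Ps: "\<alpha> * s\<^sup>2 \<le> Psi j v s \<or> \<gamma> / 16 * real n \<le> Psi j v s" if "0 \<le> s" "s \<le> Dm" for s
        by (rule E3(3)[OF _ w1 v kerZ sp flat_j that]) (use w in auto)
      have "prob {\<omega> \<in> space M. \<bar>Z v j \<omega> - u\<bar> < \<epsilon>} \<le> 2 * (20 * (2 / sqrt (\<alpha> / 2) + 1)) * (\<epsilon> + 1 / Dm)"
        by (rule prob_ball_le_cauchy[OF j \<alpha> Dm0 Dexp \<epsilon> Ps])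
      also have "\<dots> = 2 * C0 * \<epsilon> + 2 * C0 * (1 / Dm)" unfolding C0_def[symmetric] by (rule distrib_left)
      also have "2 * C0 * (1 / Dm) \<le> exp (- c4 * real n)"
      proof -
        have "1 / Dm \<le> 1 / (exp (c3 * real n) / 2)" using Dlb Dm0 by (intro divide_left_mono) auto
        then have "2 * C0 * (1 / Dm) \<le> 2 * C0 * (1 / (exp (c3 * real n) / 2))" using C0 by (intro mult_left_mono) auto
        also have "\<dots> = exp (ln (4 * C0)) * exp (- (c3 * real n))" using C0 by (simp add: exp_minus field_simps)
        also have "\<dots> = exp (ln (4 * C0) - c3 * real n)" by (simp only: exp_add[symmetric] diff_conv_add_uminus)
        also have "\<dots> \<le> exp (- c4 * real n)"
        proof -
          have "2 * ln (4 * C0) / c3 \<le> real n" using n0(5) nn by linarith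
          then have "2 * ln (4 * C0) \<le> c3 * real n" using c3(1) by (simp add: pos_divide_le_eq mult.commute)
          moreover have "c4 * real n \<le> c3 / 2 * real n" using c4 by (intro mult_right_mono) auto
          ultimately have "ln (4 * C0) - c3 * real n \<le> - c4 * real n" by linarith
          then show ?thesis by simp
        qed
        finally show ?thesis .
      qed
      finally show "prob {\<omega>' \<in> space M. \<bar>(\<Sum>k<n. v k * X j k \<omega>') - u\<bar> < \<epsilon>} \<le> 2 * C0 * \<epsilon> + exp (- c4 * real n)"
        by (simp add: Z_def)
    qed
  qed
qed

section \<open>Random subspaces spanned by columns\<close>

lemma vec_norm_eq: "x \<in> carrier_vec n \<Longrightarrow> vec_norm x = sqrt (\<Sum>k<n. (x $ k)\<^sup>2)"
  by (simp add: vec_norm_def scalar_prod_def power2_eq_square atLeast0LessThan)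

text \<open>Coefficients are indexed by column numbers, whereas linear combinations of a set of
  vectors would merge equal columns. Hence one inclusion goes through closure under the module
  operations and the other by induction on the index set. The result parametrises the span by
  \<open>nat \<Rightarrow> real\<close>, a separable space.\<close>

lemma other_cols_span_eq:
  fixes B :: "real mat"
  assumes B: "B \<in> carrier_mat n n"
  shows "other_cols_span n B j = range (\<lambda>c. vec n (\<lambda>k. \<Sum>i\<in>{..<n} - {j}. c i * B $$ (k, i)))"
proof -
  interpret vec_space "TYPE(real)" n .
  let ?I = "{..<n} - {j}"
  define S where "S = {col B i |i. i < n \<and> i \<noteq> j}"
  define lc where "lc = (\<lambda>c I. vec n (\<lambda>k. \<Sum>i\<in>I. c i * B $$ (k, i)))"
  have S: "S \<subseteq> carrier_vec n" using B by (auto simp: S_def)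
  have sp: "other_cols_span n B j = span S" by (simp add: other_cols_span_def vec_span_def S_def)
  have "submodule class_ring (range (\<lambda>c. lc c ?I)) V"
  proof (rule LinearCombinations.submodule.intro)
    show "Module.module class_ring V" by unfold_locales
    show "range (\<lambda>c. lc c ?I) \<subseteq> carrier V" by (auto simp: lc_def)
    show "\<zero>\<^bsub>V\<^esub> \<in> range (\<lambda>c. lc c ?I)"
      by (rule image_eqI[of _ _ "\<lambda>_. 0"]) (auto simp: lc_def)
    fix x y assume "x \<in> range (\<lambda>c. lc c ?I)" "y \<in> range (\<lambda>c. lc c ?I)"
    then obtain c d where "x = lc c ?I" "y = lc d ?I" by blast
    then have "x \<oplus>\<^bsub>V\<^esub> y = lc (\<lambda>i. c i + d i) ?I"
      by (intro eq_vecI) (auto simp: lc_def sum.distrib distrib_right)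
    then show "x \<oplus>\<^bsub>V\<^esub> y \<in> range (\<lambda>c. lc c ?I)" by blast
  next
    fix a :: real and x assume "a \<in> carrier class_ring" and x: "x \<in> range (\<lambda>c. lc c ?I)"
    from x obtain c where "x = lc c ?I" by blast
    then have "a \<odot>\<^bsub>V\<^esub> x = lc (\<lambda>i. a * c i) ?I"
      by (intro eq_vecI) (auto simp: lc_def sum_distrib_left mult.assoc)
    then show "a \<odot>\<^bsub>V\<^esub> x \<in> range (\<lambda>c. lc c ?I)" by blast
  qed
  moreover have "S \<subseteq> range (\<lambda>c. lc c ?I)"
  proof
    fix x assume "x \<in> S"
    then obtain i where i: "i < n" "i \<noteq> j" "x = col B i" by (auto simp: S_def)
    have "(\<Sum>i'\<in>?I. (if i' = i then 1 else 0) * B $$ (k, i')) = B $$ (k, i)" for k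
      using i by (subst sum.cong[OF refl, of _ _ "\<lambda>i'. if i' = i then B $$ (k, i) else 0"]) auto
    then have "x = lc (\<lambda>i'. if i' = i then 1 else 0) ?I"
      using i B by (intro eq_vecI) (auto simp: lc_def)
    then show "x \<in> range (\<lambda>c. lc c ?I)" by blast
  qed
  ultimately have 1: "span S \<subseteq> range (\<lambda>c. lc c ?I)" by (rule span_is_subset[rotated])
  have "lc c I \<in> span S" if "finite I" "I \<subseteq> ?I" for c I
    using that
  proof (induction I rule: finite_induct)
    case empty
    have "lc c {} = 0\<^sub>v n" by (auto simp: lc_def)
    moreover have "0\<^sub>v n \<in> span S"
    proof (rule in_spanI)
      show "0\<^sub>v n = lincomb (\<lambda>_. 0) {}" by (simp add: lincomb_def)
    qed auto
    ultimately show ?case by (simp only:)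
  next
    case (insert i I)
    then have i: "i < n" "i \<noteq> j" by auto
    have "col B i \<in> span S" using S i by (intro subsetD[OF in_own_span[OF S]]) (auto simp: S_def)
    then have "c i \<cdot>\<^sub>v col B i \<in> span S" by (rule smult_in_span[OF S])
    moreover have "lc c I \<in> span S" using insert by auto
    ultimately have "c i \<cdot>\<^sub>v col B i + lc c I \<in> span S" by (rule span_add1[OF S])
    moreover have "c i \<cdot>\<^sub>v col B i + lc c I = lc c (insert i I)"
      using insert B i by (intro eq_vecI) (auto simp: lc_def)
    ultimately show ?case by simp
  qed
  then have "lc c ?I \<in> span S" for c by simp
  then have "range (\<lambda>c. lc c ?I) \<subseteq> span S" by auto
  with 1 show ?thesis unfolding sp lc_def by blast
qed

text \<open>The matrix with rows \<open>a i\<close> and row \<open>j\<close> replaced by 0 is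
  singular; a kernel vector is normalised.\<close>

lemma ex_unit_orthogonal:
  fixes a :: "nat \<Rightarrow> nat \<Rightarrow> real"
  assumes j: "j < n"
  shows "\<exists>v :: nat \<Rightarrow> real. (\<Sum>k<n. (v k)\<^sup>2) = 1 \<and> (\<forall>i<n. i \<noteq> j \<longrightarrow> (\<Sum>k<n. v k * a i k) = 0)"
proof -
  define P where "P = mat\<^sub>r n n (\<lambda>i. if i = j then 0\<^sub>v n else vec n (a i))"
  have P: "P \<in> carrier_mat n n" by (simp add: P_def)
  have "det P = 0" unfolding P_def by (rule det_row_0[OF j]) auto
  then obtain w where w: "w \<in> carrier_vec n" "w \<noteq> 0\<^sub>v n" "P *\<^sub>v w = 0\<^sub>v n"
    using det_0_iff_vec_prod_zero_field[OF P] by blast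
  define s where "s = (\<Sum>k<n. (w $ k)\<^sup>2)"
  have "s \<noteq> 0"
  proof
    assume "s = 0"
    then have "\<forall>k<n. w $ k = 0" unfolding s_def by (subst (asm) sum_nonneg_eq_0_iff) auto
    then have "w = 0\<^sub>v n" using w(1) by (intro eq_vecI) auto
    then show False using w(2) by simp
  qed
  moreover have "0 \<le> s" unfolding s_def by (intro sum_nonneg) auto
  ultimately have s: "0 < s" by simp
  define v where "v = (\<lambda>k. w $ k / sqrt s)"
  have "(\<Sum>k<n. (v k)\<^sup>2) = s / s" unfolding v_def power_divide using s by (simp add: sum_divide_distrib[symmetric] s_def)
  then have 1: "(\<Sum>k<n. (v k)\<^sup>2) = 1" using s by simp
  have "(\<Sum>k<n. v k * a i k) = 0" if i: "i < n" "i \<noteq> j" for i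
  proof -
    have "0 = (P *\<^sub>v w) $ i" using w(3) i by simp
    also have "\<dots> = (\<Sum>k<n. a i k * w $ k)"
      using i w(1) P by (simp add: scalar_prod_def P_def atLeast0LessThan)
    finally have "(\<Sum>k<n. w $ k * a i k) = 0" by (simp add: mult.commute)
    then show ?thesis unfolding v_def by (simp add: sum_divide_distrib[symmetric])
  qed
  with 1 show ?thesis by blast
qed

text \<open>Every event of \<open>V\<close> is an event of \<open>U\<close>, so independence passes
  on by inclusion of \<sigma>-fields, without writing \<open>V\<close> as a function of
  \<open>U\<close>.\<close>

lemma (in prob_space) indep_var_vimage_algebra:
  assumes ind: "indep_var N U T W" and V: "V \<in> measurable (vimage_algebra (space M) U N) S"
  shows "indep_var S V T W"
proof -
  have U: "random_variable N U" and W: "random_variable T W"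
    and iset: "indep_set (sigma_sets (space M) {U -` A \<inter> space M | A. A \<in> sets N}) (sigma_sets (space M) {W -` A \<inter> space M | A. A \<in> sets T})"
    using ind unfolding indep_var_eq by auto
  have sub: "sets (vimage_algebra (space M) U N) \<subseteq> events"
    unfolding sets_vimage_algebra using U by (intro sets.sigma_sets_subset) (auto intro: measurable_sets)
  have Vm: "random_variable S V"
  proof (rule measurableI)
    show "V x \<in> space S" if "x \<in> space M" for x using measurable_space[OF V] that by simp
    show "V -` A \<inter> space M \<in> events" if "A \<in> sets S" for A
      using measurable_sets[OF V that] sub by auto
  qed
  have "sigma_sets (space M) {V -` A \<inter> space M | A. A \<in> sets S} \<subseteq> sigma_sets (space M) {U -` A \<inter> space M | A. A \<in> sets N}"
  proof (rule sigma_sets_mono)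
    show "{V -` A \<inter> space M |A. A \<in> sets S} \<subseteq> sigma_sets (space M) {U -` A \<inter> space M |A. A \<in> sets N}"
    proof
      fix B assume "B \<in> {V -` A \<inter> space M |A. A \<in> sets S}"
      then obtain A where A: "A \<in> sets S" "B = V -` A \<inter> space M" by blast
      have "B \<in> sets (vimage_algebra (space M) U N)" using measurable_sets[OF V A(1)] A(2) by simp
      then show "B \<in> sigma_sets (space M) {U -` A \<inter> space M |A. A \<in> sets N}"
        unfolding sets_vimage_algebra .
    qed
  qed
  then have "indep_set (sigma_sets (space M) {V -` A \<inter> space M | A. A \<in> sets S}) (sigma_sets (space M) {W -` A \<inter> space M | A. A \<in> sets T})"
    using iset unfolding indep_set_def by (elim indep_sets_mono_sets) (auto split: bool.split)
  then show ?thesis unfolding indep_var_eq using Vm W by blast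
qed

text \<open>Fubini for independent \<open>V\<close> and \<open>W\<close>: a bound for the sections of \<open>Q\<close> at the typical
  values of \<open>V\<close> bounds the probability that \<open>(V, W) \<in> Q\<close>.\<close>

lemma (in prob_space) prob_indep_pair_le:
  assumes ind: "indep_var S V T W" and Q: "Q \<in> sets (S \<Otimes>\<^sub>M T)" and E: "E \<in> events" and \<beta>: "0 \<le> \<beta>"
    and sec: "AE \<omega> in M. \<omega> \<notin> E \<longrightarrow> prob {\<omega>' \<in> space M. (V \<omega>, W \<omega>') \<in> Q} \<le> \<beta>"
  shows "prob {\<omega> \<in> space M. (V \<omega>, W \<omega>) \<in> Q} \<le> \<beta> + prob E"
proof -
  have V [measurable]: "random_variable S V" and W [measurable]: "random_variable T W"
    using ind unfolding indep_var_eq by auto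
  interpret dT: prob_space "distr M T W" by (rule prob_space_distr[OF W])
  have eq: "distr M S V \<Otimes>\<^sub>M distr M T W = distr M (S \<Otimes>\<^sub>M T) (\<lambda>x. (V x, W x))"
    using ind unfolding indep_var_distribution_eq by blast
  have Q': "Q \<in> sets (distr M S V \<Otimes>\<^sub>M distr M T W)" using Q by (simp add: eq)
  have "emeasure M {\<omega> \<in> space M. (V \<omega>, W \<omega>) \<in> Q} = emeasure (distr M S V \<Otimes>\<^sub>M distr M T W) Q"
    unfolding eq using Q by (subst emeasure_distr) (auto intro!: arg_cong[where f = "emeasure M"])
  also have "\<dots> = (\<integral>\<^sup>+x. emeasure (distr M T W) (Pair x -` Q) \<partial>distr M S V)"
    by (rule dT.emeasure_pair_measure_alt[OF Q'])
  also have "\<dots> = (\<integral>\<^sup>+\<omega>. emeasure (distr M T W) (Pair (V \<omega>) -` Q) \<partial>M)"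
  proof (rule nn_integral_distr[OF V])
    show "(\<lambda>x. emeasure (distr M T W) (Pair x -` Q)) \<in> borel_measurable (distr M S V)"
      by (rule dT.measurable_emeasure_Pair[OF Q'])
  qed
  also have "\<dots> \<le> (\<integral>\<^sup>+\<omega>. ennreal \<beta> + indicator E \<omega> \<partial>M)"
  proof (rule nn_integral_mono_AE)
    show "AE \<omega> in M. emeasure (distr M T W) (Pair (V \<omega>) -` Q) \<le> ennreal \<beta> + indicator E \<omega>"
      using sec AE_space
    proof eventually_elim
      case (elim \<omega>)
      have "Pair (V \<omega>) -` Q \<in> sets T" using Q by (rule sets_Pair1)
      then have "emeasure (distr M T W) (Pair (V \<omega>) -` Q) = emeasure M {\<omega>' \<in> space M. (V \<omega>, W \<omega>') \<in> Q}"
        by (subst emeasure_distr) (auto intro!: arg_cong[where f = "emeasure M"])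
      also have "\<dots> = ennreal (prob {\<omega>' \<in> space M. (V \<omega>, W \<omega>') \<in> Q})" by (simp add: emeasure_eq_measure)
      also have "\<dots> \<le> ennreal \<beta> + indicator E \<omega>"
      \<comment> \<open>On \<open>E\<close> the section is bounded trivially by 1; integrating the
        indicator gives the summand \<open>prob E\<close>.\<close>
      proof (cases "\<omega> \<in> E")
        case True
        have "ennreal (prob {\<omega>' \<in> space M. (V \<omega>, W \<omega>') \<in> Q}) \<le> 1"
          using ennreal_leI[OF prob_le_1] by simp
        also have "\<dots> \<le> ennreal \<beta> + indicator E \<omega>" using True by simp
        finally show ?thesis .
      next
        case False
        then show ?thesis using elim(1) by (simp add: ennreal_leI)
      qed
      finally show ?case .
    qed
  qed
  also have "\<dots> = ennreal \<beta> + emeasure M E"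
    using E by (subst nn_integral_add) (auto simp: emeasure_space_1)
  also have "\<dots> = ennreal (\<beta> + prob E)" using \<beta> by (simp add: emeasure_eq_measure ennreal_plus)
  finally show ?thesis
    using \<beta> by (simp add: emeasure_eq_measure ennreal_plus[symmetric] del: ennreal_plus)
qed

text \<open>Moves open sets of vectors to the product topology on
  \<open>nat \<Rightarrow> real\<close>; only the leading \<open>n\<close> coordinates are
  constrained.\<close>

lemma vec_open_imp_open:
  assumes "vec_open n O'"
  shows "open {f :: nat \<Rightarrow> real. vec n f \<in> O'}"
proof (subst open_subopen, rule ballI)
  fix f assume "f \<in> {f. vec n f \<in> O'}"
  then have "vec n f \<in> O'" by simp
  then obtain e where e: "0 < e" "\<And>y. y \<in> carrier_vec n \<Longrightarrow> vec_norm (y - vec n f) < e \<Longrightarrow> y \<in> O'"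
    using assms unfolding vec_open_def by blast
  let ?T = "{g :: nat \<Rightarrow> real. sqrt (\<Sum>k<n. (g k - f k)\<^sup>2) < e}"
  have "open ?T" by (intro open_Collect_less continuous_intros continuous_on_product_coordinates)
  moreover have "f \<in> ?T" using e by simp
  moreover have "?T \<subseteq> {f. vec n f \<in> O'}"
  proof
    fix g assume g: "g \<in> ?T"
    have "vec_norm (vec n g - vec n f) = sqrt (\<Sum>k<n. ((vec n g - vec n f) $ k)\<^sup>2)"
      by (rule vec_norm_eq) simp
    also have "(\<Sum>k<n. ((vec n g - vec n f) $ k)\<^sup>2) = (\<Sum>k<n. (g k - f k)\<^sup>2)" by (intro sum.cong) auto
    finally have "vec_norm (vec n g - vec n f) < e" using g by simp
    then show "g \<in> {f. vec n f \<in> O'}" using e(2)[of "vec n g"] by simp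
  qed
  ultimately show "\<exists>T. open T \<and> f \<in> T \<and> T \<subseteq> {f. vec n f \<in> O'}" by blast
qed

text \<open>Linear combinations depend continuously on their coefficients, so the span hits an open
  set if and only if a combination with coefficients from a countable dense set does. The generating
  events are thus countable unions of events of the other columns.\<close>

lemma sets_subspace_sigma_subset:
  fixes A :: "'w \<Rightarrow> real mat" and j n :: nat
  assumes A: "\<And>\<omega>. \<omega> \<in> space M \<Longrightarrow> A \<omega> \<in> carrier_mat n n"
  defines "B \<equiv> {..<n} \<times> ({..<n} - {j})"
  shows "sets (subspace_sigma M n (\<lambda>\<omega>. other_cols_span n (A \<omega>) j))
    \<subseteq> sets (vimage_algebra (space M) (\<lambda>\<omega>. \<lambda>p\<in>B. A \<omega> $$ p) (PiM B (\<lambda>_. borel)))"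
proof -
  let ?U = "\<lambda>\<omega>. \<lambda>p\<in>B. A \<omega> $$ p" and ?I = "{..<n} - {j}"
  let ?VA = "vimage_algebra (space M) ?U (PiM B (\<lambda>_. borel))"
  obtain D :: "(nat \<Rightarrow> real) set" where D: "countable D" "\<And>X. open X \<Longrightarrow> X \<noteq> {} \<Longrightarrow> \<exists>d\<in>D. d \<in> X"
    by (rule countable_dense_setE) blast
  \<comment> \<open>Extended by 0 beyond \<open>n\<close>, to be a continuous map into the space
    where the preimage of the open set is open.\<close>
  define F where "F = (\<lambda>q (u :: nat \<times> nat \<Rightarrow> real) k. if k < n then \<Sum>i\<in>?I. q i * u (k, i) else 0)"
  have gen: "{\<omega> \<in> space M. other_cols_span n (A \<omega>) j \<inter> O' \<noteq> {}} \<in> sets ?VA" if O': "vec_open n O'" for O'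
  proof -
    define U0 where "U0 = {f :: nat \<Rightarrow> real. vec n f \<in> O'}"
    have U0: "open U0" unfolding U0_def by (rule vec_open_imp_open[OF O'])
    have "{\<omega> \<in> space M. other_cols_span n (A \<omega>) j \<inter> O' \<noteq> {}} = {\<omega> \<in> space M. \<exists>q\<in>D. F q (?U \<omega>) \<in> U0}"
    proof (intro Collect_cong conj_cong refl)
      fix \<omega> assume \<omega>: "\<omega> \<in> space M"
      have FU: "F q (?U \<omega>) k = (if k < n then \<Sum>i\<in>?I. q i * A \<omega> $$ (k, i) else 0)" for q k
        unfolding F_def B_def by auto
      have v: "vec n (F q (?U \<omega>)) = vec n (\<lambda>k. \<Sum>i\<in>?I. q i * A \<omega> $$ (k, i))" for q
        by (intro eq_vecI) (auto simp: FU)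
      have hit: "other_cols_span n (A \<omega>) j \<inter> O' \<noteq> {} \<longleftrightarrow> (\<exists>q. F q (?U \<omega>) \<in> U0)"
        unfolding other_cols_span_eq[OF A[OF \<omega>]] U0_def mem_Collect_eq v by blast
      have "open {q. F q (?U \<omega>) \<in> U0}"
      proof -
        have "continuous_on UNIV (\<lambda>q. F q (?U \<omega>))"
        proof (rule continuous_on_coordinatewise_then_product)
          fix k
          show "continuous_on UNIV (\<lambda>q. F q (?U \<omega>) k)"
            unfolding FU by (cases "k < n") (auto intro!: continuous_intros continuous_on_product_coordinates)
        qed
        from open_vimage[OF U0 this] show ?thesis by (simp add: vimage_def)
      qed
      then show "(other_cols_span n (A \<omega>) j \<inter> O' \<noteq> {}) = (\<exists>q\<in>D. F q (?U \<omega>) \<in> U0)"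
        unfolding hit using D(2)[of "{q. F q (?U \<omega>) \<in> U0}"] by blast
    qed
    also have "\<dots> = ?U -` {u \<in> space (PiM B (\<lambda>_. borel)). \<exists>q\<in>D. F q u \<in> U0} \<inter> space M"
      by (auto simp: space_PiM)
    also have "\<dots> \<in> sets ?VA"
    proof (rule in_vimage_algebra)
      have m: "(\<lambda>u. F q u) \<in> measurable (PiM B (\<lambda>_. borel)) borel" for q
      proof -
        have "(\<lambda>u. F q u) \<in> measurable (PiM B (\<lambda>_. borel)) (PiM UNIV (\<lambda>_. borel :: real measure))"
        proof (rule measurable_PiM_single')
          fix k :: nat
          show "(\<lambda>u. F q u k) \<in> borel_measurable (PiM B (\<lambda>_. borel))"
          proof (cases "k < n")
            case True
            have "(\<lambda>u. \<Sum>i\<in>?I. q i * u (k, i)) \<in> borel_measurable (PiM B (\<lambda>_. borel))"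
              using True by (intro borel_measurable_sum borel_measurable_times borel_measurable_const measurable_component_singleton) (auto simp: B_def)
            then show ?thesis using True by (simp add: F_def)
          qed (simp add: F_def)
        qed auto
        then show ?thesis using measurable_cong_sets[OF refl sets_PiM_equal_borel] by blast
      qed
      have "{u \<in> space (PiM B (\<lambda>_. borel)). F q u \<in> U0} \<in> sets (PiM B (\<lambda>_. borel))" for q
        using measurable_sets[OF m borel_open[OF U0]] by (simp add: vimage_def Collect_conj_eq Int_commute)
      then have "(\<Union>q\<in>D. {u \<in> space (PiM B (\<lambda>_. borel)). F q u \<in> U0}) \<in> sets (PiM B (\<lambda>_. borel))"
        using D(1) by (intro sets.countable_UN') auto
      also have "(\<Union>q\<in>D. {u \<in> space (PiM B (\<lambda>_. borel)). F q u \<in> U0}) = {u \<in> space (PiM B (\<lambda>_. borel)). \<exists>q\<in>D. F q u \<in> U0}" by auto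
      finally show "{u \<in> space (PiM B (\<lambda>_. borel)). \<exists>q\<in>D. F q u \<in> U0} \<in> sets (PiM B (\<lambda>_. borel))" .
    qed
    finally show ?thesis .
  qed
  have "sets (subspace_sigma M n (\<lambda>\<omega>. other_cols_span n (A \<omega>) j))
    = sigma_sets (space M) {{\<omega> \<in> space M. other_cols_span n (A \<omega>) j \<inter> O' \<noteq> {}} |O'. vec_open n O'}"
    unfolding subspace_sigma_def by (rule sets_measure_of) auto
  also have "\<dots> \<subseteq> sets ?VA"
    using sets.sigma_sets_subset[of "{{\<omega> \<in> space M. other_cols_span n (A \<omega>) j \<inter> O' \<noteq> {}} |O'. vec_open n O'}" ?VA] gen by auto
  finally show ?thesis .
qed

section \<open>From the hypotheses on the matrix to independent columns and distances\<close>

lemma concentration_ge: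
  assumes "prob_space M"
  shows "measure M {\<omega> \<in> space M. \<bar>Z \<omega> - u\<bar> < t} \<le> concentration M Z t"
proof -
  interpret prob_space M by fact
  show ?thesis unfolding concentration_def
    by (rule cSUP_upper) (auto intro!: bdd_aboveI[of _ 1])
qed

lemma concentration_le:
  assumes "\<And>u. measure M {\<omega> \<in> space M. \<bar>Z \<omega> - u\<bar> < t} \<le> B"
  shows "concentration M Z t \<le> B"
  unfolding concentration_def by (rule cSUP_least) (use assms in auto)

lemma integrable_sum_of_nn_integral_le:
  fixes f :: "'i \<Rightarrow> 'a \<Rightarrow> real"
  assumes fin: "finite I" and m: "\<And>i. i \<in> I \<Longrightarrow> f i \<in> borel_measurable M" and nn: "\<And>i x. 0 \<le> f i x"
    and le: "(\<Sum>i\<in>I. \<integral>\<^sup>+x. ennreal (f i x) \<partial>M) \<le> ennreal B" and B: "0 \<le> B"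
  shows "\<And>i. i \<in> I \<Longrightarrow> integrable M (f i)" and "(\<Sum>i\<in>I. \<integral>x. f i x \<partial>M) \<le> B"
proof -
  show int: "integrable M (f i)" if i: "i \<in> I" for i
  proof (rule integrableI_nonneg[OF m[OF i]])
    have "(\<integral>\<^sup>+x. ennreal (f i x) \<partial>M) \<le> (\<Sum>i\<in>I. \<integral>\<^sup>+x. ennreal (f i x) \<partial>M)"
      using fin i by (intro member_le_sum) auto
    also have "\<dots> < \<infinity>" using le by (metis ennreal_less_top infinity_ennreal_def order_le_less_trans)
    finally show "(\<integral>\<^sup>+x. ennreal (f i x) \<partial>M) < \<infinity>" .
  qed (use nn in auto)
  have "ennreal (\<Sum>i\<in>I. \<integral>x. f i x \<partial>M) = (\<Sum>i\<in>I. ennreal (\<integral>x. f i x \<partial>M))"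
    by (rule sum_ennreal[symmetric]) (use nn in \<open>auto intro: Bochner_Integration.integral_nonneg\<close>)
  also have "\<dots> = (\<Sum>i\<in>I. \<integral>\<^sup>+x. ennreal (f i x) \<partial>M)"
    by (intro sum.cong refl nn_integral_eq_integral[symmetric] int) (use nn in auto)
  also note le
  finally show "(\<Sum>i\<in>I. \<integral>x. f i x \<partial>M) \<le> B" by (simp only: ennreal_le_iff[OF B])
qed

text \<open>The locale numbers entries by column and row, so the family is transposed; taking
  \<open>max K 1\<close> only weakens the moment bound and ensures the locale's normalisation of
  \<open>K\<close>.\<close>

lemma random_columns_of_matrix:
  fixes M :: "'w measure" and A :: "'w \<Rightarrow> real mat"
  assumes M: "prob_space M" and n: "0 < n" and b: "b < 1" and K: "0 < K"
    and ind: "prob_space.indep_vars M (\<lambda>_. borel) (\<lambda>(i, j) \<omega>. A \<omega> $$ (i, j)) ({..<n} \<times> {..<n})"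
    and tot: "(\<Sum>i<n. \<Sum>j<n. \<integral>\<^sup>+\<omega>. ennreal ((A \<omega> $$ (i, j))\<^sup>2) \<partial>M) \<le> ennreal (K * (real n)\<^sup>2)"
    and conc: "\<forall>i<n. \<forall>j<n. concentration M (\<lambda>\<omega>. A \<omega> $$ (i, j)) 1 \<le> b"
  shows "random_columns M (\<lambda>i k \<omega>. A \<omega> $$ (k, i)) n (max K 1) b"
proof -
  interpret prob_space M by fact
  have meas: "(\<lambda>\<omega>. A \<omega> $$ (k, i)) \<in> borel_measurable M" if "i < n" "k < n" for i k
  proof -
    have "(case (k, i) of (i, j) \<Rightarrow> \<lambda>\<omega>. A \<omega> $$ (i, j)) \<in> borel_measurable M"
      using ind that unfolding indep_vars_def by blast
    then show ?thesis by simp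
  qed
  let ?J = "{..<n} \<times> {..<n}"
  let ?f = "\<lambda>p \<omega>. (A \<omega> $$ (fst p, snd p))\<^sup>2"
  have "(\<Sum>p\<in>?J. \<integral>\<^sup>+\<omega>. ennreal (?f p \<omega>) \<partial>M) \<le> ennreal (K * (real n)\<^sup>2)"
    using tot by (simp add: sum.cartesian_product case_prod_unfold)
  note sums = integrable_sum_of_nn_integral_le[OF _ _ _ this]
  have int: "integrable M (?f p)" if "p \<in> ?J" for p
    by (rule sums(1)[OF _ _ _ _ that]) (use meas K in auto)
  have "(\<Sum>p\<in>?J. \<integral>\<omega>. ?f p \<omega> \<partial>M) \<le> K * (real n)\<^sup>2"
    by (rule sums(2)) (use meas K in auto)
  then have "(\<Sum>i<n. \<Sum>k<n. \<integral>\<omega>. (A \<omega> $$ (i, k))\<^sup>2 \<partial>M) \<le> K * (real n)\<^sup>2"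
    by (simp add: sum.cartesian_product case_prod_unfold)
  then have le: "(\<Sum>i<n. \<Sum>k<n. \<integral>\<omega>. (A \<omega> $$ (k, i))\<^sup>2 \<partial>M) \<le> K * (real n)\<^sup>2"
    by (subst sum.swap)
  have "K * (real n)\<^sup>2 \<le> max K 1 * (real n)\<^sup>2" by (intro mult_right_mono) auto
  then have le': "(\<Sum>i<n. \<Sum>k<n. \<integral>\<omega>. (A \<omega> $$ (k, i))\<^sup>2 \<partial>M) \<le> max K 1 * (real n)\<^sup>2" using le by linarith
  have 1: "indep_vars (\<lambda>p. PiM {prod.swap p} (\<lambda>_. borel))
      (\<lambda>p \<omega>. restrict (\<lambda>q. (case q of (i, j) \<Rightarrow> \<lambda>\<omega>. A \<omega> $$ (i, j)) \<omega>) {prod.swap p}) ?J"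
    by (rule indep_vars_restrict[OF ind]) (auto simp: disjoint_family_on_def)
  have "indep_vars (\<lambda>_. borel) (\<lambda>p \<omega>. (\<lambda>f. f (prod.swap p))
      (restrict (\<lambda>q. (case q of (i, j) \<Rightarrow> \<lambda>\<omega>. A \<omega> $$ (i, j)) \<omega>) {prod.swap p})) ?J"
    by (rule indep_vars_compose2[OF 1]) (auto intro: measurable_component_singleton)
  then have ind': "indep_vars (\<lambda>_. borel) (\<lambda>(i, k). \<lambda>\<omega>. A \<omega> $$ (k, i)) ?J"
    by (simp add: case_prod_unfold prod.swap_def)
  have cc: "prob {\<omega> \<in> space M. \<bar>A \<omega> $$ (k, i) - u\<bar> < 1} \<le> b" if "i < n" "k < n" for i k u
    using concentration_ge[OF M, of "\<lambda>\<omega>. A \<omega> $$ (k, i)" u 1] conc that by (meson order_trans)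
  show ?thesis
  proof (rule random_columns.intro[OF M], rule random_columns_axioms.intro)
    show "indep_vars (\<lambda>_. borel) (\<lambda>(i, k). \<lambda>\<omega>. A \<omega> $$ (k, i)) ?J" by (rule ind')
    show "prob {\<omega> \<in> space M. \<bar>A \<omega> $$ (k, i) - u\<bar> < 1} \<le> b" if "i < n" "k < n" for i k u by (rule cc[OF that])
    show "integrable M (\<lambda>\<omega>. (A \<omega> $$ (k, i))\<^sup>2)" if "i < n" "k < n" for i k using int[of "(k, i)"] that by simp
  qed (use le' n b in auto)
qed

text \<open>Distances to a subspace are attained up to any error by coefficient vectors from a
  countable dense set, which makes the event below measurable.\<close>

lemma measurable_near_span:
  fixes D :: "(nat \<Rightarrow> real) set" and B :: "(nat \<times> nat) set"
  assumes D: "countable D" and B: "{..<n} \<times> ({..<n} - {j}) \<subseteq> B"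
  shows "{p \<in> space (PiM B (\<lambda>_. borel) \<Otimes>\<^sub>M PiM ({..<n} \<times> {j}) (\<lambda>_. borel)). \<forall>m::nat. \<exists>q\<in>D.
      sqrt (\<Sum>k<n. (snd p (k, j) - (\<Sum>i\<in>{..<n} - {j}. q i * fst p (k, i)))\<^sup>2) < \<epsilon> + 1 / Suc m}
    \<in> sets (PiM B (\<lambda>_. borel) \<Otimes>\<^sub>M PiM ({..<n} \<times> {j}) (\<lambda>_. borel :: real measure))"
proof -
  let ?P = "PiM B (\<lambda>_. borel) \<Otimes>\<^sub>M PiM ({..<n} \<times> {j}) (\<lambda>_. borel :: real measure)"
  have [measurable]: "(\<lambda>p. sqrt (\<Sum>k<n. (snd p (k, j) - (\<Sum>i\<in>{..<n} - {j}. q i * fst p (k, i)))\<^sup>2)) \<in> borel_measurable ?P" for q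
  proof -
    have "(\<lambda>p. snd p (k, j)) \<in> borel_measurable ?P" if "k < n" for k
      by (rule measurable_compose[OF measurable_snd measurable_component_singleton]) (use that in simp)
    moreover have "(\<lambda>p. fst p (k, i)) \<in> borel_measurable ?P" if "k < n" "i \<in> {..<n} - {j}" for k i
      by (rule measurable_compose[OF measurable_fst measurable_component_singleton]) (use that B in auto)
    ultimately show ?thesis
      by (intro measurable_compose[OF _ borel_measurable_sqrt] borel_measurable_sum borel_measurable_power borel_measurable_diff
          borel_measurable_times borel_measurable_const) auto
  qed
  have 1: "{p \<in> space ?P. sqrt (\<Sum>k<n. (snd p (k, j) - (\<Sum>i\<in>{..<n} - {j}. q i * fst p (k, i)))\<^sup>2) < \<epsilon> + 1 / Suc m} \<in> sets ?P" for q m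
    by measurable
  have "{p \<in> space ?P. \<exists>q\<in>D. sqrt (\<Sum>k<n. (snd p (k, j) - (\<Sum>i\<in>{..<n} - {j}. q i * fst p (k, i)))\<^sup>2) < \<epsilon> + 1 / Suc m} \<in> sets ?P" for m
  proof -
    have "(\<Union>q\<in>D. {p \<in> space ?P. sqrt (\<Sum>k<n. (snd p (k, j) - (\<Sum>i\<in>{..<n} - {j}. q i * fst p (k, i)))\<^sup>2) < \<epsilon> + 1 / Suc m}) \<in> sets ?P"
      by (rule sets.countable_UN'[OF D]) (use 1 in auto)
    also have "(\<Union>q\<in>D. {p \<in> space ?P. sqrt (\<Sum>k<n. (snd p (k, j) - (\<Sum>i\<in>{..<n} - {j}. q i * fst p (k, i)))\<^sup>2) < \<epsilon> + 1 / Suc m})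
      = {p \<in> space ?P. \<exists>q\<in>D. sqrt (\<Sum>k<n. (snd p (k, j) - (\<Sum>i\<in>{..<n} - {j}. q i * fst p (k, i)))\<^sup>2) < \<epsilon> + 1 / Suc m}"
      by blast
    finally show ?thesis .
  qed
  then show ?thesis by (intro sets.sets_Collect_countable_All) auto
qed

text \<open>Cauchy-Schwarz after subtracting \<open>h\<close>, which \<open>v\<close> does not see.
  This is how a small distance becomes a small inner product.\<close>

lemma abs_inner_le_dist:
  fixes v w h :: "nat \<Rightarrow> real"
  assumes "(\<Sum>k<n. (v k)\<^sup>2) = 1" and "(\<Sum>k<n. v k * h k) = 0"
  shows "\<bar>\<Sum>k<n. v k * w k\<bar> \<le> sqrt (\<Sum>k<n. (w k - h k)\<^sup>2)"
proof -
  have "(\<Sum>k<n. v k * w k) = (\<Sum>k<n. v k * (w k - h k))"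
    using assms(2) by (simp add: right_diff_distrib sum_subtractf)
  moreover have "(\<Sum>k<n. v k * (w k - h k))\<^sup>2 \<le> (\<Sum>k<n. (v k)\<^sup>2) * (\<Sum>k<n. (w k - h k)\<^sup>2)"
    by (rule Cauchy_Schwarz_ineq_sum)
  ultimately have "(\<Sum>k<n. v k * w k)\<^sup>2 \<le> (\<Sum>k<n. (w k - h k)\<^sup>2)" using assms(1) by simp
  then have "sqrt ((\<Sum>k<n. v k * w k)\<^sup>2) \<le> sqrt (\<Sum>k<n. (w k - h k)\<^sup>2)" by (rule real_sqrt_le_mono)
  then show ?thesis by simp
qed

lemma orthogonal_other_cols_span_iff:
  fixes B :: "real mat"
  assumes B: "B \<in> carrier_mat n n" and v: "v \<in> carrier_vec n"
  shows "(\<forall>h\<in>other_cols_span n B j. v \<bullet> h = 0) \<longleftrightarrow>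
    (\<forall>i<n. i \<noteq> j \<longrightarrow> (\<Sum>k<n. v $ k * B $$ (k, i)) = 0)"
proof safe
  fix i assume o: "\<forall>h\<in>other_cols_span n B j. v \<bullet> h = 0" and i: "i < n" "i \<noteq> j"
  let ?h = "vec n (\<lambda>k. \<Sum>i'\<in>{..<n} - {j}. (if i' = i then 1 else 0) * B $$ (k, i'))"
  have "?h \<in> other_cols_span n B j" unfolding other_cols_span_eq[OF B]
    by (rule image_eqI[of _ _ "\<lambda>i'. if i' = i then 1 else 0"]) auto
  then have "v \<bullet> ?h = 0" using o by blast
  moreover have "(\<Sum>i'\<in>{..<n} - {j}. (if i' = i then 1 else 0) * B $$ (k, i')) = B $$ (k, i)" for k
    using i by (subst sum.cong[OF refl, of _ _ "\<lambda>i'. if i' = i then B $$ (k, i) else 0"]) auto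
  ultimately show "(\<Sum>k<n. v $ k * B $$ (k, i)) = 0"
    by (simp add: scalar_prod_def atLeast0LessThan)
next
  fix h assume o: "\<forall>i<n. i \<noteq> j \<longrightarrow> (\<Sum>k<n. v $ k * B $$ (k, i)) = 0" and h: "h \<in> other_cols_span n B j"
  obtain c where c: "h = vec n (\<lambda>k. \<Sum>i\<in>{..<n} - {j}. c i * B $$ (k, i))"
    using h unfolding other_cols_span_eq[OF B] by blast
  have "v \<bullet> h = (\<Sum>k<n. \<Sum>i\<in>{..<n} - {j}. c i * (v $ k * B $$ (k, i)))"
    by (simp add: c scalar_prod_def atLeast0LessThan sum_distrib_left mult_ac)
  also have "\<dots> = (\<Sum>i\<in>{..<n} - {j}. c i * (\<Sum>k<n. v $ k * B $$ (k, i)))"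
    by (subst sum.swap) (simp add: sum_distrib_left)
  also have "\<dots> = 0" using o by (intro sum.neutral) auto
  finally show "v \<bullet> h = 0" .
qed

text \<open>Both bounds are Fubini over the other columns and column \<open>j\<close>. A given
  \<open>v\<close> is independent of column \<open>j\<close> because the \<sigma>-field of the span
  lies in that of the other columns; for the distance no random normal vector has to be chosen
  measurably.\<close>

theorem ex_distance_bound:
  fixes K b :: real
  assumes K: "0 < K" and b: "b < 1"
  shows "\<exists>r>0. \<exists>C>0. \<exists>c>0. distance_bound TYPE('w) K b r C c"
proof -
  have K1: "1 \<le> max K 1" by simp
  obtain r C c n0 where r: "0 < r" and C: "0 < C" and c: "0 < c"
    and core: "\<forall>(M :: 'w measure) X n j. random_columns M X n (max K 1) b \<longrightarrow> n0 \<le> real n \<longrightarrow>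
    j < n \<longrightarrow> (\<Sum>k<n. \<integral>\<omega>. (X j k \<omega>)\<^sup>2 \<partial>M) \<le> r * (real n)\<^sup>2 \<longrightarrow>
    (\<exists>E\<in>sets M. measure M E \<le> exp (- c * real n) \<and> (\<forall>\<omega>\<in>space M - E. \<forall>v.
      (\<Sum>k<n. (v k)\<^sup>2) = 1 \<longrightarrow> (\<forall>i<n. i \<noteq> j \<longrightarrow> (\<Sum>k<n. v k * X i k \<omega>) = 0) \<longrightarrow>
      (\<forall>u. \<forall>\<epsilon>\<ge>0. measure M {\<omega>' \<in> space M. \<bar>(\<Sum>k<n. v k * X j k \<omega>') - u\<bar> < \<epsilon>} \<le> C * \<epsilon> + exp (- c * real n))))"
    using ex_small_ball_constants[OF K1 b, where 'w = 'w] by (elim exE conjE) (rule that)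
  \<comment> \<open>For \<open>n\<close> below \<open>n0\<close> this makes 2 exp(-c' n) at least 1,
    so both claims are trivial there; \<open>max n0 1\<close> keeps the denominator
    positive.\<close>
  define c' where "c' = min c (ln 2 / max n0 1)"
  have c': "0 < c'" "c' \<le> c" using c by (auto simp: c'_def)
  show ?thesis
  proof (rule exI[of _ r], rule conjI[OF r], rule exI[of _ C], rule conjI[OF C], rule exI[of _ c'], rule conjI[OF c'(1)],
      unfold distance_bound_def, intro allI impI)
    fix n :: nat and M :: "'w measure" and A :: "'w \<Rightarrow> real mat" and j :: nat
    assume M: "prob_space M" and A: "\<forall>\<omega>\<in>space M. A \<omega> \<in> carrier_mat n n"
      and ind: "prob_space.indep_vars M (\<lambda>_. borel) (\<lambda>(i, j) \<omega>. A \<omega> $$ (i, j)) ({..<n} \<times> {..<n})"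
      and tot: "(\<Sum>i<n. \<Sum>j<n. \<integral>\<^sup>+\<omega>. ennreal ((A \<omega> $$ (i, j))\<^sup>2) \<partial>M) \<le> ennreal (K * (real n)\<^sup>2)"
      and conc: "\<forall>i<n. \<forall>j<n. concentration M (\<lambda>\<omega>. A \<omega> $$ (i, j)) 1 \<le> b"
      and j: "j < n"
      and col: "(\<integral>\<^sup>+\<omega>. ennreal ((vec_norm (col (A \<omega>) j))\<^sup>2) \<partial>M) \<le> ennreal (r * (real n)\<^sup>2)"
    interpret prob_space M by fact
    let ?H = "\<lambda>\<omega>. other_cols_span n (A \<omega>) j"
    have n: "0 < n" using j by simp
    have meas: "(\<lambda>\<omega>. A \<omega> $$ (k, i)) \<in> borel_measurable M" if "i < n" "k < n" for i k
    proof -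
      have "(case (k, i) of (i, j) \<Rightarrow> \<lambda>\<omega>. A \<omega> $$ (i, j)) \<in> borel_measurable M"
        using ind that unfolding indep_vars_def by blast
      then show ?thesis by simp
    qed
    show "(\<forall>v :: 'w \<Rightarrow> real vec. (\<forall>\<omega>\<in>space M. v \<omega> \<in> carrier_vec n) \<longrightarrow>
             (\<forall>k<n. (\<lambda>\<omega>. v \<omega> $ k) \<in> borel_measurable (subspace_sigma M n ?H)) \<longrightarrow>
             (AE \<omega> in M. vec_norm (v \<omega>) = 1) \<longrightarrow>
             (AE \<omega> in M. \<forall>h\<in>?H \<omega>. v \<omega> \<bullet> h = 0) \<longrightarrow>
             (\<forall>\<epsilon>\<ge>0. concentration M (\<lambda>\<omega>. v \<omega> \<bullet> col (A \<omega>) j) \<epsilon> \<le> C * \<epsilon> + 2 * exp (- c' * real n))) \<and>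
          (\<forall>\<epsilon>\<ge>0. measure M {\<omega> \<in> space M. vec_setdist (col (A \<omega>) j) (?H \<omega>) \<le> \<epsilon>} \<le> C * \<epsilon> + 2 * exp (- c' * real n))"
    proof (cases "n0 \<le> real n")
      case False
      have "c' * real n \<le> ln 2 / max n0 1 * max n0 1"
        using False c' by (intro mult_mono) (auto simp: c'_def)
      then have "c' * real n \<le> ln 2" by simp
      then have "- ln 2 \<le> - c' * real n" by simp
      then have "exp (- ln 2) \<le> exp (- c' * real n)" by (simp only: exp_le_cancel_iff)
      then have one: "1 \<le> 2 * exp (- c' * real n)" by (simp add: exp_minus)
      have "1 \<le> C * \<epsilon> + 2 * exp (- c' * real n)" if "0 \<le> \<epsilon>" for \<epsilon>
      proof -
        have "0 \<le> C * \<epsilon>" using C that by simp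
        then show ?thesis using one by linarith
      qed
      then show ?thesis by (auto intro!: concentration_le intro: order_trans[OF prob_le_1])
    next
      case True
      define X where "X = (\<lambda>i k \<omega>. A \<omega> $$ (k, i))"
      have rc: "random_columns M X n (max K 1) b"
        unfolding X_def by (rule random_columns_of_matrix[OF M n b K ind tot conc])
      have colX: "col (A \<omega>) j $ k = X j k \<omega>" if "\<omega> \<in> space M" "k < n" for \<omega> k
        using A that j by (auto simp: X_def)
      have colc: "col (A \<omega>) j \<in> carrier_vec n" if "\<omega> \<in> space M" for \<omega> using A that j by auto
      have mom: "(\<Sum>k<n. \<integral>\<omega>. (X j k \<omega>)\<^sup>2 \<partial>M) \<le> r * (real n)\<^sup>2"
      proof (rule integrable_sum_of_nn_integral_le(2))
        have "(\<Sum>k<n. \<integral>\<^sup>+\<omega>. ennreal ((X j k \<omega>)\<^sup>2) \<partial>M) = (\<integral>\<^sup>+\<omega>. (\<Sum>k<n. ennreal ((X j k \<omega>)\<^sup>2)) \<partial>M)"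
          using meas j by (intro nn_integral_sum[symmetric]) (auto simp: X_def)
        also have "\<dots> = (\<integral>\<^sup>+\<omega>. ennreal ((vec_norm (col (A \<omega>) j))\<^sup>2) \<partial>M)"
        proof (rule nn_integral_cong)
          fix \<omega> assume w: "\<omega> \<in> space M"
          have "(vec_norm (col (A \<omega>) j))\<^sup>2 = (\<Sum>k<n. (X j k \<omega>)\<^sup>2)"
            unfolding vec_norm_eq[OF colc[OF w]] using w by (simp add: colX sum_nonneg)
          then show "(\<Sum>k<n. ennreal ((X j k \<omega>)\<^sup>2)) = ennreal ((vec_norm (col (A \<omega>) j))\<^sup>2)"
            by (simp add: sum_ennreal)
        qed
        finally show "(\<Sum>k<n. \<integral>\<^sup>+\<omega>. ennreal ((X j k \<omega>)\<^sup>2) \<partial>M) \<le> ennreal (r * (real n)\<^sup>2)" using col by simp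
      qed (use meas j r in \<open>auto simp: X_def\<close>)
      note core_n = core[THEN spec, THEN spec, THEN spec, THEN spec, THEN mp, OF rc, THEN mp, OF True, THEN mp, OF j, THEN mp, OF mom]
      obtain E where E: "E \<in> events" "prob E \<le> exp (- c * real n)"
        and sb0: "\<forall>\<omega>\<in>space M - E. \<forall>v. (\<Sum>k<n. (v k)\<^sup>2) = 1 \<longrightarrow> (\<forall>i<n. i \<noteq> j \<longrightarrow> (\<Sum>k<n. v k * X i k \<omega>) = 0) \<longrightarrow>
          (\<forall>u. \<forall>\<epsilon>\<ge>0. prob {\<omega>' \<in> space M. \<bar>(\<Sum>k<n. v k * X j k \<omega>') - u\<bar> < \<epsilon>} \<le> C * \<epsilon> + exp (- c * real n))"
        using core_n by (elim bexE conjE) (rule that)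
      have sb: "prob {\<omega>' \<in> space M. \<bar>(\<Sum>k<n. v k * X j k \<omega>') - u\<bar> < \<epsilon>} \<le> C * \<epsilon> + exp (- c * real n)"
        if "\<omega> \<in> space M - E" "(\<Sum>k<n. (v k)\<^sup>2) = 1" "\<forall>i<n. i \<noteq> j \<longrightarrow> (\<Sum>k<n. v k * X i k \<omega>) = 0" "0 \<le> \<epsilon>" for \<omega> v u \<epsilon>
        by (rule sb0[rule_format]) (use that in auto)
      have fin: "C * \<epsilon> + exp (- c * real n) + prob E \<le> C * \<epsilon> + 2 * exp (- c' * real n)" for \<epsilon>
      proof -
        have "c' * real n \<le> c * real n" using c' by (intro mult_right_mono) auto
        then have "exp (- c * real n) \<le> exp (- c' * real n)" by simp
        then show ?thesis using E(2) by linarith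
      qed
      define B where "B = {..<n} \<times> ({..<n} - {j})"
      define U where "U = (\<lambda>\<omega>. \<lambda>p\<in>B. A \<omega> $$ p)"
      define B2 where "B2 = {..<n} \<times> {j}"
      define W where "W = (\<lambda>\<omega>. \<lambda>p\<in>B2. A \<omega> $$ p)"
      have indUW: "indep_var (PiM B (\<lambda>_. borel)) U (PiM B2 (\<lambda>_. borel)) W"
      proof -
        have "indep_var (PiM B (\<lambda>_. borel)) (\<lambda>\<omega>. restrict (\<lambda>p. (case p of (i, j) \<Rightarrow> \<lambda>\<omega>. A \<omega> $$ (i, j)) \<omega>) B)
          (PiM B2 (\<lambda>_. borel)) (\<lambda>\<omega>. restrict (\<lambda>p. (case p of (i, j) \<Rightarrow> \<lambda>\<omega>. A \<omega> $$ (i, j)) \<omega>) B2)"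
          by (rule indep_var_restrict[OF ind]) (use j in \<open>auto simp: B_def B2_def\<close>)
        then show ?thesis by (simp add: U_def W_def case_prod_unfold)
      qed
      have Ac: "A \<omega> \<in> carrier_mat n n" if "\<omega> \<in> space M" for \<omega> using A that by blast
      show ?thesis
      proof (intro conjI allI impI)
        fix v :: "'w \<Rightarrow> real vec" and \<epsilon> :: real
        assume vc: "\<forall>\<omega>\<in>space M. v \<omega> \<in> carrier_vec n"
          and vm: "\<forall>k<n. (\<lambda>\<omega>. v \<omega> $ k) \<in> borel_measurable (subspace_sigma M n ?H)"
          and v1: "AE \<omega> in M. vec_norm (v \<omega>) = 1" and vo: "AE \<omega> in M. \<forall>h\<in>?H \<omega>. v \<omega> \<bullet> h = 0"
          and \<epsilon>: "0 \<le> \<epsilon>"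
        \<comment> \<open>Indexed like the column \<open>W\<close>, so that both take values in the
          same product space.\<close>
        define V where "V = (\<lambda>\<omega>. \<lambda>p\<in>B2. v \<omega> $ fst p)"
        have spc: "space (subspace_sigma M n ?H) = space M" unfolding subspace_sigma_def by (rule space_measure_of) auto
        have Vm: "V \<in> measurable (vimage_algebra (space M) U (PiM B (\<lambda>_. borel))) (PiM B2 (\<lambda>_. borel))"
          unfolding V_def
        proof (rule measurable_restrict)
          fix p assume "p \<in> B2"
          then have m: "(\<lambda>\<omega>. v \<omega> $ fst p) \<in> borel_measurable (subspace_sigma M n ?H)" using vm by (auto simp: B2_def)
          show "(\<lambda>\<omega>. v \<omega> $ fst p) \<in> borel_measurable (vimage_algebra (space M) U (PiM B (\<lambda>_. borel)))"
          proof (rule measurableI)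
            fix S :: "real set" assume "S \<in> sets borel"
            from measurable_sets[OF m this]
            have "(\<lambda>\<omega>. v \<omega> $ fst p) -` S \<inter> space M \<in> sets (subspace_sigma M n ?H)" unfolding spc .
            then show "(\<lambda>\<omega>. v \<omega> $ fst p) -` S \<inter> space (vimage_algebra (space M) U (PiM B (\<lambda>_. borel)))
                \<in> sets (vimage_algebra (space M) U (PiM B (\<lambda>_. borel)))"
              using sets_subspace_sigma_subset[where M = M and A = A and n = n and j = j, OF Ac] unfolding U_def B_def by auto
          qed auto
        qed
        have indVW: "indep_var (PiM B2 (\<lambda>_. borel)) V (PiM B2 (\<lambda>_. borel)) W"
          by (rule indep_var_vimage_algebra[OF indUW Vm])
        show "concentration M (\<lambda>\<omega>. v \<omega> \<bullet> col (A \<omega>) j) \<epsilon> \<le> C * \<epsilon> + 2 * exp (- c' * real n)"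
        proof (rule concentration_le)
          fix u
          let ?P = "PiM B2 (\<lambda>_. borel :: real measure)"
          define Q where "Q = {p \<in> space (?P \<Otimes>\<^sub>M ?P). \<bar>(\<Sum>k<n. fst p (k, j) * snd p (k, j)) - u\<bar> < \<epsilon>}"
          have Q: "Q \<in> sets (?P \<Otimes>\<^sub>M ?P)"
          proof -
            have f: "(\<lambda>p. fst p (k, j)) \<in> borel_measurable (?P \<Otimes>\<^sub>M ?P)" if "k < n" for k
              by (rule measurable_compose[OF measurable_fst measurable_component_singleton]) (use that in \<open>simp add: B2_def\<close>)
            have s: "(\<lambda>p. snd p (k, j)) \<in> borel_measurable (?P \<Otimes>\<^sub>M ?P)" if "k < n" for k
              by (rule measurable_compose[OF measurable_snd measurable_component_singleton]) (use that in \<open>simp add: B2_def\<close>)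
            have [measurable]: "(\<lambda>p. \<Sum>k<n. fst p (k, j) * snd p (k, j)) \<in> borel_measurable (?P \<Otimes>\<^sub>M ?P)"
              using f s by (intro borel_measurable_sum borel_measurable_times) auto
            show ?thesis unfolding Q_def by measurable
          qed
          have inQ: "(V \<omega>, W \<omega>') \<in> Q \<longleftrightarrow> \<bar>(\<Sum>k<n. v \<omega> $ k * X j k \<omega>') - u\<bar> < \<epsilon>" for \<omega> \<omega>'
          proof -
            have "(V \<omega>, W \<omega>') \<in> space (?P \<Otimes>\<^sub>M ?P)" by (auto simp: V_def W_def space_pair_measure space_PiM)
            moreover have "(\<Sum>k<n. V \<omega> (k, j) * W \<omega>' (k, j)) = (\<Sum>k<n. v \<omega> $ k * X j k \<omega>')"
              by (intro sum.cong) (auto simp: V_def W_def X_def B2_def)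
            ultimately show ?thesis unfolding Q_def by simp
          qed
          have "prob {\<omega> \<in> space M. (V \<omega>, W \<omega>) \<in> Q} \<le> (C * \<epsilon> + exp (- c * real n)) + prob E"
          proof (rule prob_indep_pair_le[OF indVW Q E(1)])
            show "0 \<le> C * \<epsilon> + exp (- c * real n)" using C \<epsilon> by (intro add_nonneg_nonneg) auto
            show "AE \<omega> in M. \<omega> \<notin> E \<longrightarrow> prob {\<omega>' \<in> space M. (V \<omega>, W \<omega>') \<in> Q} \<le> C * \<epsilon> + exp (- c * real n)"
              using v1 vo AE_space
            proof eventually_elim
              case (elim \<omega>)
              have vw: "v \<omega> \<in> carrier_vec n" using vc elim by blast
              have "sqrt (\<Sum>k<n. (v \<omega> $ k)\<^sup>2) = 1" using elim(1) unfolding vec_norm_eq[OF vw] .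
              then have unit: "(\<Sum>k<n. (v \<omega> $ k)\<^sup>2) = 1" by simp
              have ker: "\<forall>i<n. i \<noteq> j \<longrightarrow> (\<Sum>k<n. v \<omega> $ k * X i k \<omega>) = 0"
                using elim(2) unfolding orthogonal_other_cols_span_iff[OF Ac[OF elim(3)] vw] X_def .
              show ?case unfolding inQ using sb[OF _ unit ker \<epsilon>] elim by auto
            qed
          qed
          also have "{\<omega> \<in> space M. (V \<omega>, W \<omega>) \<in> Q} = {\<omega> \<in> space M. \<bar>v \<omega> \<bullet> col (A \<omega>) j - u\<bar> < \<epsilon>}"
          proof (intro Collect_cong conj_cong refl)
            fix \<omega> assume w: "\<omega> \<in> space M"
            have "v \<omega> \<bullet> col (A \<omega>) j = (\<Sum>k<n. v \<omega> $ k * X j k \<omega>)"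
              using Ac[OF w] w by (simp add: scalar_prod_def atLeast0LessThan colX del: index_col)
            then show "((V \<omega>, W \<omega>) \<in> Q) = (\<bar>v \<omega> \<bullet> col (A \<omega>) j - u\<bar> < \<epsilon>)" unfolding inQ by simp
          qed
          finally show "prob {\<omega> \<in> space M. \<bar>v \<omega> \<bullet> col (A \<omega>) j - u\<bar> < \<epsilon>} \<le> C * \<epsilon> + 2 * exp (- c' * real n)"
            using fin[of \<epsilon>] by linarith
        qed
      next
        fix \<epsilon> :: real assume \<epsilon>: "0 \<le> \<epsilon>"
        obtain D :: "(nat \<Rightarrow> real) set" where D: "countable D" "\<And>X. open X \<Longrightarrow> X \<noteq> {} \<Longrightarrow> \<exists>d\<in>D. d \<in> X"
          by (rule countable_dense_setE) blast
        let ?I = "{..<n} - {j}"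
        define dst where "dst = (\<lambda>(u :: nat \<times> nat \<Rightarrow> real) (w :: nat \<times> nat \<Rightarrow> real) q. sqrt (\<Sum>k<n. (w (k, j) - (\<Sum>i\<in>?I. q i * u (k, i)))\<^sup>2))"
        define Q where "Q = {p \<in> space (PiM B (\<lambda>_. borel) \<Otimes>\<^sub>M PiM B2 (\<lambda>_. borel)). \<forall>m::nat. \<exists>q\<in>D.
          dst (fst p) (snd p) q < \<epsilon> + 1 / Suc m}"
        have Q: "Q \<in> sets (PiM B (\<lambda>_. borel) \<Otimes>\<^sub>M PiM B2 (\<lambda>_. borel :: real measure))"
          unfolding Q_def dst_def B2_def by (rule measurable_near_span[OF D(1)]) (simp add: B_def)
        have inQ: "(U \<omega>, W \<omega>') \<in> Q \<longleftrightarrow> (\<forall>m::nat. \<exists>q\<in>D. dst (U \<omega>) (W \<omega>') q < \<epsilon> + 1 / Suc m)" for \<omega> \<omega>'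
          by (auto simp: Q_def U_def W_def space_pair_measure space_PiM)
        have "prob {\<omega> \<in> space M. (U \<omega>, W \<omega>) \<in> Q} \<le> (C * \<epsilon> + exp (- c * real n)) + prob E"
        proof (rule prob_indep_pair_le[OF indUW Q E(1)])
          show "0 \<le> C * \<epsilon> + exp (- c * real n)" using C \<epsilon> by (intro add_nonneg_nonneg) auto
          show "AE \<omega> in M. \<omega> \<notin> E \<longrightarrow> prob {\<omega>' \<in> space M. (U \<omega>, W \<omega>') \<in> Q} \<le> C * \<epsilon> + exp (- c * real n)"
          proof (intro AE_I2 impI)
            fix \<omega> assume w: "\<omega> \<in> space M" "\<omega> \<notin> E"
            \<comment> \<open>Inside a section \<omega> is fixed, so any unit normal vector will
              do.\<close>
            obtain v :: "nat \<Rightarrow> real" where v: "(\<Sum>k<n. (v k)\<^sup>2) = 1" "\<forall>i<n. i \<noteq> j \<longrightarrow> (\<Sum>k<n. v k * X i k \<omega>) = 0"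
              using ex_unit_orthogonal[OF j, of "\<lambda>i k. X i k \<omega>"] by blast
            have le: "\<bar>\<Sum>k<n. v k * X j k \<omega>'\<bar> \<le> \<epsilon>" if q: "(U \<omega>, W \<omega>') \<in> Q" for \<omega>'
            proof (rule ccontr)
              assume "\<not> ?thesis"
              then have "0 < \<bar>\<Sum>k<n. v k * X j k \<omega>'\<bar> - \<epsilon>" by simp
              then obtain m :: nat where m: "1 / Suc m < \<bar>\<Sum>k<n. v k * X j k \<omega>'\<bar> - \<epsilon>"
                using nat_approx_posE by blast
              obtain q where q: "dst (U \<omega>) (W \<omega>') q < \<epsilon> + 1 / Suc m" using q unfolding inQ by blast
              let ?h = "\<lambda>k. \<Sum>i\<in>?I. q i * X i k \<omega>"
              have "(\<Sum>k<n. v k * ?h k) = (\<Sum>k<n. \<Sum>i\<in>?I. q i * (v k * X i k \<omega>))"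
                by (simp add: sum_distrib_left mult_ac)
              also have "\<dots> = (\<Sum>i\<in>?I. \<Sum>k<n. q i * (v k * X i k \<omega>))" by (rule sum.swap)
              also have "\<dots> = (\<Sum>i\<in>?I. q i * (\<Sum>k<n. v k * X i k \<omega>))" by (simp add: sum_distrib_left)
              also have "\<dots> = 0" using v(2) by (intro sum.neutral) auto
              finally have o: "(\<Sum>k<n. v k * ?h k) = 0" .
              have "dst (U \<omega>) (W \<omega>') q = sqrt (\<Sum>k<n. (X j k \<omega>' - ?h k)\<^sup>2)"
                unfolding dst_def by (intro arg_cong[where f = sqrt] sum.cong refl) (auto simp: U_def W_def X_def B_def B2_def)
              then show False using abs_inner_le_dist[OF v(1) o, of "\<lambda>k. X j k \<omega>'"] q m by linarith
            qed
            show "prob {\<omega>' \<in> space M. (U \<omega>, W \<omega>') \<in> Q} \<le> C * \<epsilon> + exp (- c * real n)"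
            \<comment> \<open>The distance event has a non-strict inequality, the small ball bound a
              strict one: the radius is enlarged by e / C, which costs \<open>e\<close>.\<close>
            proof (rule field_le_epsilon)
              fix e :: real assume e: "0 < e"
              have "prob {\<omega>' \<in> space M. (U \<omega>, W \<omega>') \<in> Q} \<le> prob {\<omega>' \<in> space M. \<bar>(\<Sum>k<n. v k * X j k \<omega>') - 0\<bar> < \<epsilon> + e / C}"
              proof (rule finite_measure_mono)
                have "0 < e / C" using e C by simp
                then show "{\<omega>' \<in> space M. (U \<omega>, W \<omega>') \<in> Q} \<subseteq> {\<omega>' \<in> space M. \<bar>(\<Sum>k<n. v k * X j k \<omega>') - 0\<bar> < \<epsilon> + e / C}"
                  using le by fastforce
                have [measurable]: "(\<lambda>\<omega>'. \<Sum>k<n. v k * X j k \<omega>') \<in> borel_measurable M"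
                  using meas j by (intro borel_measurable_sum borel_measurable_times borel_measurable_const) (auto simp: X_def)
                show "{\<omega>' \<in> space M. \<bar>(\<Sum>k<n. v k * X j k \<omega>') - 0\<bar> < \<epsilon> + e / C} \<in> events" by measurable
              qed
              also have "\<dots> \<le> C * (\<epsilon> + e / C) + exp (- c * real n)"
                by (rule sb[OF _ v]) (use w \<epsilon> e C in auto)
              also have "C * (\<epsilon> + e / C) + exp (- c * real n) = C * \<epsilon> + exp (- c * real n) + e"
                using C by (simp add: distrib_left)
              finally show "prob {\<omega>' \<in> space M. (U \<omega>, W \<omega>') \<in> Q} \<le> C * \<epsilon> + exp (- c * real n) + e" .
            qed
          qed
        qed
        moreover have "prob {\<omega> \<in> space M. vec_setdist (col (A \<omega>) j) (?H \<omega>) \<le> \<epsilon>} \<le> prob {\<omega> \<in> space M. (U \<omega>, W \<omega>) \<in> Q}"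
        proof (rule finite_measure_mono)
          have "(\<lambda>\<omega>. (U \<omega>, W \<omega>)) \<in> measurable M (PiM B (\<lambda>_. borel) \<Otimes>\<^sub>M PiM B2 (\<lambda>_. borel))"
            using indUW unfolding indep_var_eq by (intro measurable_Pair) auto
          from measurable_sets[OF this Q] show "{\<omega> \<in> space M. (U \<omega>, W \<omega>) \<in> Q} \<in> events"
            by (simp add: vimage_def Collect_conj_eq Int_commute)
          show "{\<omega> \<in> space M. vec_setdist (col (A \<omega>) j) (?H \<omega>) \<le> \<epsilon>} \<subseteq> {\<omega> \<in> space M. (U \<omega>, W \<omega>) \<in> Q}"
          proof safe
            fix \<omega> assume w: "\<omega> \<in> space M" and d: "vec_setdist (col (A \<omega>) j) (?H \<omega>) \<le> \<epsilon>"
            show "(U \<omega>, W \<omega>) \<in> Q" unfolding inQ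
            proof
              fix m :: nat
              let ?lc = "\<lambda>c. vec n (\<lambda>k. \<Sum>i\<in>?I. c i * A \<omega> $$ (k, i))"
              have norm: "vec_norm (col (A \<omega>) j - ?lc q) = dst (U \<omega>) (W \<omega>) q" for q
              proof -
                have "vec_norm (col (A \<omega>) j - ?lc q) = sqrt (\<Sum>k<n. ((col (A \<omega>) j - ?lc q) $ k)\<^sup>2)"
                  using colc[OF w] by (intro vec_norm_eq) auto
                also have "\<dots> = dst (U \<omega>) (W \<omega>) q"
                  unfolding dst_def using w
                  by (intro arg_cong[where f = sqrt] sum.cong refl) (auto simp: U_def W_def B_def B2_def colX X_def)
                finally show ?thesis .
              qed
              have "(INF y\<in>?H \<omega>. vec_norm (col (A \<omega>) j - y)) < \<epsilon> + 1 / Suc m"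
                using d unfolding vec_setdist_def by (rule le_less_trans) simp
              then have "\<exists>y\<in>?H \<omega>. vec_norm (col (A \<omega>) j - y) < \<epsilon> + 1 / Suc m"
              proof (subst (asm) cINF_less_iff)
                show "?H \<omega> \<noteq> {}" unfolding other_cols_span_eq[OF Ac[OF w]] by blast
                show "bdd_below ((\<lambda>y. vec_norm (col (A \<omega>) j - y)) ` ?H \<omega>)"
                  by (rule bdd_belowI[of _ 0]) (auto simp: vec_norm_def scalar_prod_def intro!: sum_nonneg)
              qed
              then obtain q0 where q0: "dst (U \<omega>) (W \<omega>) q0 < \<epsilon> + 1 / Suc m"
                unfolding other_cols_span_eq[OF Ac[OF w]] using norm by auto
              have "open {q. dst (U \<omega>) (W \<omega>) q < \<epsilon> + 1 / Suc m}"
                unfolding dst_def by (intro open_Collect_less continuous_intros continuous_on_product_coordinates)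
              then show "\<exists>q\<in>D. dst (U \<omega>) (W \<omega>) q < \<epsilon> + 1 / Suc m"
                using D(2)[of "{q. dst (U \<omega>) (W \<omega>) q < \<epsilon> + 1 / Suc m}"] q0 by blast
            qed
          qed
        qed
        ultimately show "prob {\<omega> \<in> space M. vec_setdist (col (A \<omega>) j) (?H \<omega>) \<le> \<epsilon>} \<le> C * \<epsilon> + 2 * exp (- c' * real n)"
          using fin[of \<epsilon>] by linarith
      qed
    qed
  qed
qed

section \<open>Change of the sample space\<close>

text \<open>The image measure on the final \<open>\<sigma>\<close>-field, so that even non-measurable events keep
  their \<open>measure\<close> under the transfer.\<close>

definition pushforward :: "'a measure \<Rightarrow> ('a \<Rightarrow> 'b) \<Rightarrow> 'b measure" where
  "pushforward M \<phi> = distr M (sigma (\<phi> ` space M) {E. E \<subseteq> \<phi> ` space M \<and> \<phi> -` E \<inter> space M \<in> sets M}) \<phi>"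

lemma sigma_algebra_pushforward:
  "sigma_algebra (\<phi> ` space M) {E. E \<subseteq> \<phi> ` space M \<and> \<phi> -` E \<inter> space M \<in> sets M}"
  unfolding sigma_algebra_iff2
proof (intro conjI ballI allI impI)
  fix E assume "E \<in> {E. E \<subseteq> \<phi> ` space M \<and> \<phi> -` E \<inter> space M \<in> sets M}"
  moreover have "\<phi> -` (\<phi> ` space M - E) \<inter> space M = space M - (\<phi> -` E \<inter> space M)" by auto
  ultimately show "\<phi> ` space M - E \<in> {E. E \<subseteq> \<phi> ` space M \<and> \<phi> -` E \<inter> space M \<in> sets M}"
    by auto
next
  fix E :: "nat \<Rightarrow> _" assume E: "range E \<subseteq> {E. E \<subseteq> \<phi> ` space M \<and> \<phi> -` E \<inter> space M \<in> sets M}"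
  have "\<phi> -` (\<Union>i. E i) \<inter> space M = (\<Union>i. \<phi> -` E i \<inter> space M)" by auto
  moreover have "(\<Union>i. \<phi> -` E i \<inter> space M) \<in> sets M"
    using E by (intro sets.countable_UN) auto
  ultimately show "(\<Union>i. E i) \<in> {E. E \<subseteq> \<phi> ` space M \<and> \<phi> -` E \<inter> space M \<in> sets M}"
    using E by auto
qed auto

lemma space_pushforward [simp]: "space (pushforward M \<phi>) = \<phi> ` space M"
  by (auto simp: pushforward_def space_measure_of_conv)

lemma sets_pushforward:
  "sets (pushforward M \<phi>) = {E. E \<subseteq> \<phi> ` space M \<and> \<phi> -` E \<inter> space M \<in> sets M}"
  unfolding pushforward_def sets_distr
  by (rule sigma_algebra.sets_measure_of_eq[OF sigma_algebra_pushforward])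

lemma measurable_pushforward: "\<phi> \<in> measurable M (pushforward M \<phi>)"
  by (rule measurableI) (auto simp: sets_pushforward)

lemma distr_pushforward: "distr M (pushforward M \<phi>) \<phi> = pushforward M \<phi>"
  by (rule trans[OF distr_cong pushforward_def[symmetric]])
     (auto simp: sets_pushforward sigma_algebra.sets_measure_of_eq[OF sigma_algebra_pushforward])

text \<open>The universal property of the final \<sigma>-field.\<close>

lemma measurable_from_pushforward:
  assumes f: "(\<lambda>\<omega>. f (\<phi> \<omega>)) \<in> measurable M L"
  shows "f \<in> measurable (pushforward M \<phi>) L"
proof (rule measurableI)
  show "f x \<in> space L" if "x \<in> space (pushforward M \<phi>)" for x
    using that measurable_space[OF f] by auto
  show "f -` S \<inter> space (pushforward M \<phi>) \<in> sets (pushforward M \<phi>)" if "S \<in> sets L" for S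
  proof -
    have "\<phi> -` (f -` S \<inter> \<phi> ` space M) \<inter> space M = (\<lambda>\<omega>. f (\<phi> \<omega>)) -` S \<inter> space M" by auto
    then show ?thesis using measurable_sets[OF f that] by (simp add: sets_pushforward)
  qed
qed

text \<open>If the event is not measurable, neither is its preimage, and \<open>measure\<close> is 0
  on both sides.\<close>

lemma measure_pushforward:
  "measure (pushforward M \<phi>) {f \<in> space (pushforward M \<phi>). P f} = measure M {\<omega> \<in> space M. P (\<phi> \<omega>)}"
proof -
  let ?E = "{f \<in> space (pushforward M \<phi>). P f}"
  have eq: "\<phi> -` ?E \<inter> space M = {\<omega> \<in> space M. P (\<phi> \<omega>)}" by auto
  show ?thesis
  proof (cases "?E \<in> sets (pushforward M \<phi>)")
    case True
    then show ?thesis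
      using measure_distr[OF measurable_pushforward True] by (simp only: distr_pushforward eq)
  next
    case False
    then have "{\<omega> \<in> space M. P (\<phi> \<omega>)} \<notin> sets M" unfolding eq[symmetric] by (auto simp: sets_pushforward)
    then show ?thesis using False by (simp add: measure_notin_sets)
  qed
qed

text \<open>The event is a union of fibres of \<phi>, so once measurable in \<open>M\<close> it
  descends to an event of the image.\<close>

lemma AE_pushforward:
  assumes "{\<omega> \<in> space M. P (\<phi> \<omega>)} \<in> sets M" and AE: "AE \<omega> in M. P (\<phi> \<omega>)"
  shows "AE f in pushforward M \<phi>. P f"
proof -
  have "\<phi> -` {f \<in> \<phi> ` space M. P f} \<inter> space M = {\<omega> \<in> space M. P (\<phi> \<omega>)}" by auto
  then have "{f \<in> space (pushforward M \<phi>). P f} \<in> sets (pushforward M \<phi>)"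
    using assms(1) by (auto simp: sets_pushforward)
  from AE_distr_iff[OF measurable_pushforward this] AE show ?thesis by (simp only: distr_pushforward)
qed

lemma concentration_pushforward:
  assumes "\<And>\<omega>. \<omega> \<in> space M \<Longrightarrow> Z' (\<phi> \<omega>) = Z \<omega>"
  shows "concentration (pushforward M \<phi>) Z' t = concentration M Z t"
proof -
  have "{\<omega> \<in> space M. \<bar>Z' (\<phi> \<omega>) - u\<bar> < t} = {\<omega> \<in> space M. \<bar>Z \<omega> - u\<bar> < t}" for u
    using assms by auto
  then show ?thesis unfolding concentration_def measure_pushforward by simp
qed

lemma nn_integral_pushforward:
  assumes "\<And>\<omega>. \<omega> \<in> space M \<Longrightarrow> g' (\<phi> \<omega>) = g \<omega>" and g: "g \<in> borel_measurable M"
  shows "(\<integral>\<^sup>+f. g' f \<partial>pushforward M \<phi>) = (\<integral>\<^sup>+\<omega>. g \<omega> \<partial>M)"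
proof -
  have "(\<lambda>\<omega>. g' (\<phi> \<omega>)) \<in> borel_measurable M" using assms by (simp cong: measurable_cong)
  then have "g' \<in> borel_measurable (distr M (pushforward M \<phi>) \<phi>)"
    unfolding distr_pushforward by (rule measurable_from_pushforward)
  from nn_integral_distr[OF measurable_pushforward this]
  show ?thesis unfolding distr_pushforward using assms(1) by (simp cong: nn_integral_cong)
qed

text \<open>For a nonempty index set, independence says that the joint law is the product of the
  marginals, and \<phi> preserves all these laws.\<close>

lemma (in prob_space) indep_vars_pushforward:
  assumes I: "I \<noteq> {}" and eq: "\<And>i \<omega>. i \<in> I \<Longrightarrow> \<omega> \<in> space M \<Longrightarrow> X' i (\<phi> \<omega>) = X i \<omega>"
    and ind: "indep_vars N X I"
  shows "prob_space.indep_vars (pushforward M \<phi>) N X' I"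
proof -
  interpret P: prob_space "pushforward M \<phi>"
    using prob_space_distr[OF measurable_pushforward] by (simp add: distr_pushforward)
  have X: "X i \<in> measurable M (N i)" if "i \<in> I" for i using ind that unfolding indep_vars_def by blast
  have "(\<lambda>\<omega>. X' i (\<phi> \<omega>)) \<in> measurable M (N i)" if "i \<in> I" for i
    using X[OF that] eq[OF that] by (simp cong: measurable_cong)
  then have X': "X' i \<in> measurable (pushforward M \<phi>) (N i)" if "i \<in> I" for i
    using that by (intro measurable_from_pushforward)
  have d: "distr (pushforward M \<phi>) (N i) (X' i) = distr M (N i) (X i)" if "i \<in> I" for i
  proof -
    have "distr (pushforward M \<phi>) (N i) (X' i) = distr M (N i) (X' i \<circ> \<phi>)"
      using distr_distr[OF X'[OF that] measurable_pushforward] by (simp add: distr_pushforward)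
    also have "\<dots> = distr M (N i) (X i)" using eq[OF that] by (intro distr_cong) auto
    finally show ?thesis .
  qed
  have "(\<lambda>f. \<lambda>i\<in>I. X' i f) \<in> measurable (pushforward M \<phi>) (PiM I N)" by (rule measurable_restrict) (rule X')
  from distr_distr[OF this measurable_pushforward]
  have "distr (pushforward M \<phi>) (PiM I N) (\<lambda>f. \<lambda>i\<in>I. X' i f) = distr M (PiM I N) ((\<lambda>f. \<lambda>i\<in>I. X' i f) \<circ> \<phi>)"
    by (simp add: distr_pushforward)
  also have "\<dots> = distr M (PiM I N) (\<lambda>\<omega>. \<lambda>i\<in>I. X i \<omega>)"
    using eq by (intro distr_cong) (auto simp: restrict_def)
  also have "\<dots> = PiM I (\<lambda>i. distr M (N i) (X i))"
    using indep_vars_iff_distr_eq_PiM'[where I = I and M' = N and X = X] I X ind by blast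
  also have "\<dots> = PiM I (\<lambda>i. distr (pushforward M \<phi>) (N i) (X' i))" by (rule PiM_cong) (auto simp: d)
  finally show ?thesis using P.indep_vars_iff_distr_eq_PiM'[where I = I and M' = N and X = X'] I X' by blast
qed


text \<open>The matrix is recovered from its sequence of entries, so the problem can be posed on the
  image in \<open>nat \<Rightarrow> real\<close>. The point to check is that \<open>v\<close>
  descends: being measurable for the \<sigma>-field of the span, it is constant on the fibres of
  \<phi>.\<close>

lemma distance_bound_transfer:
  assumes bound: "distance_bound TYPE(nat \<Rightarrow> real) K b r C c"
  shows "distance_bound TYPE('w) K b r C c"
  unfolding distance_bound_def
proof (intro allI impI)
  fix n :: nat and M :: "'w measure" and A :: "'w \<Rightarrow> real mat" and j :: nat
  assume M: "prob_space M" and A: "\<forall>\<omega>\<in>space M. A \<omega> \<in> carrier_mat n n"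
    and ind: "prob_space.indep_vars M (\<lambda>_. borel) (\<lambda>(i, j) \<omega>. A \<omega> $$ (i, j)) ({..<n} \<times> {..<n})"
    and tot: "(\<Sum>i<n. \<Sum>j<n. \<integral>\<^sup>+\<omega>. ennreal ((A \<omega> $$ (i, j))\<^sup>2) \<partial>M) \<le> ennreal (K * (real n)\<^sup>2)"
    and conc: "\<forall>i<n. \<forall>j<n. concentration M (\<lambda>\<omega>. A \<omega> $$ (i, j)) 1 \<le> b"
    and j: "j < n"
    and col: "(\<integral>\<^sup>+\<omega>. ennreal ((vec_norm (col (A \<omega>) j))\<^sup>2) \<partial>M) \<le> ennreal (r * (real n)\<^sup>2)"
  interpret prob_space M by fact
  have Ac: "A \<omega> \<in> carrier_mat n n" if "\<omega> \<in> space M" for \<omega> using A that by blast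
  have meas: "(\<lambda>\<omega>. A \<omega> $$ (k, i)) \<in> borel_measurable M" if "i < n" "k < n" for i k
  proof -
    have "(case (k, i) of (i, j) \<Rightarrow> \<lambda>\<omega>. A \<omega> $$ (i, j)) \<in> borel_measurable M"
      using ind that unfolding indep_vars_def by blast
    then show ?thesis by simp
  qed
  \<comment> \<open>Row-major coding; \<open>A'\<close> reads only the indices
    \<open>i * n + k\<close> with \<open>i\<close> and \<open>k\<close> below \<open>n\<close>, so
    the tail of the sequence does not matter.\<close>
  define \<phi> where "\<phi> = (\<lambda>\<omega> m. A \<omega> $$ (m div n, m mod n))"
  define A' where "A' = (\<lambda>f :: nat \<Rightarrow> real. mat n n (\<lambda>(i, k). f (i * n + k)))"
  define M' where "M' = pushforward M \<phi>"
  have spM': "space M' = \<phi> ` space M" by (simp add: M'_def)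
  have A'\<phi>: "A' (\<phi> \<omega>) = A \<omega>" if "\<omega> \<in> space M" for \<omega>
    using Ac[OF that] by (intro eq_matI) (auto simp: A'_def \<phi>_def)
  let ?H = "\<lambda>\<omega>. other_cols_span n (A \<omega>) j" and ?H' = "\<lambda>f. other_cols_span n (A' f) j"
  have norm: "vec_norm x = sqrt (\<Sum>k<n. (x $ k)\<^sup>2)" if "x \<in> carrier_vec n" for x
    by (rule vec_norm_eq[OF that])
  have M': "prob_space M'"
    using prob_space_distr[OF measurable_pushforward] by (simp add: M'_def distr_pushforward)
  have ind': "prob_space.indep_vars M' (\<lambda>_. borel) (\<lambda>(i, j) f. A' f $$ (i, j)) ({..<n} \<times> {..<n})"
    unfolding M'_def
  proof (rule indep_vars_pushforward[OF _ _ ind])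
    show "{..<n} \<times> {..<n} \<noteq> {}" using j by auto
  qed (auto simp: A'\<phi>)
  have "(\<integral>\<^sup>+f. ennreal ((A' f $$ (i, k))\<^sup>2) \<partial>M') = (\<integral>\<^sup>+\<omega>. ennreal ((A \<omega> $$ (i, k))\<^sup>2) \<partial>M)"
    if "i < n" "k < n" for i k
    unfolding M'_def using meas[of k i] that by (intro nn_integral_pushforward) (auto simp: A'\<phi>)
  then have tot': "(\<Sum>i<n. \<Sum>j<n. \<integral>\<^sup>+f. ennreal ((A' f $$ (i, j))\<^sup>2) \<partial>M') \<le> ennreal (K * (real n)\<^sup>2)"
    using tot by simp
  have conc': "\<forall>i<n. \<forall>j<n. concentration M' (\<lambda>f. A' f $$ (i, j)) 1 \<le> b"
  proof (intro allI impI)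
    fix i k assume "i < n" "k < n"
    moreover have "concentration M' (\<lambda>f. A' f $$ (i, k)) 1 = concentration M (\<lambda>\<omega>. A \<omega> $$ (i, k)) 1"
      unfolding M'_def by (rule concentration_pushforward) (simp add: A'\<phi>)
    ultimately show "concentration M' (\<lambda>f. A' f $$ (i, k)) 1 \<le> b" using conc by simp
  qed
  have "(\<integral>\<^sup>+f. ennreal ((vec_norm (col (A' f) j))\<^sup>2) \<partial>M') = (\<integral>\<^sup>+\<omega>. ennreal ((vec_norm (col (A \<omega>) j))\<^sup>2) \<partial>M)"
    unfolding M'_def
  proof (rule nn_integral_pushforward)
    have [measurable]: "(\<lambda>\<omega>. \<Sum>k<n. (A \<omega> $$ (k, j))\<^sup>2) \<in> borel_measurable M"
      using meas j by (intro borel_measurable_sum borel_measurable_power) auto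
    have "(\<lambda>\<omega>. sqrt (\<Sum>k<n. (A \<omega> $$ (k, j))\<^sup>2)) \<in> borel_measurable M" by measurable
    moreover have "vec_norm (col (A \<omega>) j) = sqrt (\<Sum>k<n. (A \<omega> $$ (k, j))\<^sup>2)" if "\<omega> \<in> space M" for \<omega>
      using Ac[OF that] j by (subst norm) (auto intro!: sum.cong)
    ultimately have "(\<lambda>\<omega>. vec_norm (col (A \<omega>) j)) \<in> borel_measurable M" by (simp cong: measurable_cong)
    then show "(\<lambda>\<omega>. ennreal ((vec_norm (col (A \<omega>) j))\<^sup>2)) \<in> borel_measurable M" by measurable
  qed (simp add: A'\<phi>)
  then have col': "(\<integral>\<^sup>+f. ennreal ((vec_norm (col (A' f) j))\<^sup>2) \<partial>M') \<le> ennreal (r * (real n)\<^sup>2)"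
    using col by simp
  have carr': "\<forall>f\<in>space M'. A' f \<in> carrier_mat n n" by (simp add: A'_def)
  have bound': "(\<forall>v. (\<forall>f\<in>space M'. v f \<in> carrier_vec n) \<longrightarrow>
             (\<forall>k<n. (\<lambda>f. v f $ k) \<in> borel_measurable (subspace_sigma M' n ?H')) \<longrightarrow>
             (AE f in M'. vec_norm (v f) = 1) \<longrightarrow>
             (AE f in M'. \<forall>h\<in>?H' f. v f \<bullet> h = 0) \<longrightarrow>
             (\<forall>\<epsilon>\<ge>0. concentration M' (\<lambda>f. v f \<bullet> col (A' f) j) \<epsilon> \<le> C * \<epsilon> + 2 * exp (- c * real n))) \<and>
          (\<forall>\<epsilon>\<ge>0. measure M' {f \<in> space M'. vec_setdist (col (A' f) j) (?H' f) \<le> \<epsilon>} \<le> C * \<epsilon> + 2 * exp (- c * real n))"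
    using bound[unfolded distance_bound_def, rule_format, OF M' bspec[OF carr'] ind' tot' _ j col'] conc' by blast
  show "(\<forall>v :: 'w \<Rightarrow> real vec. (\<forall>\<omega>\<in>space M. v \<omega> \<in> carrier_vec n) \<longrightarrow>
             (\<forall>k<n. (\<lambda>\<omega>. v \<omega> $ k) \<in> borel_measurable (subspace_sigma M n ?H)) \<longrightarrow>
             (AE \<omega> in M. vec_norm (v \<omega>) = 1) \<longrightarrow>
             (AE \<omega> in M. \<forall>h\<in>?H \<omega>. v \<omega> \<bullet> h = 0) \<longrightarrow>
             (\<forall>\<epsilon>\<ge>0. concentration M (\<lambda>\<omega>. v \<omega> \<bullet> col (A \<omega>) j) \<epsilon> \<le> C * \<epsilon> + 2 * exp (- c * real n))) \<and>
          (\<forall>\<epsilon>\<ge>0. measure M {\<omega> \<in> space M. vec_setdist (col (A \<omega>) j) (?H \<omega>) \<le> \<epsilon>} \<le> C * \<epsilon> + 2 * exp (- c * real n))"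
  proof (intro conjI allI impI)
    fix \<epsilon> :: real assume "0 \<le> \<epsilon>"
    then have "measure M' {f \<in> space M'. vec_setdist (col (A' f) j) (?H' f) \<le> \<epsilon>} \<le> C * \<epsilon> + 2 * exp (- c * real n)"
      using bound' by blast
    also have "measure M' {f \<in> space M'. vec_setdist (col (A' f) j) (?H' f) \<le> \<epsilon>}
      = measure M {\<omega> \<in> space M. vec_setdist (col (A' (\<phi> \<omega>)) j) (?H' (\<phi> \<omega>)) \<le> \<epsilon>}"
      unfolding M'_def by (rule measure_pushforward)
    also have "{\<omega> \<in> space M. vec_setdist (col (A' (\<phi> \<omega>)) j) (?H' (\<phi> \<omega>)) \<le> \<epsilon>}
      = {\<omega> \<in> space M. vec_setdist (col (A \<omega>) j) (?H \<omega>) \<le> \<epsilon>}" using A'\<phi> by auto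
    finally show "measure M {\<omega> \<in> space M. vec_setdist (col (A \<omega>) j) (?H \<omega>) \<le> \<epsilon>} \<le> C * \<epsilon> + 2 * exp (- c * real n)" .
  next
    fix v :: "'w \<Rightarrow> real vec" and \<epsilon> :: real
    assume v: "\<forall>\<omega>\<in>space M. v \<omega> \<in> carrier_vec n"
      and vm: "\<forall>k<n. (\<lambda>\<omega>. v \<omega> $ k) \<in> borel_measurable (subspace_sigma M n ?H)"
      and v1: "AE \<omega> in M. vec_norm (v \<omega>) = 1" and vo: "AE \<omega> in M. \<forall>h\<in>?H \<omega>. v \<omega> \<bullet> h = 0"
      and \<epsilon>: "0 \<le> \<epsilon>"
    let ?G = "subspace_sigma M n ?H" and ?G' = "subspace_sigma M' n ?H'"
    have spG: "space ?G = space M" unfolding subspace_sigma_def by (rule space_measure_of) auto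
    have spG': "space ?G' = space M'" unfolding subspace_sigma_def by (rule space_measure_of) auto
    have "sets ?G \<subseteq> sets (vimage_algebra (space M) \<phi> ?G')"
    proof -
      have "{\<omega> \<in> space M. ?H \<omega> \<inter> U \<noteq> {}} \<in> sets (vimage_algebra (space M) \<phi> ?G')" if "vec_open n U" for U
      proof -
        have "{f \<in> space M'. ?H' f \<inter> U \<noteq> {}} \<in> sets ?G'"
          unfolding subspace_sigma_def using that by (subst sets_measure_of) (auto intro!: sigma_sets.Basic)
        then have "\<phi> -` {f \<in> space M'. ?H' f \<inter> U \<noteq> {}} \<inter> space M \<in> sets (vimage_algebra (space M) \<phi> ?G')"
          by (rule in_vimage_algebra)
        moreover have "\<phi> -` {f \<in> space M'. ?H' f \<inter> U \<noteq> {}} \<inter> space M = {\<omega> \<in> space M. ?H \<omega> \<inter> U \<noteq> {}}"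
        proof (rule Set.set_eqI)
          fix \<omega>
          have "\<omega> \<in> space M \<Longrightarrow> \<phi> \<omega> \<in> space M'" by (simp add: M'_def)
          then show "\<omega> \<in> \<phi> -` {f \<in> space M'. ?H' f \<inter> U \<noteq> {}} \<inter> space M \<longleftrightarrow> \<omega> \<in> {\<omega> \<in> space M. ?H \<omega> \<inter> U \<noteq> {}}"
            using A'\<phi> by (cases "\<omega> \<in> space M") simp_all
        qed
        ultimately show ?thesis by (rule back_subst[of "\<lambda>S. S \<in> _"])
      qed
      then have "sigma_sets (space M) {{\<omega> \<in> space M. ?H \<omega> \<inter> U \<noteq> {}} |U. vec_open n U}
          \<subseteq> sets (vimage_algebra (space M) \<phi> ?G')"
        using sets.sigma_sets_subset[of "{{\<omega> \<in> space M. ?H \<omega> \<inter> U \<noteq> {}} |U. vec_open n U}" "vimage_algebra (space M) \<phi> ?G'"] by auto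
      then show ?thesis unfolding subspace_sigma_def[of M] by (subst sets_measure_of) auto
    qed
    also have "sets (vimage_algebra (space M) \<phi> ?G') = {\<phi> -` E \<inter> space M | E. E \<in> sets ?G'}"
      by (rule sets_vimage_algebra2) (auto simp: spG' spM')
    finally have sub: "sets ?G \<subseteq> {\<phi> -` E \<inter> space M | E. E \<in> sets ?G'}" .
    have pull: "\<exists>E\<in>sets ?G'. (\<lambda>\<omega>. v \<omega> $ k) -` S \<inter> space M = \<phi> -` E \<inter> space M"
      if k: "k < n" and S: "S \<in> sets borel" for k S
    proof -
      have "(\<lambda>\<omega>. v \<omega> $ k) -` S \<inter> space M \<in> sets ?G"
        using measurable_sets[OF vm[rule_format, OF k] S] by (simp only: spG)
      from subsetD[OF sub this] show ?thesis by (elim CollectE exE conjE) (rule bexI)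
    qed
    \<comment> \<open>An arbitrary representative of each fibre; \<open>v'\<phi>\<close> shows that
      \<open>v'\<close> does not depend on the choice.\<close>
    define s where "s = inv_into (space M) \<phi>"
    define v' where "v' = (\<lambda>f. v (s f))"
    have s: "s f \<in> space M" "\<phi> (s f) = f" if "f \<in> \<phi> ` space M" for f
      unfolding s_def by (rule inv_into_into[OF that], rule f_inv_into_f[OF that])
    have vc: "v \<omega> \<in> carrier_vec n" if "\<omega> \<in> space M" for \<omega> using v that by (rule bspec)
    have v'\<phi>: "v' (\<phi> \<omega>) = v \<omega>" if \<omega>: "\<omega> \<in> space M" for \<omega>
    proof (rule eq_vecI)
      have s': "s (\<phi> \<omega>) \<in> space M" "\<phi> (s (\<phi> \<omega>)) = \<phi> \<omega>" using s[of "\<phi> \<omega>"] \<omega> by auto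
      show "dim_vec (v' (\<phi> \<omega>)) = dim_vec (v \<omega>)" 
        unfolding v'_def carrier_vecD[OF vc[OF s'(1)]] carrier_vecD[OF vc[OF \<omega>]] by (rule refl)
      fix k assume "k < dim_vec (v \<omega>)"
      then have "k < n" unfolding carrier_vecD[OF vc[OF \<omega>]] .
      from pull[OF this borel_singleton[OF sets.empty_sets]] obtain E
        where E: "(\<lambda>\<omega>. v \<omega> $ k) -` {v \<omega> $ k} \<inter> space M = \<phi> -` E \<inter> space M" ..
      \<comment> \<open>The level set of the coordinate through \<omega> is a preimage under \<phi>,
        hence contains the representative of the fibre of \<omega>.\<close>
      have "\<omega> \<in> \<phi> -` E \<inter> space M" using \<omega> unfolding E[symmetric] by simp
      then have "s (\<phi> \<omega>) \<in> \<phi> -` E \<inter> space M" using s' by simp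
      then show "v' (\<phi> \<omega>) $ k = v \<omega> $ k" unfolding E[symmetric] v'_def by simp
    qed
    have v': "\<forall>f\<in>space M'. v' f \<in> carrier_vec n" 
    proof
      fix f assume "f \<in> space M'"
      then show "v' f \<in> carrier_vec n" unfolding spM' v'_def by (intro vc s)
    qed
    have vm': "\<forall>k<n. (\<lambda>f. v' f $ k) \<in> borel_measurable ?G'"
    proof (intro allI impI measurableI)
      fix k and S :: "real set" assume k: "k < n" and S: "S \<in> sets borel"
      from pull[OF k S] obtain E where E: "E \<in> sets ?G'" "(\<lambda>\<omega>. v \<omega> $ k) -` S \<inter> space M = \<phi> -` E \<inter> space M" ..
      have "(\<lambda>f. v' f $ k) -` S \<inter> space ?G' = E"
      proof (intro subset_antisym subsetI)
        fix f assume "f \<in> (\<lambda>f. v' f $ k) -` S \<inter> space ?G'"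
        then have f: "v' f $ k \<in> S" "f \<in> \<phi> ` space M" by (simp_all add: spG' spM')
        from f(2) obtain \<omega> where \<omega>: "f = \<phi> \<omega>" "\<omega> \<in> space M" by (rule imageE)
        have "v \<omega> $ k \<in> S" using f(1) unfolding \<omega>(1) v'\<phi>[OF \<omega>(2)] .
        then have "\<omega> \<in> (\<lambda>\<omega>. v \<omega> $ k) -` S \<inter> space M" using \<omega>(2) by simp
        then show "f \<in> E" unfolding E(2) using \<omega> by simp
      next
        fix f assume f: "f \<in> E"
        then have sp: "f \<in> space ?G'" using sets.sets_into_space[OF E(1)] by blast
        then have "f \<in> \<phi> ` space M" by (simp only: spG' spM')
        then obtain \<omega> where \<omega>: "f = \<phi> \<omega>" "\<omega> \<in> space M" by (rule imageE)
        then have "\<omega> \<in> \<phi> -` E \<inter> space M" using f by simp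
        then have "v \<omega> $ k \<in> S" unfolding E(2)[symmetric] by simp
        then show "f \<in> (\<lambda>f. v' f $ k) -` S \<inter> space ?G'" using sp unfolding \<omega>(1) by (simp add: v'\<phi>[OF \<omega>(2)])
      qed
      then show "(\<lambda>f. v' f $ k) -` S \<inter> space ?G' \<in> sets ?G'" using E(1) by simp
    qed auto
    \<comment> \<open>\<open>AE_pushforward\<close> asks for events of \<open>M\<close>; they come
      from the inclusion of the \<sigma>-field of the span in that of the other columns.\<close>
    have vM: "(\<lambda>\<omega>. v \<omega> $ k) \<in> borel_measurable M" if k: "k < n" for k
    proof (rule measurableI)
      let ?B = "{..<n} \<times> ({..<n} - {j})"
      let ?U = "\<lambda>\<omega>. \<lambda>p\<in>?B. A \<omega> $$ p"
      fix S :: "real set" assume "S \<in> sets borel"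
      then have "(\<lambda>\<omega>. v \<omega> $ k) -` S \<inter> space M \<in> sets ?G" using measurable_sets[OF vm[rule_format, OF k]] unfolding spG by blast
      then have "(\<lambda>\<omega>. v \<omega> $ k) -` S \<inter> space M \<in> sets (vimage_algebra (space M) ?U (PiM ?B (\<lambda>_. borel)))"
        using sets_subspace_sigma_subset[where M = M and A = A and n = n and j = j, OF Ac] by blast
      moreover have "?U \<in> measurable M (PiM ?B (\<lambda>_. borel))"
        using meas by (intro measurable_restrict) auto
      then have "sets (vimage_algebra (space M) ?U (PiM ?B (\<lambda>_. borel))) \<subseteq> sets M"
        unfolding sets_vimage_algebra by (intro sets.sigma_sets_subset) (auto intro: measurable_sets)
      ultimately show "(\<lambda>\<omega>. v \<omega> $ k) -` S \<inter> space M \<in> sets M" by blast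
    qed auto
    have v1': "AE f in M'. vec_norm (v' f) = 1"
      unfolding M'_def
    proof (rule AE_pushforward)
      have "{\<omega> \<in> space M. sqrt (\<Sum>k<n. (v \<omega> $ k)\<^sup>2) = 1} \<in> sets M"
      proof -
        have [measurable]: "(\<lambda>\<omega>. \<Sum>k<n. (v \<omega> $ k)\<^sup>2) \<in> borel_measurable M"
          using vM by (intro borel_measurable_sum borel_measurable_power) auto
        show ?thesis by measurable
      qed
      also have "{\<omega> \<in> space M. sqrt (\<Sum>k<n. (v \<omega> $ k)\<^sup>2) = 1} = {\<omega> \<in> space M. vec_norm (v' (\<phi> \<omega>)) = 1}"
        using v by (intro Collect_cong conj_cong refl) (simp only: v'\<phi> norm)
      finally show "{\<omega> \<in> space M. vec_norm (v' (\<phi> \<omega>)) = 1} \<in> sets M" .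
      show "AE \<omega> in M. vec_norm (v' (\<phi> \<omega>)) = 1" using v1 AE_space by eventually_elim (simp add: v'\<phi>)
    qed
    have vo': "AE f in M'. \<forall>h\<in>?H' f. v' f \<bullet> h = 0"
      unfolding M'_def
    proof (rule AE_pushforward)
      have "{\<omega> \<in> space M. \<forall>i<n. i \<noteq> j \<longrightarrow> (\<Sum>k<n. v \<omega> $ k * A \<omega> $$ (k, i)) = 0} \<in> sets M"
      proof -
        have m: "(\<lambda>\<omega>. \<Sum>k<n. v \<omega> $ k * A \<omega> $$ (k, i)) \<in> borel_measurable M" if "i < n" for i
          using vM meas that by (intro borel_measurable_sum borel_measurable_times) auto
        have "{\<omega> \<in> space M. \<forall>i\<in>{..<n} - {j}. (\<Sum>k<n. v \<omega> $ k * A \<omega> $$ (k, i)) = 0} \<in> sets M"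
        proof (rule sets.sets_Collect_finite_All)
          fix i assume "i \<in> {..<n} - {j}"
          then have [measurable]: "(\<lambda>\<omega>. \<Sum>k<n. v \<omega> $ k * A \<omega> $$ (k, i)) \<in> borel_measurable M" using m by auto
          show "{\<omega> \<in> space M. (\<Sum>k<n. v \<omega> $ k * A \<omega> $$ (k, i)) = 0} \<in> sets M" by measurable
        qed auto
        then show ?thesis by (rule back_subst[of "\<lambda>S. S \<in> _"]) auto
      qed
      also have "{\<omega> \<in> space M. \<forall>i<n. i \<noteq> j \<longrightarrow> (\<Sum>k<n. v \<omega> $ k * A \<omega> $$ (k, i)) = 0}
          = {\<omega> \<in> space M. \<forall>h\<in>?H' (\<phi> \<omega>). v' (\<phi> \<omega>) \<bullet> h = 0}"
        using v by (intro Collect_cong conj_cong refl) (simp only: v'\<phi> A'\<phi> orthogonal_other_cols_span_iff[OF Ac])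
      finally show "{\<omega> \<in> space M. \<forall>h\<in>?H' (\<phi> \<omega>). v' (\<phi> \<omega>) \<bullet> h = 0} \<in> sets M" .
      show "AE \<omega> in M. \<forall>h\<in>?H' (\<phi> \<omega>). v' (\<phi> \<omega>) \<bullet> h = 0" using vo AE_space by eventually_elim (simp add: v'\<phi> A'\<phi>)
    qed
    have "concentration M' (\<lambda>f. v' f \<bullet> col (A' f) j) \<epsilon> \<le> C * \<epsilon> + 2 * exp (- c * real n)"
      by (rule conjunct1[OF bound', rule_format, OF bspec[OF v'] vm'[rule_format] v1' vo' \<epsilon>])
    also have "concentration M' (\<lambda>f. v' f \<bullet> col (A' f) j) \<epsilon> = concentration M (\<lambda>\<omega>. v \<omega> \<bullet> col (A \<omega>) j) \<epsilon>"
      unfolding M'_def by (rule concentration_pushforward) (simp add: v'\<phi> A'\<phi>)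
    finally show "concentration M (\<lambda>\<omega>. v \<omega> \<bullet> col (A \<omega>) j) \<epsilon> \<le> C * \<epsilon> + 2 * exp (- c * real n)" .
  qed
qed

theorem theorem1p2:
  fixes K b :: real
  assumes "K > 0" and "0 < b" and "b < 1"
  shows "(\<exists>r>0. \<exists>C>0. \<exists>c>0. distance_bound TYPE(nat \<Rightarrow> real) K b r C c) \<and>
         (\<forall>r>0. \<forall>C>0. \<forall>c>0. distance_bound TYPE(nat \<Rightarrow> real) K b r C c
            \<longrightarrow> distance_bound TYPE('w) K b r C c)"
proof (intro conjI allI impI)
  show "\<exists>r>0. \<exists>C>0. \<exists>c>0. distance_bound TYPE(nat \<Rightarrow> real) K b r C c"
    using assms(1,3) by (rule ex_distance_bound)
qed (rule distance_bound_transfer)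

end
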